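(* Let $M$ be a local generic real analytic CR-generic submanifold of $\mathbb C^{n+k}$ having positive codimension $k\ge1$ and positive CR dimension $n\ge1$, represented in local holomorphic coordinates $(z,w)=(z_1,\dots,z_n,w_1,\dots,w_k)$ centered at the origin $0\in M$ by $k$ complex defining equations $$\overline w_j+w_j=\overline\Xi_j(\overline z,z,w)\qquad(j=1,\dots,k),$$ with $\overline\Xi_j=\mathrm O(2)$. Introduce the power series expansion with respect to $(\overline z,z)$ $$-2w_j+\overline\Xi_j(\overline z,z,w)=:\sum_{\alpha\in\mathbb N^n}\sum_{\beta\in\mathbb N^n}\overline z^\alpha z^\beta\,\overline\Xi^{\sim}_{j,\alpha,\beta}(w)\qquad(j=1,\dots,k).$$ For all multiindices $\alpha,\beta\in\mathbb N^n$ and $\gamma=(\gamma_1,\dots,\gamma_k)\in\mathbb N^k$ introduce the explicit universal polynomial $\mathcal A_{\alpha,\beta,\gamma}$ in the functions $\overline\Xi^{\sim}_{\widehat j,\widehat\alpha,\widehat\beta}(w)$: $$\mathcal A_{\alpha,\beta,\gamma}\Big(\big\{\overline\Xi^{\sim}_{\widehat j,\widehat\alpha,\widehat\beta}(w)\big\}\Big):=\sum_{\substack{\alpha^1+\cdots+\alpha^k=\alpha\\ \beta^1+\cdots+\beta^k=\beta}}\ \sum_{\substack{\alpha^1_1+\cdots+\alpha^1_{\gamma_1}=\alpha^1\\ \beta^1_1+\cdots+\beta^1_{\gamma_1}=\beta^1}}\cdots\sum_{\substack{\alpha^k_1+\cdots+\alpha^k_{\gamma_k}=\alpha^k\\ \beta^k_1+\cdots+\beta^k_{\gamma_k}=\beta^k}}\overline\Xi^{\sim}_{1,\alpha^1_1,\beta^1_1}(w)\cdots\overline\Xi^{\sim}_{1,\alpha^1_{\gamma_1},\beta^1_{\gamma_1}}(w)\cdots\cdots\overline\Xi^{\sim}_{k,\alpha^k_1,\beta^k_1}(w)\cdots\overline\Xi^{\sim}_{k,\alpha^k_{\gamma_k},\beta^k_{\gamma_k}}(w).$$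 Then a general holomorphic vector field $$\mathsf X=\sum_{i=1}^nZ^i(z,w)\frac{\partial}{\partial z_i}+\sum_{l=1}^kW^l(z,w)\frac{\partial}{\partial w_l}$$ is an infinitesimal CR-automorphism of $M$ belonging to $\mathfrak{aut}_{CR}(M)$, namely $\overline{\mathsf X}+\mathsf X$ is tangent to $M$, if and only if, for every $j=1,\dots,k$, every $\alpha\in\mathbb N^n$ and every $\beta\in\mathbb N^n$, the following linear holomorphic partial differential equation $$\begin{aligned}0\equiv{}&\sum_{\gamma\in\mathbb N^k}\ \sum_{\alpha'+\alpha''=\alpha}\frac1{\gamma!}\,\mathcal A_{\alpha'',\beta,\gamma}\Big(\big\{\overline\Xi^{\sim}_{\widehat j,\widehat\alpha,\widehat\beta}(w)\big\}\Big)\cdot\frac{\partial^{|\gamma|}\overline W^{j,\alpha'}}{\partial w^\gamma}(w)\\ &-\sum_{i=1}^n\sum_{\gamma\in\mathbb N^k}\ \sum_{\alpha'+\alpha''=\alpha}\frac{1}{\gamma!}\,\mathcal A_{\alpha'',\beta,\gamma}\Big(\big\{\overline\Xi^{\sim}_{\widehat j,\widehat\alpha,\widehat\beta}(w)\big\}\Big)\cdot\frac{\partial^{|\gamma|}\overline Z^{i,\alpha'}}{\partial w^\gamma}(w)\\ &+\delta^{\mathbf 0}_\alpha\cdot W^{j,\beta}(w)\\ &-\sum_{i=1}^n\sum_{\beta'+\beta''=\beta}(\beta''_i+1)\,\overline\Xi^{\sim}_{j,\alpha,\beta''+\mathbf 1_i}(w)\cdot Z^{i,\beta'}(w)\\ &-2\,\delta^{\mathbf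 0}_\alpha\cdot W^{j,\beta}(w)-\sum_{l=1}^k\sum_{\beta'+\beta''=\beta}\frac{\partial\overline\Xi^{\sim}_{j,\alpha,\beta''}(w)}{\partial w_l}\,W^{l,\beta'}(w),\end{aligned}$$ which is linear with respect to the partial derivatives $$\frac{\partial^{|\gamma|}Z^{i,\alpha}}{\partial w^\gamma}(w),\quad\frac{\partial^{|\gamma'|}\overline Z^{i',\alpha'}}{\partial w^{\gamma'}}(w),\quad\frac{\partial^{|\gamma''|}W^{l,\alpha''}}{\partial w^{\gamma''}}(w),\quad\frac{\partial^{|\gamma'''|}\overline W^{l',\alpha'''}}{\partial w^{\gamma'''}}(w),$$ together with its conjugate, are satisfied identically in $\mathbb C\{w\}$ by the four families of functions $Z^{i,\alpha}(w)$, $\overline Z^{i',\alpha'}(w)$, $W^{l,\alpha''}(w)$, $\overline W^{l',\alpha'''}(w)$, depending only upon the $k$ holomorphic variables $(w_1,\dots,w_k)$.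
   Context: CR-genericity of $M\subset\mathbb C^{n+k}$ means $TM+JTM=T\mathbb C^{n+k}|_M$, where $J$ is the standard complex structure (multiplication by $i$). The coordinates are such that $T_0M=\{\overline w_j+w_j=0,\ j=1,\dots,k\}$. An infinitesimal CR-automorphism of $M$ is a $(1,0)$ vector field $\mathsf X$ with holomorphic coefficients such that $\mathsf X+\overline{\mathsf X}$ is tangent to $M$; $\mathfrak{aut}_{CR}(M)$ denotes the Lie algebra of all of them. The coefficients of $\mathsf X$ are expanded in powers of $z$: $Z^i(z,w)=\sum_{\alpha\in\mathbb N^n}z^\alpha Z^{i,\alpha}(w)$ and $W^l(z,w)=\sum_{\alpha\in\mathbb N^n}z^\alpha W^{l,\alpha}(w)$, with $Z^{i,\alpha},W^{l,\alpha}$ local holomorphic functions of $w$. For a convergent power series $A(w)$, $\overline A(w)$ denotes the series with complex-conjugated coefficients; $\overline Z^{i,\alpha}$ and $\overline W^{l,\alpha}$ are understood in this sense. $\mathbb C\{w\}$ is the ring of convergent power series in $w$. $\mathbf 0\in\mathbb N^n$ is the zero multiindex, $\mathbf 1_i\in\mathbb N^n$ is the multiindex with $1$ in position $i$ and $0$ elsewhere, and $\delta^{\mathsf b}_{\mathsf a}=1$ if $\mathsf a=\mathsf b$ and $0$ otherwise. The polynomial $\mathcal A_{\alpha,\beta,\gamma}$ arises as the coefficient of $\overline z^\alpha z^\beta$ in $\prod_{j=1}^k\big(-2w_j+\overline\Xi_j(\overline z,z,w)\big)^{\gamma_j}$.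
   Formalization: The second line of the equation is corrected: each Z̄^i term carries the omitted factor ∂Ξ̄_j/∂z̄_i, expanded in z̄ and z; as printed, the claim fails for M={w̄+w=0} and X=∂/∂z_i, where α=β=0 gives 0=-1. *)

theory Defs
  imports "HOL-Analysis.Analysis" "HOL-Library.Landau_Symbols"
begin

section \<open>Multiindices and convergent power series\<close>

text \<open>
  A multiindex is a vector of type \<open>nat ^ 'i\<close>, so that \<open>axis i 1\<close> is the multiindex with
  \<open>1\<close> in position \<open>i\<close> and \<open>0\<close> elsewhere.
\<close>

definition mpow :: "'a::comm_semiring_1 ^ 'i \<Rightarrow> nat ^ 'i \<Rightarrow> 'a" where
  "mpow x \<alpha> = (\<Prod>i\<in>UNIV. (x $ i) ^ (\<alpha> $ i))"

definition mfact :: "nat ^ 'i \<Rightarrow> complex" where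
  "mfact \<alpha> = (\<Prod>i\<in>UNIV. fact (\<alpha> $ i))"

text \<open>
  Elements of \<open>\<complex>{w}\<close> are given by their coefficient families. Two of them are equal iff the
  germs at \<open>0\<close> of the functions \<open>ps_eval a\<close> are equal. \<open>ps_bar\<close> conjugates the coefficients and
  not the variable; \<open>ps_deriv \<gamma>\<close> is the termwise partial derivative of multiorder \<open>\<gamma>\<close>.
\<close>

type_synonym 'k series = "nat ^ 'k \<Rightarrow> complex"

definition ps_eval :: "'k::finite series \<Rightarrow> complex ^ 'k \<Rightarrow> complex" where
  "ps_eval a w = (\<Sum>\<^sub>\<infinity>\<delta>. a \<delta> * mpow w \<delta>)"

definition ps_bar :: "'k series \<Rightarrow> 'k series" where
  "ps_bar a = (\<lambda>\<delta>. cnj (a \<delta>))"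

definition ps_deriv :: "nat ^ 'k \<Rightarrow> 'k::finite series \<Rightarrow> 'k series" where
  "ps_deriv \<gamma> a = (\<lambda>\<delta>. mfact (\<delta> + \<gamma>) / mfact \<delta> * a (\<delta> + \<gamma>))"

text \<open>
  Convergent expansions at the origin in powers of \<open>z\<close>, resp.\ of \<open>(\<zeta>, z)\<close>, whose coefficients
  are convergent power series in \<open>w\<close>. The variable \<open>\<zeta>\<close> stands for \<open>z\<close>-bar.
\<close>

definition expands_z ::
  "((complex ^ 'n) \<times> (complex ^ 'k) \<Rightarrow> complex) \<Rightarrow> (nat ^ 'n \<Rightarrow> 'k series) \<Rightarrow> bool" where
  "expands_z f c \<longleftrightarrow> (\<exists>r>0. \<forall>z w. norm z < r \<longrightarrow> norm w < r \<longrightarrow>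
     ((\<lambda>(\<beta>, \<delta>). c \<beta> \<delta> * mpow z \<beta> * mpow w \<delta>) has_sum f (z, w)) UNIV)"

definition expands_zz ::
  "((complex ^ 'n) \<times> (complex ^ 'n) \<times> (complex ^ 'k) \<Rightarrow> complex) \<Rightarrow>
   (nat ^ 'n \<Rightarrow> nat ^ 'n \<Rightarrow> 'k series) \<Rightarrow> bool" where
  "expands_zz f c \<longleftrightarrow> (\<exists>r>0. \<forall>\<zeta> z w. norm \<zeta> < r \<longrightarrow> norm z < r \<longrightarrow> norm w < r \<longrightarrow>
     ((\<lambda>(\<alpha>, \<beta>, \<delta>). c \<alpha> \<beta> \<delta> * mpow \<zeta> \<alpha> * mpow z \<beta> * mpow w \<delta>) has_sum f (\<zeta>, z, w)) UNIV)"

definition holomorphic_germ :: "((complex ^ 'n) \<times> (complex ^ 'k) \<Rightarrow> complex) \<Rightarrow> bool" where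
  "holomorphic_germ f \<longleftrightarrow> (\<exists>c. expands_z f c)"


section \<open>Real analytic and CR-generic submanifolds of \<open>\<complex>\<^sup>n\<^sup>+\<^sup>k\<close>\<close>

definition real_analytic_at :: "('a::euclidean_space \<Rightarrow> 'b::real_normed_vector) \<Rightarrow> 'a \<Rightarrow> bool" where
  "real_analytic_at f p \<longleftrightarrow> (\<exists>c. \<exists>r>0. \<forall>h. norm h < r \<longrightarrow>
     ((\<lambda>\<alpha>. (\<Prod>b\<in>Basis. (h \<bullet> b) ^ \<alpha> b) *\<^sub>R c \<alpha>) has_sum f (p + h))
       (Basis \<rightarrow>\<^sub>E (UNIV :: nat set)))"

text \<open>Embedded real analytic submanifolds of real dimension \<open>d\<close>: locally, a real analytic
  diffeomorphism with real analytic inverse straightens \<open>M\<close> to a linear subspace.\<close>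

definition real_analytic_submanifold :: "nat \<Rightarrow> 'a::euclidean_space set \<Rightarrow> bool" where
  "real_analytic_submanifold d M \<longleftrightarrow>
     (\<forall>p\<in>M. \<exists>U V \<Phi> \<Psi> (L :: 'a set).
        open U \<and> p \<in> U \<and> open V \<and> homeomorphism U V \<Phi> \<Psi> \<and>
        (\<forall>x\<in>U. real_analytic_at \<Phi> x) \<and> (\<forall>y\<in>V. real_analytic_at \<Psi> y) \<and>
        subspace L \<and> dim L = d \<and> \<Phi> ` (M \<inter> U) = L \<inter> V)"

definition tangent_space :: "'a::real_normed_vector set \<Rightarrow> 'a \<Rightarrow> 'a set" where
  "tangent_space M p = {v. \<exists>c. c 0 = p \<and> (\<forall>\<^sub>F t in nhds (0::real). c t \<in> M) \<and>
     (c has_vector_derivative v) (at 0)}"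

definition cplx_J :: "(complex ^ 'n) \<times> (complex ^ 'k) \<Rightarrow> (complex ^ 'n) \<times> (complex ^ 'k)" where
  "cplx_J = (\<lambda>(z, w). (\<i> *s z, \<i> *s w))"

definition CR_generic :: "((complex ^ 'n) \<times> (complex ^ 'k)) set \<Rightarrow> bool" where
  "CR_generic M \<longleftrightarrow>
     (\<forall>p\<in>M. {u + cplx_J v | u v. u \<in> tangent_space M p \<and> v \<in> tangent_space M p} = UNIV)"

definition has_CR_dim :: "nat \<Rightarrow> ((complex ^ 'n) \<times> (complex ^ 'k)) set \<Rightarrow> bool" where
  "has_CR_dim d M \<longleftrightarrow>
     (\<forall>p\<in>M. dim (tangent_space M p \<inter> cplx_J ` tangent_space M p) = 2 * d)"


section \<open>Infinitesimal CR-automorphisms\<close>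

text \<open>
  A complexified tangent vector \<open>u + iv\<close> at a point, with \<open>u\<close>, \<open>v\<close> real tangent vectors, is the
  pair \<open>(u, v)\<close>. With \<open>z = x + iy\<close> one has \<open>\<partial>/\<partial>z = 1/2 (\<partial>/\<partial>x - i \<partial>/\<partial>y)\<close>.
\<close>

type_synonym ('n, 'k) ctangent =
  "((complex ^ 'n) \<times> (complex ^ 'k)) \<times> ((complex ^ 'n) \<times> (complex ^ 'k))"

definition ct_scale :: "complex \<Rightarrow> ('n::finite, 'k::finite) ctangent \<Rightarrow> ('n, 'k) ctangent" where
  "ct_scale a = (\<lambda>(u, v). (Re a *\<^sub>R u - Im a *\<^sub>R v, Re a *\<^sub>R v + Im a *\<^sub>R u))"

definition ct_conj :: "('n::finite, 'k::finite) ctangent \<Rightarrow> ('n, 'k) ctangent" where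
  "ct_conj = (\<lambda>(u, v). (u, - v))"

definition d_dz :: "'n \<Rightarrow> ('n::finite, 'k::finite) ctangent" where
  "d_dz i = ((1/2) *\<^sub>R (axis i 1, 0), - (1/2) *\<^sub>R (axis i \<i>, 0))"

definition d_dw :: "'k \<Rightarrow> ('n::finite, 'k::finite) ctangent" where
  "d_dw l = ((1/2) *\<^sub>R (0, axis l 1), - (1/2) *\<^sub>R (0, axis l \<i>))"

definition vfield_10 ::
  "((complex ^ 'n) \<times> (complex ^ 'k) \<Rightarrow> (complex ^ 'n)) \<Rightarrow>
   ((complex ^ 'n) \<times> (complex ^ 'k) \<Rightarrow> (complex ^ 'k)) \<Rightarrow>
   (complex ^ 'n) \<times> (complex ^ 'k) \<Rightarrow> ('n::finite, 'k::finite) ctangent" where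
  "vfield_10 Z W p = (\<Sum>i\<in>UNIV. ct_scale (Z p $ i) (d_dz i)) + (\<Sum>l\<in>UNIV. ct_scale (W p $ l) (d_dw l))"

text \<open>\<open>M\<close> and the vector fields are germs at \<open>0\<close>; a vector field is given by its coefficient
  functions, and tangency is required at the points of \<open>M\<close> close to \<open>0\<close>.\<close>

definition aut_CR :: "((complex ^ 'n) \<times> (complex ^ 'k)) set \<Rightarrow>
    (((complex ^ 'n) \<times> (complex ^ 'k) \<Rightarrow> (complex ^ 'n)) \<times>
     ((complex ^ 'n) \<times> (complex ^ 'k) \<Rightarrow> (complex ^ 'k))) set" where
  "aut_CR M = {(Z, W).
     (\<forall>i. holomorphic_germ (\<lambda>p. Z p $ i)) \<and> (\<forall>l. holomorphic_germ (\<lambda>p. W p $ l)) \<and>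
     (\<forall>\<^sub>F p in nhds 0. p \<in> M \<longrightarrow>
        (\<exists>v\<in>tangent_space M p. ct_conj (vfield_10 Z W p) + vfield_10 Z W p = (v, 0)))}"

lemma vfield_10_eq:
  "vfield_10 Z W p = ((1/2) *\<^sub>R (Z p, W p), - (1/2) *\<^sub>R cplx_J (Z p, W p))"
proof -
  have z: "ct_scale a (d_dz i) = ((1/2) *\<^sub>R (axis i a, 0), - (1/2) *\<^sub>R (axis i (\<i> * a), 0))"
    for a and i :: 'a
    by (auto simp: ct_scale_def d_dz_def vec_eq_iff axis_def complex_eq_iff)
  have w: "ct_scale a (d_dw l) = ((1/2) *\<^sub>R (0, axis l a), - (1/2) *\<^sub>R (0, axis l (\<i> * a)))"
    for a and l :: 'b
    by (auto simp: ct_scale_def d_dw_def vec_eq_iff axis_def complex_eq_iff)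
  have s: "(\<Sum>i\<in>UNIV. axis i (x $ i)) = x" for x :: "complex ^ 'c"
    by (simp add: vec_eq_iff axis_def)
  have si: "(\<Sum>i\<in>UNIV. axis i (\<i> * x $ i)) = \<i> *s x" for x :: "complex ^ 'c"
    by (simp add: vec_eq_iff axis_def)
  show ?thesis
    by (simp add: vfield_10_def z w prod_eq_iff fst_sum snd_sum cplx_J_def s si
        sum_negf flip: scaleR_sum_right)
qed

lemma conj_plus_vfield_10:
  "ct_conj (vfield_10 Z W p) + vfield_10 Z W p = ((Z p, W p), 0)"
  by (simp add: vfield_10_eq ct_conj_def prod_eq_iff flip: scaleR_add_left)


section \<open>The determining equations\<close>

definition vec_cnj :: "complex ^ 'n \<Rightarrow> complex ^ 'n" where
  "vec_cnj z = (\<chi> i. cnj (z $ i))"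

text \<open>The decompositions of \<open>\<alpha>\<close> as an ordered sum of \<open>m\<close> multiindices (for \<open>m = 0\<close> there is one
  if \<open>\<alpha> = 0\<close> and none otherwise).\<close>

definition decomps :: "nat \<Rightarrow> nat ^ 'n \<Rightarrow> (nat \<Rightarrow> nat ^ 'n) set" where
  "decomps m \<alpha> = {t \<in> {..<m} \<rightarrow>\<^sub>E UNIV. (\<Sum>i<m. t i) = \<alpha>}"

text \<open>
  In \<open>calA\<close> the families \<open>a\<close>, \<open>b\<close> are \<open>(\<alpha>\<^sup>1,\<dots>,\<alpha>\<^sup>k)\<close>, \<open>(\<beta>\<^sup>1,\<dots>,\<beta>\<^sup>k)\<close>, and \<open>s j\<close>, \<open>t j\<close> are the
  decompositions of \<open>a j\<close>, \<open>b j\<close> into \<open>\<gamma>\<^sub>j\<close> multiindices. All the index sets are finite.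
\<close>

definition calA :: "('k \<Rightarrow> nat ^ 'n \<Rightarrow> nat ^ 'n \<Rightarrow> 'a::comm_semiring_1) \<Rightarrow>
    nat ^ 'n \<Rightarrow> nat ^ 'n \<Rightarrow> nat ^ 'k \<Rightarrow> 'a" where
  "calA X \<alpha> \<beta> \<gamma> =
     (\<Sum>(a, b) \<in> {(a, b). (\<Sum>j\<in>UNIV. a j) = \<alpha> \<and> (\<Sum>j\<in>UNIV. b j) = \<beta>}.
      \<Sum>(s, t) \<in> {(s, t). \<forall>j. s j \<in> decomps (\<gamma> $ j) (a j) \<and> t j \<in> decomps (\<gamma> $ j) (b j)}.
        \<Prod>j\<in>UNIV. \<Prod>m<\<gamma> $ j. X j (s j m) (t j m))"

text \<open>
  The coefficient of \<open>\<zeta>\<^sup>\<alpha> z\<^sup>\<beta>\<close> in \<open>(X-bar + X)(w-bar\<^sub>j + w\<^sub>j - \<Xi>\<^sub>j(\<zeta>, z, w))\<close> on \<open>M\<close>, where \<open>\<Xi>\<^sub>j\<close> is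
  the right-hand side of the \<open>j\<close>-th complex defining equation of \<open>M\<close>, and where \<open>A(w-bar)\<close>, for
  \<open>A\<close> in \<open>\<complex>{w}\<close>, is expanded by Taylor's formula at \<open>w\<close> with
  \<open>w-bar = w + (-2 w + \<Xi>(\<zeta>, z, w))\<close>. \<open>X j \<alpha> \<beta>\<close> is the coefficient of \<open>\<zeta>\<^sup>\<alpha> z\<^sup>\<beta>\<close> in
  \<open>-2 w\<^sub>j + \<Xi>\<^sub>j(\<zeta>, z, w)\<close>.

  In the second summand the coefficients of \<open>X-bar\<close> along \<open>\<partial>/\<partial>\<zeta>\<^sub>i\<close> are multiplied by
  \<open>\<partial>\<Xi>\<^sub>j/\<partial>\<zeta>\<^sub>i\<close>; this factor contributes \<open>(\<alpha>'''\<^sub>i + 1) X j (\<alpha>''' + axis i 1) \<beta>''\<close>. The source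
  prints the summand without it, which is a misprint: for \<open>M = {w-bar + w = 0}\<close> the
  field \<open>\<partial>/\<partial>z\<^sub>i\<close> is in \<open>aut_CR M\<close>, but without the factor the equation for \<open>\<alpha> = \<beta> = 0\<close>
  would read \<open>0 = -1\<close>.
\<close>

definition det_rhs :: "('k \<Rightarrow> nat ^ 'n \<Rightarrow> nat ^ 'n \<Rightarrow> 'k series) \<Rightarrow>
    ('n \<Rightarrow> nat ^ 'n \<Rightarrow> 'k series) \<Rightarrow> ('k \<Rightarrow> nat ^ 'n \<Rightarrow> 'k series) \<Rightarrow>
    'k \<Rightarrow> nat ^ 'n \<Rightarrow> nat ^ 'n \<Rightarrow> complex ^ 'k \<Rightarrow> complex" where
  "det_rhs X Z W j \<alpha> \<beta> w =
     (let Xw = (\<lambda>j \<alpha> \<beta>. ps_eval (X j \<alpha> \<beta>) w) in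
       (\<Sum>\<^sub>\<infinity>\<gamma>. \<Sum>(\<alpha>', \<alpha>'') | \<alpha>' + \<alpha>'' = \<alpha>.
          1 / mfact \<gamma> * calA Xw \<alpha>'' \<beta> \<gamma> * ps_eval (ps_deriv \<gamma> (ps_bar (W j \<alpha>'))) w)
     - (\<Sum>i\<in>UNIV. \<Sum>\<^sub>\<infinity>\<gamma>.
          \<Sum>(\<alpha>', \<alpha>'', \<alpha>''') | \<alpha>' + \<alpha>'' + \<alpha>''' = \<alpha>. \<Sum>(\<beta>', \<beta>'') | \<beta>' + \<beta>'' = \<beta>.
            1 / mfact \<gamma> * calA Xw \<alpha>'' \<beta>' \<gamma>
              * (of_nat (\<alpha>''' $ i + 1) * Xw j (\<alpha>''' + axis i 1) \<beta>'')
              * ps_eval (ps_deriv \<gamma> (ps_bar (Z i \<alpha>'))) w)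
     + of_bool (\<alpha> = 0) * ps_eval (W j \<beta>) w
     - (\<Sum>i\<in>UNIV. \<Sum>(\<beta>', \<beta>'') | \<beta>' + \<beta>'' = \<beta>.
          of_nat (\<beta>'' $ i + 1) * Xw j \<alpha> (\<beta>'' + axis i 1) * ps_eval (Z i \<beta>') w)
     - 2 * of_bool (\<alpha> = 0) * ps_eval (W j \<beta>) w
     - (\<Sum>l\<in>UNIV. \<Sum>(\<beta>', \<beta>'') | \<beta>' + \<beta>'' = \<beta>.
          ps_eval (ps_deriv (axis l 1) (X j \<alpha> \<beta>'')) w * ps_eval (W l \<beta>') w))"

text \<open>The conjugate equation: the coefficients of all the series involved are conjugated.\<close>

definition det_rhs_conj :: "('k \<Rightarrow> nat ^ 'n \<Rightarrow> nat ^ 'n \<Rightarrow> 'k series) \<Rightarrow>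
    ('n \<Rightarrow> nat ^ 'n \<Rightarrow> 'k series) \<Rightarrow> ('k \<Rightarrow> nat ^ 'n \<Rightarrow> 'k series) \<Rightarrow>
    'k \<Rightarrow> nat ^ 'n \<Rightarrow> nat ^ 'n \<Rightarrow> complex ^ 'k \<Rightarrow> complex" where
  "det_rhs_conj X Z W = det_rhs (\<lambda>j \<alpha> \<beta>. ps_bar (X j \<alpha> \<beta>))
     (\<lambda>i \<alpha>. ps_bar (Z i \<alpha>)) (\<lambda>l \<alpha>. ps_bar (W l \<alpha>))"

end

theory Submission
  imports Defs "HOL-Complex_Analysis.Conformal_Mappings"
begin

text \<open>
  Write \<open>X\<^sub>j = -2 w\<^sub>j + \<Xi>\<^sub>j\<close> for the given series, so that \<open>M\<close> is the zero set of the functions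
  \<open>\<rho>\<^sub>j = cnj w\<^sub>j - w\<^sub>j - X\<^sub>j(cnj z, z, w)\<close> near the origin (\<open>defining_fun\<close>). The proof compares three conditions on
  the vector field.

  Tangency and the differential. Near \<open>0\<close>, the tangent space of \<open>M\<close> at a point of \<open>M\<close> is the common
  kernel of the differentials \<open>d\<rho>\<^sub>j\<close> (proof of the theorem, from
  \<open>tangent_space_subset_kernel\<close>, \<open>tangent_space_contains_subspace\<close> and \<open>dim_kernel_le\<close>). Differentiating
  \<open>\<rho>\<^sub>j\<close> along a curve in \<open>M\<close> puts the tangent space inside the kernel. Conversely a chart provides a
  subspace of dimension \<open>2n + k\<close> of tangent vectors, and the kernel has at most that dimension: since
  \<open>\<Xi> = O(2)\<close>, the differentials at \<open>0\<close> are \<open>cnj w\<^sub>j + w\<^sub>j\<close>, so near \<open>0\<close> the kernel meets the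
  \<open>k\<close>-dimensional space of real \<open>w\<close>-directions only in \<open>0\<close>.

  From \<open>M\<close> to a full neighbourhood. On \<open>M\<close> one can replace \<open>cnj w\<close> by \<open>w + X(cnj z, z, w)\<close>, and
  \<open>d\<rho>\<^sub>j\<close> applied to the vector field becomes the value at \<open>(cnj z, z, w)\<close> of a function
  \<open>tangency\<close> that is holomorphic in the independent variables \<open>(\<zeta>, z, w)\<close>. If it vanishes at
  the points \<open>(cnj z, z, w)\<close> with \<open>(z, w)\<close> in \<open>M\<close>, it vanishes identically
  (\<open>zero_on_M_imp_zero\<close>): the homogeneous part of lowest degree of its expansion vanishes on all
  velocities at \<open>0\<close> of curves in that set. These velocities are the points \<open>(cnj z, z, w)\<close> with
  \<open>cnj w + w = 0\<close>; they form a totally real subspace of maximal dimension, on which no nonzero polynomial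
  vanishes (\<open>leading_form_vanishes\<close>, \<open>poly_zero_totally_real\<close>).

  Coefficients. For fixed small \<open>w\<close>, the coefficient of \<open>\<zeta>\<^sup>\<alpha> z\<^sup>\<beta>\<close> in \<open>tangency\<close> is the
  right-hand side of the determining equation (\<open>det_rhs_expansion\<close>): the series with conjugated
  coefficients are expanded by Taylor's formula at \<open>w\<close> with increment \<open>X\<close> (\<open>taylor_subst\<close>), and
  \<open>calA\<close> gives the coefficients of the powers of \<open>X\<close> (\<open>calA_eq_series_power\<close>). The function
  vanishes near \<open>0\<close> iff each of its coefficients is the zero germ in \<open>w\<close>; as the neighbourhoods on which the
  coefficients vanish may depend on \<open>\<alpha>\<close> and \<open>\<beta>\<close>, this uses a joint power series expansion
  in \<open>(\<zeta>, z, w)\<close> (\<open>tangency_zero_iff_det\<close>). The conjugate equation at \<open>w\<close> is the conjugate of the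
  equation at \<open>cnj w\<close> (\<open>det_rhs_conj_iff\<close>).

  All power series have index set \<open>nat ^ 'v\<close>; several groups of variables are merged into one by a sum
  type, e.g. \<open>'v = ('n + 'n) + 'k\<close> for \<open>(\<zeta>, z, w)\<close>.
\<close>

section \<open>Monomials and absolutely convergent power series\<close>

definition mdeg :: "nat ^ 'v \<Rightarrow> nat" where
  "mdeg \<alpha> = (\<Sum>i\<in>UNIV. \<alpha> $ i)"

definition polydisc :: "real \<Rightarrow> (complex ^ 'v) set" where
  "polydisc r = {x. \<forall>i. norm (x $ i) \<le> r}"

definition abs_conv :: "real \<Rightarrow> 'v::finite series \<Rightarrow> bool" where
  "abs_conv r a \<longleftrightarrow> (\<lambda>\<alpha>. norm (a \<alpha>) * r ^ mdeg \<alpha>) summable_on UNIV"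

text \<open>
  The weighted \<open>l\<^sup>1\<close> norm. It bounds the values on \<open>polydisc r\<close> and is submultiplicative,
  which is what makes compositions converge.
\<close>

definition wnorm :: "real \<Rightarrow> 'v::finite series \<Rightarrow> real" where
  "wnorm r a = (\<Sum>\<^sub>\<infinity>\<alpha>. norm (a \<alpha>) * r ^ mdeg \<alpha>)"

text \<open>
  The formal power series obtained from a family of terms \<open>c x\<close> times the monomial of exponent
  \<open>e x\<close> by collecting equal exponents. Cauchy products, powers, Taylor expansions and partial
  evaluations are all of this form, so that one rearrangement argument serves them all.
\<close>

definition collect :: "('x \<Rightarrow> complex) \<Rightarrow> ('x \<Rightarrow> nat ^ 'v) \<Rightarrow> 'x set \<Rightarrow> 'v series" where
  "collect c e A = (\<lambda>i. \<Sum>\<^sub>\<infinity>x\<in>{x\<in>A. e x = i}. c x)"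

lemma mpow_0 [simp]: "mpow x 0 = 1"
  by (simp add: mpow_def)

lemma mpow_add: "mpow x (\<alpha> + \<beta>) = mpow x \<alpha> * mpow x \<beta>"
  by (simp add: mpow_def power_add prod.distrib)

lemma mpow_sum: "finite S \<Longrightarrow> mpow x (sum u S) = (\<Prod>q\<in>S. mpow x (u q))"
  by (induction S rule: finite_induct) (auto simp: mpow_add)

lemma mdeg_0 [simp]: "mdeg 0 = 0"
  by (simp add: mdeg_def)

lemma mdeg_add: "mdeg (\<alpha> + \<beta>) = mdeg \<alpha> + mdeg \<beta>"
  by (simp add: mdeg_def sum.distrib)

lemma mdeg_sum: "mdeg (sum u S) = (\<Sum>q\<in>S. mdeg (u q))"
  by (induction S rule: infinite_finite_induct) (auto simp: mdeg_add)

lemma mdeg_eq_0_iff [simp]: "mdeg \<alpha> = 0 \<longleftrightarrow> \<alpha> = 0"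
  by (auto simp: mdeg_def vec_eq_iff)

lemma mpow_const: "mpow (\<chi> i. x) \<alpha> = x ^ mdeg \<alpha>"
  by (simp add: mpow_def mdeg_def power_sum)

lemma mpow_scale: "mpow (c *s x) \<alpha> = c ^ mdeg \<alpha> * mpow x \<alpha>"
  by (simp add: mpow_def mdeg_def power_sum power_mult_distrib prod.distrib)

lemma norm_mpow_le:
  assumes "x \<in> polydisc r"
  shows "norm (mpow x \<alpha>) \<le> r ^ mdeg \<alpha>"
proof -
  have "norm (mpow x \<alpha>) = (\<Prod>i\<in>UNIV. norm (x $ i) ^ (\<alpha> $ i))"
    by (simp add: mpow_def norm_power prod_norm[symmetric])
  also have "\<dots> \<le> (\<Prod>i\<in>UNIV. r ^ (\<alpha> $ i))"
    using assms by (intro prod_mono) (auto simp: polydisc_def intro!: power_mono)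
  finally show ?thesis
    by (simp add: mdeg_def power_sum)
qed

lemma polydisc_mono: "x \<in> polydisc r \<Longrightarrow> r \<le> s \<Longrightarrow> x \<in> polydisc s"
  unfolding polydisc_def using order_trans by blast

lemma zero_in_polydisc [simp]: "0 \<le> r \<Longrightarrow> 0 \<in> polydisc r"
  by (simp add: polydisc_def)

lemma abs_conv_mono:
  assumes "abs_conv s a" "0 \<le> r" "r \<le> s"
  shows "abs_conv r a"
  using assms(1) unfolding abs_conv_def
  by (rule summable_on_comparison_test)
     (use assms in \<open>auto intro!: mult_left_mono power_mono\<close>)

lemma abs_conv_summable:
  assumes "abs_conv r a" "x \<in> polydisc r"
  shows "(\<lambda>\<alpha>. a \<alpha> * mpow x \<alpha>) summable_on UNIV"
proof (rule abs_summable_summable, rule summable_on_comparison_test)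
  show "(\<lambda>\<alpha>. norm (a \<alpha>) * r ^ mdeg \<alpha>) summable_on UNIV"
    using assms(1) by (simp add: abs_conv_def)
qed (auto simp: norm_mult intro!: mult_left_mono norm_mpow_le assms)

lemma abs_conv_has_sum:
  assumes "abs_conv r a" "x \<in> polydisc r"
  shows "((\<lambda>\<alpha>. a \<alpha> * mpow x \<alpha>) has_sum ps_eval a x) UNIV"
  using abs_conv_summable[OF assms] by (simp add: ps_eval_def)

lemma ps_evalI: "((\<lambda>\<alpha>. a \<alpha> * mpow x \<alpha>) has_sum S) UNIV \<Longrightarrow> ps_eval a x = S"
  by (simp add: ps_eval_def infsumI)

lemma wnorm_nonneg: "0 \<le> r \<Longrightarrow> 0 \<le> wnorm r a"
  unfolding wnorm_def by (rule infsum_nonneg) auto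

lemma norm_ps_eval_le:
  assumes "abs_conv r a" "x \<in> polydisc r"
  shows "norm (ps_eval a x) \<le> wnorm r a"
  unfolding wnorm_def
  by (rule norm_infsum_le[OF abs_conv_has_sum[OF assms] has_sum_infsum])
     (use assms in \<open>auto simp: abs_conv_def norm_mult intro!: mult_left_mono norm_mpow_le\<close>)

lemma bij_betw_snd_fibres: "bij_betw snd (SIGMA i:UNIV. {x\<in>A. e x = i}) A"
  by (force simp: bij_betw_def inj_on_def)

lemma collect_has_sum:
  fixes c :: "'x \<Rightarrow> complex"
  assumes "((\<lambda>x. c x * mpow y (e x)) has_sum S) A"
    and "\<And>i. c summable_on {x\<in>A. e x = i}"
  shows "((\<lambda>i. collect c e A i * mpow y i) has_sum S) UNIV"
proof -
  let ?B = "SIGMA i:UNIV. {x\<in>A. e x = i}"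
  have "((\<lambda>p. c (snd p) * mpow y (e (snd p))) has_sum S) ?B"
    using has_sum_reindex_bij_betw[OF bij_betw_snd_fibres[of A e], of "\<lambda>x. c x * mpow y (e x)"] assms(1) by simp
  then show ?thesis
  proof (rule has_sum_SigmaD)
    fix i
    have "((\<lambda>x. c x * mpow y i) has_sum collect c e A i * mpow y i) {x\<in>A. e x = i}"
      unfolding collect_def by (intro has_sum_cmult_left has_sum_infsum assms)
    then show "((\<lambda>x. c (snd (i, x)) * mpow y (e (snd (i, x)))) has_sum collect c e A i * mpow y i)
        {x\<in>A. e x = i}"
      by (rule has_sum_cong[THEN iffD1, rotated]) auto
  qed
qed

text \<open>
  If the family converges absolutely at radius \<open>r\<close>, then so does the collected series, with no larger
  norm, and both have the same sum on the polydisc: unconditional sums may be computed fibrewise.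
\<close>

lemma collect:
  fixes c :: "'x \<Rightarrow> complex" and e :: "'x \<Rightarrow> nat ^ 'v"
  assumes sm: "(\<lambda>x. norm (c x) * r ^ mdeg (e x)) summable_on A" and r: "r > 0"
  shows collect_abs_conv: "abs_conv r (collect c e A)"
    and collect_wnorm: "wnorm r (collect c e A) \<le> (\<Sum>\<^sub>\<infinity>x\<in>A. norm (c x) * r ^ mdeg (e x))"
    and collect_fibre: "\<And>i. c summable_on {x\<in>A. e x = i}"
    and collect_eval: "\<And>y. y \<in> polydisc r \<Longrightarrow>
           ((\<lambda>x. c x * mpow y (e x)) has_sum ps_eval (collect c e A) y) A"
proof -
  let ?F = "\<lambda>i. {x\<in>A. e x = i}"
  have 1: "(\<lambda>x. norm (c x) * r ^ mdeg (e x)) summable_on ?F i" for i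
    using sm by (rule summable_on_subset_banach) auto
  have 2: "(\<lambda>x. norm (c x)) summable_on ?F i" for i
  proof -
    have "(\<lambda>x. norm (c x) * r ^ mdeg i) summable_on ?F i"
      using 1[of i] by (rule summable_on_cong[THEN iffD1, rotated]) auto
    then show ?thesis
      using r by (subst (asm) summable_on_cmult_left') auto
  qed
  have 3: "((\<lambda>x. norm (c x) * r ^ mdeg (e x)) has_sum (\<Sum>\<^sub>\<infinity>x\<in>?F i. norm (c x)) * r ^ mdeg i) (?F i)" for i
  proof -
    have "((\<lambda>x. norm (c x) * r ^ mdeg i) has_sum (\<Sum>\<^sub>\<infinity>x\<in>?F i. norm (c x)) * r ^ mdeg i) (?F i)"
      by (intro has_sum_cmult_left has_sum_infsum 2)
    then show ?thesis
      by (rule has_sum_cong[THEN iffD1, rotated]) auto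
  qed
  have 4: "((\<lambda>i. (\<Sum>\<^sub>\<infinity>x\<in>?F i. norm (c x)) * r ^ mdeg i) has_sum
      (\<Sum>\<^sub>\<infinity>x\<in>A. norm (c x) * r ^ mdeg (e x))) UNIV"
  proof (rule has_sum_SigmaD)
    show "((\<lambda>p. norm (c (snd p)) * r ^ mdeg (e (snd p))) has_sum (\<Sum>\<^sub>\<infinity>x\<in>A. norm (c x) * r ^ mdeg (e x)))
        (SIGMA i:UNIV. ?F i)"
      using has_sum_reindex_bij_betw[OF bij_betw_snd_fibres[of A e], of "\<lambda>x. norm (c x) * r ^ mdeg (e x)"] sm
      by simp
  qed (use 3 in simp)
  have 5: "norm (collect c e A i) \<le> (\<Sum>\<^sub>\<infinity>x\<in>?F i. norm (c x))" for i
    unfolding collect_def by (rule norm_infsum_bound[OF 2])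
  show 8: "c summable_on ?F i" for i
    by (rule abs_summable_summable[OF 2])
  show 6: "abs_conv r (collect c e A)"
    unfolding abs_conv_def
    by (rule summable_on_comparison_test[OF has_sum_imp_summable[OF 4]])
       (use r in \<open>auto intro!: mult_right_mono 5\<close>)
  show "wnorm r (collect c e A) \<le> (\<Sum>\<^sub>\<infinity>x\<in>A. norm (c x) * r ^ mdeg (e x))"
    unfolding wnorm_def
    by (rule has_sum_mono[OF has_sum_infsum 4])
       (use 6 r in \<open>auto simp: abs_conv_def intro!: mult_right_mono 5\<close>)
  fix y :: "complex ^ 'v" assume y: "y \<in> polydisc r"
  have "(\<lambda>x. c x * mpow y (e x)) summable_on A"
    by (rule abs_summable_summable, rule summable_on_comparison_test[OF sm])
       (auto simp: norm_mult intro!: mult_left_mono norm_mpow_le y)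
  then have 7: "((\<lambda>x. c x * mpow y (e x)) has_sum (\<Sum>\<^sub>\<infinity>x\<in>A. c x * mpow y (e x))) A"
    by simp
  have "((\<lambda>i. collect c e A i * mpow y i) has_sum (\<Sum>\<^sub>\<infinity>x\<in>A. c x * mpow y (e x))) UNIV"
    by (rule collect_has_sum[OF 7 8])
  then show "((\<lambda>x. c x * mpow y (e x)) has_sum ps_eval (collect c e A) y) A"
    using 7 ps_evalI by metis
qed

section \<open>Products, powers and composition\<close>

lemma has_sum_prod_Times_real:
  fixes f g :: "_ \<Rightarrow> real"
  assumes "f summable_on A" "g summable_on B" "\<And>x. x \<in> A \<Longrightarrow> 0 \<le> f x" "\<And>y. y \<in> B \<Longrightarrow> 0 \<le> g y"
  shows "((\<lambda>(x, y). f x * g y) has_sum (infsum f A * infsum g B)) (A \<times> B)"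
proof (rule has_sum_SigmaI)
  show "((\<lambda>y. case (x, y) of (x, y) \<Rightarrow> f x * g y) has_sum f x * infsum g B) B" for x
    using assms by (auto intro!: has_sum_cmult_right)
  show "((\<lambda>x. f x * infsum g B) has_sum infsum f A * infsum g B) A"
    using assms by (auto intro!: has_sum_cmult_left)
  show "(\<lambda>(x, y). f x * g y) summable_on (SIGMA x:A. B)"
  proof (rule summable_on_SigmaI)
    show "((\<lambda>y. case (x, y) of (x, y) \<Rightarrow> f x * g y) has_sum f x * infsum g B) B" for x
      using assms by (auto intro!: has_sum_cmult_right)
    show "(\<lambda>x. f x * infsum g B) summable_on A"
      using assms by (auto intro!: summable_on_cmult_left)
  qed (use assms in auto)
qed

lemma has_sum_prod_Times_complex:
  fixes f g :: "_ \<Rightarrow> complex"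
  assumes "(f has_sum S) A" "(g has_sum T) B"
  shows "((\<lambda>(x, y). f x * g y) has_sum (S * T)) (A \<times> B)"
proof (rule has_sum_SigmaI)
  show "((\<lambda>y. case (x, y) of (x, y) \<Rightarrow> f x * g y) has_sum f x * T) B" for x
    using assms by (auto intro!: has_sum_cmult_right)
  show "((\<lambda>x. f x * T) has_sum S * T) A"
    using assms by (auto intro!: has_sum_cmult_left)
  have "((\<lambda>(x, y). norm (f x) * norm (g y)) has_sum (\<Sum>\<^sub>\<infinity>x\<in>A. norm (f x)) * (\<Sum>\<^sub>\<infinity>y\<in>B. norm (g y))) (A \<times> B)"
    using assms by (intro has_sum_prod_Times_real)
       (auto simp: summable_on_iff_abs_summable_on_complex[symmetric] has_sum_imp_summable)
  then have "(\<lambda>(x, y). norm (f x) * norm (g y)) summable_on A \<times> B"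
    by (rule has_sum_imp_summable)
  then show "(\<lambda>(x, y). f x * g y) summable_on (SIGMA x:A. B)"
    by (subst summable_on_iff_abs_summable_on_complex) (auto simp: norm_mult case_prod_unfold)
qed

lemma finite_add_decomps: "finite {(\<alpha>, \<beta>). \<alpha> + \<beta> = (\<gamma> :: nat ^ 'v)}"
proof -
  have "{(\<alpha>, \<beta>). \<alpha> + \<beta> = \<gamma>} \<subseteq> (\<lambda>(f, g). (vec_lambda f, vec_lambda g)) `
      ((UNIV \<rightarrow>\<^sub>E {..mdeg \<gamma>}) \<times> (UNIV \<rightarrow>\<^sub>E {..mdeg \<gamma>}))"
  proof safe
    fix \<alpha> \<beta> :: "nat ^ 'v" assume g: "\<gamma> = \<alpha> + \<beta>"
    have "\<alpha> $ i \<le> mdeg \<alpha>" "\<beta> $ i \<le> mdeg \<beta>" for i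
      by (auto simp: mdeg_def intro: member_le_sum)
    then have "\<alpha> $ i \<le> mdeg (\<alpha> + \<beta>)" "\<beta> $ i \<le> mdeg (\<alpha> + \<beta>)" for i
      by (auto simp: mdeg_add intro: trans_le_add1 trans_le_add2)
    then show "(\<alpha>, \<beta>) \<in> (\<lambda>(f, g). (vec_lambda f, vec_lambda g)) `
      ((UNIV \<rightarrow>\<^sub>E {..mdeg (\<alpha> + \<beta>)}) \<times> (UNIV \<rightarrow>\<^sub>E {..mdeg (\<alpha> + \<beta>)}))"
      by (intro rev_image_eqI[of "(vec_nth \<alpha>, vec_nth \<beta>)"]) (auto simp: PiE_def)
  qed
  then show ?thesis
    by (rule finite_subset) (intro finite_imageI finite_cartesian_product finite_PiE; simp)
qed

definition cauchy :: "'v::finite series \<Rightarrow> 'v series \<Rightarrow> 'v series" where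
  "cauchy a b k = (\<Sum>(i, j) | i + j = k. a i * b j)"

lemma cauchy:
  fixes a b :: "'v::finite series"
  assumes "abs_conv r a" "abs_conv r b" "r > 0"
  shows abs_conv_cauchy: "abs_conv r (cauchy a b)"
    and ps_eval_cauchy: "\<And>x. x \<in> polydisc r \<Longrightarrow> ps_eval (cauchy a b) x = ps_eval a x * ps_eval b x"
proof -
  let ?c = "\<lambda>(i, j). a i * b j" and ?e = "\<lambda>(i, j). i + j"
  have *: "cauchy a b = collect ?c ?e UNIV"
    by (simp add: collect_def cauchy_def fun_eq_iff case_prod_unfold
        infsum_finite finite_add_decomps[unfolded case_prod_unfold])
  have sm: "(\<lambda>x. norm (?c x) * r ^ mdeg (?e x)) summable_on UNIV"
    using has_sum_imp_summable[OF has_sum_prod_Times_real[OF assms(1,2)[unfolded abs_conv_def]]] assms(3)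
    by (simp add: case_prod_unfold mdeg_add power_add norm_mult mult_ac)
  show "abs_conv r (cauchy a b)"
    unfolding * by (rule collect_abs_conv[OF sm assms(3)])
  fix x :: "complex ^ 'v" assume x: "x \<in> polydisc r"
  have "((\<lambda>p. ?c p * mpow x (?e p)) has_sum ps_eval (cauchy a b) x) UNIV"
    unfolding * by (rule collect_eval[OF sm assms(3) x])
  moreover have "((\<lambda>p. ?c p * mpow x (?e p)) has_sum ps_eval a x * ps_eval b x) UNIV"
    using has_sum_prod_Times_complex[OF abs_conv_has_sum[OF assms(1) x] abs_conv_has_sum[OF assms(2) x]]
    by (simp add: case_prod_unfold mpow_add mult_ac)
  ultimately show "ps_eval (cauchy a b) x = ps_eval a x * ps_eval b x"
    by (rule has_sum_unique)
qed

lemma summable_on_prod_PiE: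
  fixes f :: "'q \<Rightarrow> 'b \<Rightarrow> real"
  assumes "finite S" "\<And>q. q \<in> S \<Longrightarrow> f q summable_on B q" "\<And>q x. 0 \<le> f q x"
  shows "(\<lambda>u. \<Prod>q\<in>S. f q (u q)) summable_on PiE S B"
  using assms(1,2)
proof (induction S rule: finite_induct)
  case (insert x S)
  have "(\<lambda>(y, u). f x y * (\<Prod>q\<in>S. f q (u q))) summable_on B x \<times> PiE S B"
    using insert assms(3) by (intro has_sum_imp_summable[OF has_sum_prod_Times_real]) (auto intro: prod_nonneg)
  then have "(\<lambda>z. \<Prod>q\<in>insert x S. f q ((case z of (y, g) \<Rightarrow> g(x := y)) q)) summable_on B x \<times> PiE S B"
  proof (rule summable_on_cong[THEN iffD1, rotated])
    fix z :: "'b \<times> ('q \<Rightarrow> 'b)"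
    have "(\<Prod>q\<in>S. f q (((snd z)(x := fst z)) q)) = (\<Prod>q\<in>S. f q (snd z q))"
      using insert(2) by (intro prod.cong) auto
    then show "(case z of (y, u) \<Rightarrow> f x y * (\<Prod>q\<in>S. f q (u q))) =
        (\<Prod>q\<in>insert x S. f q ((case z of (y, g) \<Rightarrow> g(x := y)) q))"
      using insert(1,2) by (simp add: case_prod_unfold)
  qed
  moreover have "bij_betw (\<lambda>(y, g). g(x := y)) (B x \<times> PiE S B) (PiE (insert x S) B)"
    unfolding PiE_insert_eq by (rule inj_on_imp_bij_betw[OF inj_combinator[OF insert(2)]])
  ultimately show ?case
    by (simp only: summable_on_reindex_bij_betw[where f = "\<lambda>u. \<Prod>q\<in>insert x S. f q (u q)"])
qed auto

text \<open>
  The factors of a product of \<open>\<gamma>\<^sub>1\<close> copies of the first series, \<open>\<gamma>\<^sub>2\<close> copies of the second, and so on.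
  The pair \<open>(j, m)\<close> is the \<open>m\<close>-th copy of the \<open>j\<close>-th series.
\<close>

definition slots :: "nat ^ 'k \<Rightarrow> ('k \<times> nat) set" where
  "slots \<gamma> = (SIGMA j:UNIV. {..<\<gamma> $ j})"

text \<open>
  The coefficients of the product of the \<open>b\<^sub>j\<close> to the powers \<open>\<gamma>\<^sub>j\<close>: one exponent is chosen in each
  factor and the choices with a given sum are collected. This is \<open>calA\<close> for an arbitrary number of
  variables.
\<close>

definition series_power :: "('k \<Rightarrow> 'v::finite series) \<Rightarrow> nat ^ 'k \<Rightarrow> 'v series" where
  "series_power b \<gamma> = collect (\<lambda>u. \<Prod>q\<in>slots \<gamma>. b (fst q) (u q)) (\<lambda>u. \<Sum>q\<in>slots \<gamma>. u q)
     (slots \<gamma> \<rightarrow>\<^sub>E UNIV)"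

lemma finite_slots [simp]: "finite (slots \<gamma>)"
  unfolding slots_def by (rule finite_SigmaI) auto

lemma prod_slots: "(\<Prod>q\<in>slots \<gamma>. f (fst q)) = (\<Prod>j\<in>UNIV. f j ^ (\<gamma> $ j))"
  using prod.Sigma[of UNIV "\<lambda>j. {..<\<gamma> $ j}" "\<lambda>j m. f j"]
  by (simp add: slots_def case_prod_unfold)

text \<open>
  Expanding a finite product of absolutely convergent sums gives the sum over all choices, one
  per factor.
\<close>

lemma series_power:
  assumes "\<And>j. abs_conv r (b j)" "r > 0"
  shows abs_conv_series_power: "abs_conv r (series_power b \<gamma>)"
    and wnorm_series_power: "wnorm r (series_power b \<gamma>) \<le> (\<Prod>j\<in>UNIV. wnorm r (b j) ^ (\<gamma> $ j))"
    and ps_eval_series_power: "\<And>y. y \<in> polydisc r \<Longrightarrow> ps_eval (series_power b \<gamma>) y = mpow (\<chi> j. ps_eval (b j) y) \<gamma>"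
proof -
  let ?c = "\<lambda>u. \<Prod>q\<in>slots \<gamma>. b (fst q) (u q)" and ?e = "\<lambda>u. \<Sum>q\<in>slots \<gamma>. u q"
  let ?A = "slots \<gamma> \<rightarrow>\<^sub>E UNIV"
  have eq: "norm (?c u) * r ^ mdeg (?e u) = (\<Prod>q\<in>slots \<gamma>. norm (b (fst q) (u q)) * r ^ mdeg (u q))" for u
    by (simp add: mdeg_sum power_sum prod.distrib prod_norm)
  have sm: "(\<lambda>u. norm (?c u) * r ^ mdeg (?e u)) summable_on ?A"
    unfolding eq
    by (rule summable_on_prod_PiE[where f = "\<lambda>q k. norm (b (fst q) k) * r ^ mdeg k"])
       (use assms in \<open>auto simp: abs_conv_def\<close>)
  have val: "(\<Sum>\<^sub>\<infinity>u\<in>?A. norm (?c u) * r ^ mdeg (?e u)) = (\<Prod>j\<in>UNIV. wnorm r (b j) ^ (\<gamma> $ j))"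
    unfolding eq
    by (subst infsum_prod_PiE_abs[where f = "\<lambda>q k. norm (b (fst q) k) * r ^ mdeg k"])
       (use assms in \<open>auto simp: abs_conv_def wnorm_def prod_slots[of "\<lambda>j. \<Sum>\<^sub>\<infinity>k. norm (b j k) * r ^ mdeg k"]\<close>)
  show "abs_conv r (series_power b \<gamma>)"
    unfolding series_power_def by (rule collect_abs_conv[OF sm assms(2)])
  show "wnorm r (series_power b \<gamma>) \<le> (\<Prod>j\<in>UNIV. wnorm r (b j) ^ (\<gamma> $ j))"
    unfolding series_power_def val[symmetric] by (rule collect_wnorm[OF sm assms(2)])
  fix y :: "complex ^ 'b" assume y: "y \<in> polydisc r"
  have "((\<lambda>u. ?c u * mpow y (?e u)) has_sum ps_eval (series_power b \<gamma>) y) ?A"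
    unfolding series_power_def by (rule collect_eval[OF sm assms(2) y])
  then have "ps_eval (series_power b \<gamma>) y = (\<Sum>\<^sub>\<infinity>u\<in>?A. \<Prod>q\<in>slots \<gamma>. b (fst q) (u q) * mpow y (u q))"
    by (simp add: infsumI mpow_sum prod.distrib)
  also have "\<dots> = (\<Prod>q\<in>slots \<gamma>. ps_eval (b (fst q)) y)"
    unfolding ps_eval_def
    by (rule infsum_prod_PiE_abs[where f = "\<lambda>q k. b (fst q) k * mpow y k"])
       (use abs_conv_summable[OF assms(1) y] in \<open>auto simp: summable_on_iff_abs_summable_on_complex[symmetric]\<close>)
  also have "\<dots> = mpow (\<chi> j. ps_eval (b j) y) \<gamma>"
    using prod_slots[of "\<lambda>j. ps_eval (b j) y"] by (simp add: mpow_def)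
  finally show "ps_eval (series_power b \<gamma>) y = mpow (\<chi> j. ps_eval (b j) y) \<gamma>" .
qed

lemma wnorm_series_power_le:
  assumes "\<And>j. abs_conv r (b j)" "r > 0" "\<And>j. wnorm r (b j) \<le> s"
  shows "wnorm r (series_power b \<gamma>) \<le> s ^ mdeg \<gamma>"
proof -
  have "wnorm r (series_power b \<gamma>) \<le> (\<Prod>j\<in>UNIV. wnorm r (b j) ^ (\<gamma> $ j))"
    by (rule wnorm_series_power[OF assms(1,2)])
  also have "\<dots> \<le> (\<Prod>j\<in>UNIV. s ^ (\<gamma> $ j))"
    using assms(3) wnorm_nonneg[OF less_imp_le[OF assms(2)]] by (intro prod_mono) (auto intro!: power_mono)
  finally show ?thesis
    by (simp add: mdeg_def power_sum)
qed

lemma series_powers_summable: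
  fixes a :: "'k::finite series" and b :: "'k \<Rightarrow> 'v::finite series"
  assumes "abs_conv s a" "\<And>j. abs_conv r (b j)" "r > 0" "\<And>j. wnorm r (b j) \<le> s"
  shows "(\<lambda>(\<gamma>, i). norm (a \<gamma>) * (norm (series_power b \<gamma> i) * r ^ mdeg i)) summable_on UNIV"
proof -
  have "(\<lambda>(\<gamma>, i). norm (a \<gamma>) * (norm (series_power b \<gamma> i) * r ^ mdeg i)) summable_on (SIGMA \<gamma>:UNIV. UNIV)"
  proof (rule summable_on_SigmaI)
    fix \<gamma> :: "nat ^ 'k"
    show "((\<lambda>i. case (\<gamma>, i) of (\<gamma>, i) \<Rightarrow> norm (a \<gamma>) * (norm (series_power b \<gamma> i) * r ^ mdeg i)) has_sum
      norm (a \<gamma>) * wnorm r (series_power b \<gamma>)) UNIV"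
      using abs_conv_series_power[OF assms(2,3), where \<gamma> = \<gamma>]
      by (auto intro!: has_sum_cmult_right has_sum_infsum simp: wnorm_def abs_conv_def)
  next
    have "wnorm r (series_power b \<gamma>) \<le> s ^ mdeg \<gamma>" for \<gamma>
      by (rule wnorm_series_power_le[OF assms(2-4)])
    then show "(\<lambda>\<gamma>. norm (a \<gamma>) * wnorm r (series_power b \<gamma>)) summable_on UNIV"
      using assms(1,3) unfolding abs_conv_def
      by (elim summable_on_comparison_test) (auto intro!: mult_left_mono mult_nonneg_nonneg wnorm_nonneg)
  qed (use assms(3) in auto)
  then show ?thesis by simp
qed

lemma in_polydisc_ps_eval:
  assumes "\<And>j. abs_conv r (b j)" "\<And>j. wnorm r (b j) \<le> s" "y \<in> polydisc r"
  shows "(\<chi> j. ps_eval (b j) y) \<in> polydisc s"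
  using norm_ps_eval_le[OF assms(1,3)] assms(2) by (auto simp: polydisc_def intro: order_trans)

text \<open>
  Substitution of power series is an absolutely convergent double sum once the inner series have
  weighted norms at most a radius of convergence of the outer one.
\<close>

lemma ps_compose:
  fixes a :: "'k::finite series" and b :: "'k \<Rightarrow> 'v::finite series"
  assumes "abs_conv s a" "\<And>j. abs_conv r (b j)" "r > 0" "\<And>j. wnorm r (b j) \<le> s"
  shows "\<exists>c. abs_conv r c \<and> (\<forall>y\<in>polydisc r. ps_eval c y = ps_eval a (\<chi> j. ps_eval (b j) y))"
proof -
  let ?c = "\<lambda>(\<gamma>, i). a \<gamma> * series_power b \<gamma> i"
  have sm: "(\<lambda>x. norm (?c x) * r ^ mdeg (snd x)) summable_on UNIV"
    using series_powers_summable[OF assms] by (simp add: case_prod_unfold norm_mult mult_ac)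
  have "ps_eval (collect ?c snd UNIV) y = ps_eval a (\<chi> j. ps_eval (b j) y)" if y: "y \<in> polydisc r" for y
  proof -
    have "((\<lambda>x. ?c x * mpow y (snd x)) has_sum ps_eval (collect ?c snd UNIV) y) (SIGMA \<gamma>:UNIV. UNIV)"
      using collect_eval[OF sm assms(3) y] by simp
    then have "((\<lambda>\<gamma>. a \<gamma> * ps_eval (series_power b \<gamma>) y) has_sum ps_eval (collect ?c snd UNIV) y) UNIV"
    proof (rule has_sum_SigmaD)
      show "((\<lambda>i. ?c (\<gamma>, i) * mpow y (snd (\<gamma>, i))) has_sum a \<gamma> * ps_eval (series_power b \<gamma>) y) UNIV" for \<gamma>
        using has_sum_cmult_right[OF abs_conv_has_sum[OF abs_conv_series_power[OF assms(2,3)] y], of "a \<gamma>"]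
        by (simp add: mult_ac)
    qed
    then show ?thesis
      unfolding ps_eval_series_power[OF assms(2,3) y] by (simp add: ps_evalI)
  qed
  then show ?thesis
    using collect_abs_conv[OF sm assms(3)] by blast
qed

section \<open>Taylor expansion\<close>

lemma mfact_nonzero [simp]: "mfact \<alpha> \<noteq> 0"
  by (simp add: mfact_def)

lemma mfact_0 [simp]: "mfact 0 = 1"
  by (simp add: mfact_def)

definition mbinom :: "nat ^ 'v \<Rightarrow> nat ^ 'v \<Rightarrow> nat" where
  "mbinom \<gamma> \<delta> = (\<Prod>i\<in>UNIV. (\<gamma> $ i + \<delta> $ i) choose (\<gamma> $ i))"

lemma mbinom: "of_nat (mbinom \<gamma> \<delta>) = mfact (\<gamma> + \<delta>) / (mfact \<gamma> * mfact \<delta>)"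
proof -
  have "(of_nat ((m + n) choose m) :: complex) = fact (m + n) / (fact m * fact n)" for m n
    using binomial_fact[of m "m + n", where ?'a = complex] by simp
  then show ?thesis
    by (simp add: mbinom_def mfact_def prod_dividef prod.distrib)
qed

lemma mpow_add_binomial:
  fixes x h :: "'a::comm_ring_1 ^ 'v"
  shows "(\<Sum>(\<gamma>, \<delta>) | \<gamma> + \<delta> = \<alpha>. of_nat (mbinom \<gamma> \<delta>) * mpow h \<gamma> * mpow x \<delta>) = mpow (h + x) \<alpha>"
proof -
  let ?f = "\<lambda>i k. of_nat (\<alpha> $ i choose k) * (h $ i) ^ k * (x $ i) ^ (\<alpha> $ i - k)"
  have "mpow (h + x) \<alpha> = (\<Prod>i\<in>UNIV. \<Sum>k\<le>\<alpha> $ i. ?f i k)"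
    by (simp add: mpow_def binomial_ring)
  also have "\<dots> = (\<Sum>g\<in>PiE UNIV (\<lambda>i. {..\<alpha> $ i}). \<Prod>i\<in>UNIV. ?f i (g i))"
    by (rule prod_sum_PiE) auto
  also have "\<dots> = (\<Sum>(\<gamma>, \<delta>) | \<gamma> + \<delta> = \<alpha>. of_nat (mbinom \<gamma> \<delta>) * mpow h \<gamma> * mpow x \<delta>)"
  proof (rule sum.reindex_bij_witness[where i = "\<lambda>(\<gamma>, \<delta>). vec_nth \<gamma>"
        and j = "\<lambda>g. (vec_lambda g, \<alpha> - vec_lambda g)"])
    fix g assume g: "g \<in> PiE UNIV (\<lambda>i. {..\<alpha> $ i})"
    then have le: "g i \<le> \<alpha> $ i" for i by (auto simp: PiE_def Pi_def)
    then show "(vec_lambda g, \<alpha> - vec_lambda g) \<in> {(\<gamma>, \<delta>). \<gamma> + \<delta> = \<alpha>}"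
      by (auto simp: vec_eq_iff)
    show "(case (vec_lambda g, \<alpha> - vec_lambda g) of (\<gamma>, \<delta>) \<Rightarrow>
        of_nat (mbinom \<gamma> \<delta>) * mpow h \<gamma> * mpow x \<delta>) = (\<Prod>i\<in>UNIV. ?f i (g i))"
      using le by (simp add: mbinom_def mpow_def prod.distrib)
  next
    fix p :: "(nat ^ 'v) \<times> (nat ^ 'v)" assume "p \<in> {(\<gamma>, \<delta>). \<gamma> + \<delta> = \<alpha>}"
    then have "\<alpha> = fst p + snd p" by auto
    then show "(case p of (\<gamma>, \<delta>) \<Rightarrow> vec_nth \<gamma>) \<in> PiE UNIV (\<lambda>i. {..\<alpha> $ i})"
      "(vec_lambda (case p of (\<gamma>, \<delta>) \<Rightarrow> vec_nth \<gamma>), \<alpha> - vec_lambda (case p of (\<gamma>, \<delta>) \<Rightarrow> vec_nth \<gamma>)) = p"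
      by (auto simp: case_prod_unfold prod_eq_iff vec_eq_iff PiE_def)
  qed auto
  finally show ?thesis ..
qed

text \<open>
  Summing over the pairs with \<open>\<gamma> + \<delta> = \<alpha>\<close> first, the binomial theorem turns the double sum into the
  weighted norm of \<open>a\<close> at radius \<open>s + t\<close>.
\<close>

lemma binomial_rearrangement_summable:
  fixes a :: "'v::finite series"
  assumes "abs_conv (s + t) a" "0 \<le> s" "0 \<le> t"
  shows "(\<lambda>(\<gamma>, \<delta>). norm (a (\<gamma> + \<delta>)) * of_nat (mbinom \<gamma> \<delta>) * t ^ mdeg \<gamma> * s ^ mdeg \<delta>) summable_on UNIV"
    (is "?f summable_on UNIV")
proof -
  have "(\<lambda>p. ?f (snd p)) summable_on (SIGMA \<alpha>:UNIV. {p\<in>UNIV. (\<lambda>(\<gamma>, \<delta>). \<gamma> + \<delta>) p = \<alpha>})"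
  proof (rule summable_on_SigmaI)
    fix \<alpha> :: "nat ^ 'v"
    have "(\<Sum>p\<in>{p \<in> UNIV. (case p of (\<gamma>, \<delta>) \<Rightarrow> \<gamma> + \<delta>) = \<alpha>}. ?f p) =
        (\<Sum>(\<gamma>, \<delta>) | \<gamma> + \<delta> = \<alpha>. norm (a \<alpha>) * (of_nat (mbinom \<gamma> \<delta>) * mpow (\<chi> i. t) \<gamma> * mpow (\<chi> i. s) \<delta>))"
      by (rule sum.cong) (auto simp: mpow_const)
    also have "\<dots> = norm (a \<alpha>) * (\<Sum>(\<gamma>, \<delta>) | \<gamma> + \<delta> = \<alpha>. of_nat (mbinom \<gamma> \<delta>) * mpow (\<chi> i. t) \<gamma> * mpow (\<chi> i. s) \<delta>)"
      by (simp add: sum_distrib_left case_prod_unfold)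
    also have "\<dots> = norm (a \<alpha>) * mpow (\<chi> i. s + t) \<alpha>"
      unfolding mpow_add_binomial by (simp add: plus_vec_def add.commute)
    finally have *: "(\<Sum>p\<in>{p \<in> UNIV. (case p of (\<gamma>, \<delta>) \<Rightarrow> \<gamma> + \<delta>) = \<alpha>}. ?f p) = norm (a \<alpha>) * (s + t) ^ mdeg \<alpha>"
      by (simp add: mpow_const)
    show "((\<lambda>p. ?f (snd (\<alpha>, p))) has_sum norm (a \<alpha>) * (s + t) ^ mdeg \<alpha>)
        {p \<in> UNIV. (case p of (\<gamma>, \<delta>) \<Rightarrow> \<gamma> + \<delta>) = \<alpha>}"
      unfolding *[symmetric] using finite_add_decomps[of \<alpha>]
      by (intro has_sum_finiteI) (auto simp: case_prod_unfold)
  qed (use assms in \<open>auto simp: abs_conv_def case_prod_unfold\<close>)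
  then show ?thesis
    by (subst (asm) summable_on_reindex_bij_betw[OF bij_betw_snd_fibres])
qed

text \<open>
  Expanding each monomial of \<open>x + h\<close> by the binomial theorem and collecting powers of \<open>h\<close> gives
  Taylor's formula, with absolute convergence at the same radius \<open>t\<close> for all base points \<open>x\<close> in \<open>polydisc s\<close>.
\<close>

lemma taylor:
  fixes a :: "'v::finite series"
  assumes "abs_conv (s + t) a" "0 \<le> s" "0 < t" "x \<in> polydisc s"
  shows abs_conv_taylor: "abs_conv t (\<lambda>\<gamma>. ps_eval (ps_deriv \<gamma> a) x / mfact \<gamma>)"
    and ps_eval_taylor: "\<And>h. h \<in> polydisc t \<Longrightarrow>
      ps_eval (\<lambda>\<gamma>. ps_eval (ps_deriv \<gamma> a) x / mfact \<gamma>) h = ps_eval a (x + h)"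
    and abs_conv_ps_deriv: "abs_conv s (ps_deriv \<gamma> a)"
proof -
  let ?c = "\<lambda>(\<gamma>, \<delta>). a (\<gamma> + \<delta>) * of_nat (mbinom \<gamma> \<delta>) * mpow x \<delta>"
  note S = binomial_rearrangement_summable[OF assms(1,2) less_imp_le[OF assms(3)]]
  have sm: "(\<lambda>p. norm (?c p) * t ^ mdeg (fst p)) summable_on UNIV"
  proof (rule summable_on_comparison_test[OF S])
    fix p :: "(nat ^ 'v) \<times> (nat ^ 'v)"
    have "(norm (a (fst p + snd p)) * of_nat (mbinom (fst p) (snd p)) * t ^ mdeg (fst p)) * norm (mpow x (snd p))
       \<le> (norm (a (fst p + snd p)) * of_nat (mbinom (fst p) (snd p)) * t ^ mdeg (fst p)) * s ^ mdeg (snd p)"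
      using assms by (intro mult_left_mono norm_mpow_le) auto
    then show "norm (?c p) * t ^ mdeg (fst p) \<le>
      (case p of (\<gamma>, \<delta>) \<Rightarrow> norm (a (\<gamma> + \<delta>)) * of_nat (mbinom \<gamma> \<delta>) * t ^ mdeg \<gamma> * s ^ mdeg \<delta>)"
      by (simp add: case_prod_unfold norm_mult mult_ac)
  qed (use assms in auto)
  have coll: "collect ?c fst UNIV = (\<lambda>\<gamma>. ps_eval (ps_deriv \<gamma> a) x / mfact \<gamma>)"
  proof
    fix \<gamma> :: "nat ^ 'v"
    have "bij_betw (\<lambda>\<delta>. (\<gamma>, \<delta>)) UNIV {p \<in> UNIV. fst p = \<gamma>}"
      by (auto simp: bij_betw_def inj_on_def)
    then have "collect ?c fst UNIV \<gamma> = (\<Sum>\<^sub>\<infinity>\<delta>. ?c (\<gamma>, \<delta>))"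
      unfolding collect_def by (rule infsum_reindex_bij_betw[symmetric])
    also have "\<dots> = (\<Sum>\<^sub>\<infinity>\<delta>. ps_deriv \<gamma> a \<delta> * mpow x \<delta> * (1 / mfact \<gamma>))"
      by (rule infsum_cong) (simp add: mbinom ps_deriv_def add.commute mult_ac)
    also have "\<dots> = (\<Sum>\<^sub>\<infinity>\<delta>. ps_deriv \<gamma> a \<delta> * mpow x \<delta>) * (1 / mfact \<gamma>)"
      by (rule infsum_cmult_left')
    finally show "collect ?c fst UNIV \<gamma> = ps_eval (ps_deriv \<gamma> a) x / mfact \<gamma>"
      by (simp add: ps_eval_def)
  qed
  show "abs_conv t (\<lambda>\<gamma>. ps_eval (ps_deriv \<gamma> a) x / mfact \<gamma>)"
    using collect_abs_conv[OF sm assms(3)] unfolding coll .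
  show "ps_eval (\<lambda>\<gamma>. ps_eval (ps_deriv \<gamma> a) x / mfact \<gamma>) h = ps_eval a (x + h)"
    if h: "h \<in> polydisc t" for h
  proof -
    have "((\<lambda>p. ?c p * mpow h (fst p)) has_sum ps_eval (\<lambda>\<gamma>. ps_eval (ps_deriv \<gamma> a) x / mfact \<gamma>) h) UNIV"
      using collect_eval[OF sm assms(3) h] unfolding coll .
    then have "((\<lambda>p. ?c (snd p) * mpow h (fst (snd p))) has_sum ps_eval (\<lambda>\<gamma>. ps_eval (ps_deriv \<gamma> a) x / mfact \<gamma>) h)
        (SIGMA \<alpha>:UNIV. {p\<in>UNIV. (\<lambda>(\<gamma>, \<delta>). \<gamma> + \<delta>) p = \<alpha>})"
      using has_sum_reindex_bij_betw[OF bij_betw_snd_fibres[of UNIV "\<lambda>(\<gamma>, \<delta>). \<gamma> + \<delta>"],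
        of "\<lambda>p. ?c p * mpow h (fst p)"] by blast
    then have "((\<lambda>\<alpha>. a \<alpha> * mpow (x + h) \<alpha>) has_sum ps_eval (\<lambda>\<gamma>. ps_eval (ps_deriv \<gamma> a) x / mfact \<gamma>) h) UNIV"
    proof (rule has_sum_SigmaD)
      fix \<alpha> :: "nat ^ 'v"
      have "(\<Sum>p\<in>{p \<in> UNIV. (case p of (\<gamma>, \<delta>) \<Rightarrow> \<gamma> + \<delta>) = \<alpha>}. ?c p * mpow h (fst p)) =
        (\<Sum>(\<gamma>, \<delta>) | \<gamma> + \<delta> = \<alpha>. a \<alpha> * (of_nat (mbinom \<gamma> \<delta>) * mpow h \<gamma> * mpow x \<delta>))"
        by (rule sum.cong) auto
      also have "\<dots> = a \<alpha> * mpow (x + h) \<alpha>"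
        unfolding add.commute[of x] mpow_add_binomial[symmetric] sum_distrib_left by (simp add: case_prod_unfold)
      finally show "((\<lambda>p. ?c (snd (\<alpha>, p)) * mpow h (fst (snd (\<alpha>, p)))) has_sum a \<alpha> * mpow (x + h) \<alpha>)
          {p \<in> UNIV. (case p of (\<gamma>, \<delta>) \<Rightarrow> \<gamma> + \<delta>) = \<alpha>}"
        using finite_add_decomps[of \<alpha>] by (intro has_sum_finiteI) (auto simp: case_prod_unfold)
    qed
    then show ?thesis
      by (simp add: ps_evalI)
  qed
  show "abs_conv s (ps_deriv \<gamma> a)"
  proof -
    have "(\<lambda>(\<gamma>, \<delta>). norm (a (\<gamma> + \<delta>)) * of_nat (mbinom \<gamma> \<delta>) * t ^ mdeg \<gamma> * s ^ mdeg \<delta>)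
       summable_on (SIGMA \<gamma>:UNIV. UNIV)"
      using S by simp
    then have "(\<lambda>\<delta>. norm (a (\<gamma> + \<delta>)) * of_nat (mbinom \<gamma> \<delta>) * t ^ mdeg \<gamma> * s ^ mdeg \<delta>) summable_on UNIV"
      by (rule summable_on_SigmaD1) simp
    then have "(\<lambda>\<delta>. (norm (mfact \<gamma>) / t ^ mdeg \<gamma>) * (norm (a (\<gamma> + \<delta>)) * of_nat (mbinom \<gamma> \<delta>) * t ^ mdeg \<gamma> * s ^ mdeg \<delta>)) summable_on UNIV"
      by (rule summable_on_cmult_right)
    moreover have "(norm (mfact \<gamma>) / t ^ mdeg \<gamma>) * (norm (a (\<gamma> + \<delta>)) * of_nat (mbinom \<gamma> \<delta>) * t ^ mdeg \<gamma> * s ^ mdeg \<delta>)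
       = norm (ps_deriv \<gamma> a \<delta>) * s ^ mdeg \<delta>" for \<delta>
    proof -
      have "(of_nat (mbinom \<gamma> \<delta>) :: real) = norm (of_nat (mbinom \<gamma> \<delta>) :: complex)" by simp
      then show ?thesis
        using assms(3) unfolding mbinom by (simp add: ps_deriv_def norm_mult norm_divide add.commute)
    qed
    ultimately show ?thesis
      by (simp add: abs_conv_def)
  qed
qed

section \<open>Merging two groups of variables\<close>

definition vjoin :: "'a ^ 'p \<Rightarrow> 'a ^ 'q \<Rightarrow> 'a ^ ('p::finite + 'q::finite)" where
  "vjoin x y = (\<chi> i. case i of Inl a \<Rightarrow> x $ a | Inr b \<Rightarrow> y $ b)"

definition vfst :: "'a ^ ('p::finite + 'q::finite) \<Rightarrow> 'a ^ 'p" where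
  "vfst x = (\<chi> a. x $ Inl a)"

definition vsnd :: "'a ^ ('p::finite + 'q::finite) \<Rightarrow> 'a ^ 'q" where
  "vsnd x = (\<chi> b. x $ Inr b)"

definition sjoin :: "(nat ^ 'p::finite \<Rightarrow> 'q::finite series) \<Rightarrow> ('p + 'q) series" where
  "sjoin c = (\<lambda>\<alpha>. c (vfst \<alpha>) (vsnd \<alpha>))"

lemma vjoin_nth [simp]: "vjoin x y $ Inl a = x $ a" "vjoin x y $ Inr b = y $ b"
  by (simp_all add: vjoin_def)

lemma vfst_vsnd_nth: "vfst x $ a = x $ Inl a" "vsnd x $ b = x $ Inr b"
  by (simp_all add: vfst_def vsnd_def)

lemma vec_sum_eq_iff: "x = y \<longleftrightarrow> (\<forall>a. x $ Inl a = y $ Inl a) \<and> (\<forall>b. x $ Inr b = y $ Inr b)"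
  for x y :: "'a ^ ('p::finite + 'q::finite)"
  by (metis sum.exhaust vec_eq_iff)

lemma vfst_vjoin [simp]: "vfst (vjoin x y) = x" and vsnd_vjoin [simp]: "vsnd (vjoin x y) = y"
  by (simp_all add: vec_eq_iff vfst_vsnd_nth)

lemma vjoin_collapse [simp]: "vjoin (vfst x) (vsnd x) = x"
  by (simp add: vec_sum_eq_iff vfst_vsnd_nth)

lemma vjoin_eqI: "vfst x = a \<Longrightarrow> vjoin a (vsnd x) = x"
  using vjoin_collapse by blast

lemma vjoin_add: "vjoin x y + vjoin x' y' = vjoin (x + x') (y + y')"
  by (simp add: vec_sum_eq_iff)

lemma vfst_add [simp]: "vfst (x + y) = vfst x + vfst y" and vsnd_add [simp]: "vsnd (x + y) = vsnd x + vsnd y"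
  by (simp_all add: vec_eq_iff vfst_vsnd_nth)

lemma vjoin_0 [simp]: "vjoin 0 0 = 0"
  by (simp add: vec_sum_eq_iff)

lemma vfst_0 [simp]: "vfst 0 = 0" and vsnd_0 [simp]: "vsnd 0 = 0"
  by (simp_all add: vec_eq_iff vfst_vsnd_nth)

lemma vjoin_const: "vjoin (\<chi> i. c) (\<chi> i. c) = (\<chi> i. c)"
  by (simp add: vec_sum_eq_iff)

lemma axis_Inl: "axis (Inl a) x = vjoin (axis a x) 0"
  and axis_Inr: "axis (Inr b) x = vjoin 0 (axis b x)"
  by (simp_all add: vec_sum_eq_iff axis_def)

lemma vfst_axis [simp]: "vfst (axis (Inl a) x) = axis a x" "vfst (axis (Inr b) x) = 0"
  and vsnd_axis [simp]: "vsnd (axis (Inl a) x) = 0" "vsnd (axis (Inr b) x) = axis b x"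
  by (simp_all add: axis_Inl axis_Inr)

lemma UNIV_sum_split: "(\<Sum>i\<in>UNIV. f i) = (\<Sum>a\<in>UNIV. f (Inl a)) + (\<Sum>b\<in>UNIV. f (Inr b))"
  for f :: "'p::finite + 'q::finite \<Rightarrow> 'a::comm_monoid_add"
  by (subst UNIV_Plus_UNIV[symmetric], subst sum.Plus) simp_all

lemma UNIV_prod_split: "(\<Prod>i\<in>UNIV. f i) = (\<Prod>a\<in>UNIV. f (Inl a)) * (\<Prod>b\<in>UNIV. f (Inr b))"
  for f :: "'p::finite + 'q::finite \<Rightarrow> 'a::comm_monoid_mult"
  by (subst UNIV_Plus_UNIV[symmetric], subst prod.Plus) simp_all

lemma mpow_vjoin [simp]: "mpow (vjoin x y) (vjoin \<alpha> \<beta>) = mpow x \<alpha> * mpow y \<beta>"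
  by (simp add: mpow_def UNIV_prod_split)

lemma mdeg_vjoin [simp]: "mdeg (vjoin \<alpha> \<beta>) = mdeg \<alpha> + mdeg \<beta>"
  by (simp add: mdeg_def UNIV_sum_split)

lemma mfact_vjoin [simp]: "mfact (vjoin \<alpha> \<beta>) = mfact \<alpha> * mfact \<beta>"
  by (simp add: mfact_def UNIV_prod_split)

lemma vjoin_in_polydisc [simp]: "vjoin x y \<in> polydisc r \<longleftrightarrow> x \<in> polydisc r \<and> y \<in> polydisc r"
  by (simp add: polydisc_def vjoin_def split: sum.splits) blast

lemma bij_betw_vjoin: "bij_betw (\<lambda>(x, y). vjoin x y) UNIV UNIV"
  by (rule bij_betwI[where g = "\<lambda>x. (vfst x, vsnd x)"]) auto

lemma sjoin_vjoin [simp]: "sjoin c (vjoin \<alpha> \<beta>) = c \<alpha> \<beta>"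
  by (simp add: sjoin_def)

lemma summable_on_vjoin: "(\<lambda>(\<alpha>, \<beta>). f (vjoin \<alpha> \<beta>)) summable_on UNIV \<longleftrightarrow> f summable_on UNIV"
  using summable_on_reindex_bij_betw[OF bij_betw_vjoin, of f] by (simp add: case_prod_unfold)

lemma has_sum_vjoin: "((\<lambda>(\<alpha>, \<beta>). f (vjoin \<alpha> \<beta>)) has_sum S) UNIV \<longleftrightarrow> (f has_sum S) UNIV"
  using has_sum_reindex_bij_betw[OF bij_betw_vjoin, of f] by (simp add: case_prod_unfold)

text \<open>
  Evaluating only the second group of variables. The radius does not depend on the evaluation point
  and the weighted norm does not grow; this uniformity is what later lets \<open>w\<close> vary over a fixed polydisc.
\<close>

lemma partial_eval:
  fixes c :: "nat ^ 'p \<Rightarrow> 'q::finite series"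
  assumes "abs_conv r (sjoin c)" "r > 0" "w \<in> polydisc r"
  shows abs_conv_partial: "abs_conv r (\<lambda>\<alpha>. ps_eval (c \<alpha>) w)"
    and wnorm_partial: "wnorm r (\<lambda>\<alpha>. ps_eval (c \<alpha>) w) \<le> wnorm r (sjoin c)"
    and ps_eval_partial: "\<And>x. x \<in> polydisc r \<Longrightarrow> ps_eval (\<lambda>\<alpha>. ps_eval (c \<alpha>) w) x = ps_eval (sjoin c) (vjoin x w)"
    and abs_conv_slice: "abs_conv r (c \<alpha>)"
proof -
  have s0: "(\<lambda>(\<alpha>, \<delta>). norm (c \<alpha> \<delta>) * r ^ mdeg \<delta> * r ^ mdeg \<alpha>) summable_on UNIV"
    using assms(1) summable_on_vjoin[of "\<lambda>i. norm (sjoin c i) * r ^ mdeg i"]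
    by (simp add: abs_conv_def power_add mult_ac)
  let ?c = "\<lambda>(\<alpha>, \<delta>). c \<alpha> \<delta> * mpow w \<delta>"
  have le: "norm (?c x) * r ^ mdeg (fst x) \<le> norm (sjoin c (vjoin (fst x) (snd x))) * r ^ mdeg (vjoin (fst x) (snd x))" for x
  proof -
    have "norm (c (fst x) (snd x)) * norm (mpow w (snd x)) * r ^ mdeg (fst x) \<le>
       norm (c (fst x) (snd x)) * r ^ mdeg (snd x) * r ^ mdeg (fst x)"
      using assms by (intro mult_right_mono mult_left_mono norm_mpow_le) auto
    then show ?thesis
      by (simp add: case_prod_unfold norm_mult power_add mult_ac)
  qed
  have s1: "(\<lambda>x. norm (sjoin c (vjoin (fst x) (snd x))) * r ^ mdeg (vjoin (fst x) (snd x))) summable_on UNIV"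
    using s0 by (simp add: case_prod_unfold power_add mult_ac)
  have sm: "(\<lambda>x. norm (?c x) * r ^ mdeg (fst x)) summable_on UNIV"
    by (rule summable_on_comparison_test[OF s1 le]) (use assms in auto)
  have coll: "collect ?c fst UNIV = (\<lambda>\<alpha>. ps_eval (c \<alpha>) w)"
  proof
    fix \<alpha> :: "nat ^ 'p"
    have "bij_betw (\<lambda>\<delta>. (\<alpha>, \<delta>)) UNIV {p \<in> UNIV. fst p = \<alpha>}"
      by (auto simp: bij_betw_def inj_on_def)
    then have "collect ?c fst UNIV \<alpha> = (\<Sum>\<^sub>\<infinity>\<delta>. ?c (\<alpha>, \<delta>))"
      unfolding collect_def by (rule infsum_reindex_bij_betw[symmetric])
    then show "collect ?c fst UNIV \<alpha> = ps_eval (c \<alpha>) w"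
      by (simp add: ps_eval_def)
  qed
  show "abs_conv r (\<lambda>\<alpha>. ps_eval (c \<alpha>) w)"
    using collect_abs_conv[OF sm assms(2)] unfolding coll .
  have "wnorm r (\<lambda>\<alpha>. ps_eval (c \<alpha>) w) \<le> (\<Sum>\<^sub>\<infinity>x. norm (?c x) * r ^ mdeg (fst x))"
    using collect_wnorm[OF sm assms(2)] unfolding coll .
  also have "\<dots> \<le> (\<Sum>\<^sub>\<infinity>x. norm (sjoin c (vjoin (fst x) (snd x))) * r ^ mdeg (vjoin (fst x) (snd x)))"
    by (rule infsum_mono[OF sm s1 le])
  also have "\<dots> = wnorm r (sjoin c)"
    unfolding wnorm_def
    using infsum_reindex_bij_betw[OF bij_betw_vjoin, of "\<lambda>i. norm (sjoin c i) * r ^ mdeg i"]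
    by (simp add: case_prod_unfold)
  finally show "wnorm r (\<lambda>\<alpha>. ps_eval (c \<alpha>) w) \<le> wnorm r (sjoin c)" .
  show "ps_eval (\<lambda>\<alpha>. ps_eval (c \<alpha>) w) x = ps_eval (sjoin c) (vjoin x w)" if x: "x \<in> polydisc r" for x
  proof -
    have "((\<lambda>p. ?c p * mpow x (fst p)) has_sum ps_eval (\<lambda>\<alpha>. ps_eval (c \<alpha>) w) x) UNIV"
      using collect_eval[OF sm assms(2) x] unfolding coll .
    moreover have "((\<lambda>p. ?c p * mpow x (fst p)) has_sum ps_eval (sjoin c) (vjoin x w)) UNIV"
      using abs_conv_has_sum[OF assms(1), of "vjoin x w"] x assms(3)
      by (simp add: has_sum_vjoin[symmetric] case_prod_unfold mult_ac)
    ultimately show ?thesis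
      by (rule has_sum_unique)
  qed
  have "(\<lambda>\<delta>. norm (c \<alpha> \<delta>) * r ^ mdeg \<delta> * r ^ mdeg \<alpha>) summable_on UNIV"
    by (rule summable_on_SigmaD1[where A = UNIV and B = "\<lambda>_. UNIV", OF _ UNIV_I]) (use s0 in simp)
  then show "abs_conv r (c \<alpha>)"
    using assms(2) unfolding abs_conv_def by (subst (asm) summable_on_cmult_left') auto
qed

lemma ps_deriv_sjoin:
  "ps_deriv (vjoin \<alpha> \<gamma>) (sjoin c) (vjoin 0 \<delta>) = mfact \<alpha> * ps_deriv \<gamma> (c \<alpha>) \<delta>"
  by (simp add: ps_deriv_def vjoin_add)

lemma mpow_zero: "mpow 0 \<alpha> = of_bool (\<alpha> = 0)"
proof (cases "\<alpha> = 0")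
  case False
  then obtain i where "\<alpha> $ i \<noteq> 0" by (auto simp: vec_eq_iff)
  then show ?thesis using False by (auto simp: mpow_def zero_power intro!: prod_zero bexI[of _ i])
qed simp

lemma ps_eval_0 [simp]: "ps_eval a 0 = a 0"
proof -
  have "((\<lambda>\<alpha>. a \<alpha> * mpow 0 \<alpha>) has_sum a 0) UNIV"
    by (rule has_sum_finite_neutralI[where B = "{0}"]) (auto simp: mpow_zero)
  then show ?thesis by (rule ps_evalI)
qed

lemma ps_eval_sjoin_0: "ps_eval a (vjoin 0 w) = ps_eval (\<lambda>\<delta>. a (vjoin 0 \<delta>)) w"
proof -
  have "ps_eval a (vjoin 0 w) = (\<Sum>\<^sub>\<infinity>(\<alpha>, \<delta>). a (vjoin \<alpha> \<delta>) * mpow (vjoin 0 w) (vjoin \<alpha> \<delta>))"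
    unfolding ps_eval_def
    using infsum_reindex_bij_betw[OF bij_betw_vjoin, of "\<lambda>i. a i * mpow (vjoin 0 w) i"]
    by (simp add: case_prod_unfold)
  also have "\<dots> = (\<Sum>\<^sub>\<infinity>p\<in>range (\<lambda>\<delta>. (0, \<delta>)). case p of (\<alpha>, \<delta>) \<Rightarrow> a (vjoin \<alpha> \<delta>) * mpow (vjoin 0 w) (vjoin \<alpha> \<delta>))"
    by (rule infsum_cong_neutral) (auto simp: mpow_zero image_def)
  also have "\<dots> = ps_eval (\<lambda>\<delta>. a (vjoin 0 \<delta>)) w"
    by (subst infsum_reindex) (auto simp: inj_on_def o_def ps_eval_def)
  finally show ?thesis .
qed

text \<open>
  Used to read off the Taylor coefficients at the base point \<open>(0, w)\<close>, where only the pure \<open>w\<close>-part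
  of the series survives.
\<close>

lemma ps_eval_deriv_sjoin:
  "ps_eval (ps_deriv (vjoin \<alpha> \<gamma>) (sjoin c)) (vjoin 0 w) = mfact \<alpha> * ps_eval (ps_deriv \<gamma> (c \<alpha>)) w"
  unfolding ps_eval_sjoin_0 ps_deriv_sjoin
  by (simp add: ps_eval_def mult.assoc infsum_cmult_right')

lemma norm_le_polydisc:
  assumes "x \<in> polydisc r"
  shows "norm (x :: complex ^ 'v) \<le> of_nat (CARD('v)) * r"
proof -
  have "norm x \<le> (\<Sum>i\<in>UNIV. norm (x $ i))"
    by (simp add: norm_vec_def L2_set_le_sum)
  also have "\<dots> \<le> of_nat (CARD('v)) * r"
    using assms by (intro sum_bounded_above) (auto simp: polydisc_def)
  finally show ?thesis .
qed

lemma norm_in_polydisc: "norm x \<le> r \<Longrightarrow> x \<in> polydisc r"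
  by (auto simp: polydisc_def intro: order_trans[OF Finite_Cartesian_Product.norm_nth_le])

lemma eventually_polydisc: "r > 0 \<Longrightarrow> \<forall>\<^sub>F x in nhds 0. x \<in> polydisc r"
  by (rule eventually_mono[OF eventually_nhds_ball[of r 0]]) (auto intro!: norm_in_polydisc)

lemma small_polydisc:
  assumes "R > 0"
  obtains r where "r > 0" "\<And>x :: complex ^ 'v. x \<in> polydisc r \<Longrightarrow> norm x < R"
proof
  show "R / (CARD('v) + 1) > 0" using assms by simp
  fix x :: "complex ^ 'v" assume "x \<in> polydisc (R / (CARD('v) + 1))"
  then have "norm x \<le> of_nat (CARD('v)) * (R / (CARD('v) + 1))" by (rule norm_le_polydisc)
  also have "\<dots> < R" using assms by (simp add: field_simps)
  finally show "norm x < R" .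
qed

lemma abs_convI:
  assumes "((\<lambda>\<alpha>. a \<alpha> * mpow (\<chi> i. of_real r) \<alpha>) has_sum S) UNIV" "r \<ge> 0"
  shows "abs_conv r a"
proof -
  have "(\<lambda>\<alpha>. norm (a \<alpha> * mpow (\<chi> i. of_real r) \<alpha>)) summable_on UNIV"
    by (subst summable_on_iff_abs_summable_on_complex[symmetric]) (rule has_sum_imp_summable[OF assms(1)])
  then show ?thesis
    using assms(2) by (simp add: abs_conv_def mpow_const norm_mult norm_power)
qed

lemma expands_z_sjoin:
  fixes f :: "(complex ^ 'n) \<times> (complex ^ 'k) \<Rightarrow> complex"
  assumes "expands_z f c"
  shows "\<exists>r0>0. \<forall>r. 0 < r \<and> r \<le> r0 \<longrightarrow> abs_conv r (sjoin c) \<and>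
    (\<forall>z\<in>polydisc r. \<forall>w\<in>polydisc r. f (z, w) = ps_eval (sjoin c) (vjoin z w))"
proof -
  obtain R where R: "R > 0" "\<And>z w. norm z < R \<Longrightarrow> norm w < R \<Longrightarrow>
     ((\<lambda>(\<beta>, \<delta>). c \<beta> \<delta> * mpow z \<beta> * mpow w \<delta>) has_sum f (z, w)) UNIV"
    using assms unfolding expands_z_def by blast
  obtain r1 where r1: "r1 > 0" "\<And>x :: complex ^ 'n. x \<in> polydisc r1 \<Longrightarrow> norm x < R"
    using small_polydisc[OF R(1)] by blast
  obtain r2 where r2: "r2 > 0" "\<And>x :: complex ^ 'k. x \<in> polydisc r2 \<Longrightarrow> norm x < R"
    using small_polydisc[OF R(1)] by blast
  show ?thesis
  proof (intro exI[of _ "min r1 r2"] allI impI conjI)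
    show "0 < min r1 r2" using r1 r2 by simp
    fix r :: real assume r: "0 < r \<and> r \<le> min r1 r2"
    have hs: "((\<lambda>i. sjoin c i * mpow (vjoin z w) i) has_sum f (z, w)) UNIV"
      if "z \<in> polydisc r" "w \<in> polydisc r" for z w
    proof -
      have "norm z < R" "norm w < R"
        using r r1(2)[OF polydisc_mono[OF that(1)]] r2(2)[OF polydisc_mono[OF that(2)]] by auto
      from R(2)[OF this] show ?thesis
        by (simp add: has_sum_vjoin[symmetric] mult.assoc)
    qed
    have "((\<lambda>i. sjoin c i * mpow (\<chi> i. of_real r) i) has_sum
        f (\<chi> i. of_real r, \<chi> i. of_real r)) UNIV"
      using hs[of "\<chi> i. of_real r" "\<chi> i. of_real r"] r by (simp add: vjoin_const polydisc_def)
    then show "abs_conv r (sjoin c)"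
      by (rule abs_convI) (use r in simp)
    show "\<forall>z\<in>polydisc r. \<forall>w\<in>polydisc r. f (z, w) = ps_eval (sjoin c) (vjoin z w)"
      using ps_evalI[OF hs] by simp
  qed
qed

lemma expands_zz_sjoin:
  fixes f :: "(complex ^ 'n) \<times> (complex ^ 'n) \<times> (complex ^ 'k) \<Rightarrow> complex"
  assumes "expands_zz f c"
  defines "s \<equiv> sjoin (\<lambda>i. c (vfst i) (vsnd i))"
  shows "\<exists>r0>0. \<forall>r. 0 < r \<and> r \<le> r0 \<longrightarrow> abs_conv r s \<and>
    (\<forall>\<zeta>\<in>polydisc r. \<forall>z\<in>polydisc r. \<forall>w\<in>polydisc r. f (\<zeta>, z, w) = ps_eval s (vjoin (vjoin \<zeta> z) w))"
proof -
  obtain R where R: "R > 0" "\<And>\<zeta> z w. norm \<zeta> < R \<Longrightarrow> norm z < R \<Longrightarrow> norm w < R \<Longrightarrow>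
     ((\<lambda>(\<alpha>, \<beta>, \<delta>). c \<alpha> \<beta> \<delta> * mpow \<zeta> \<alpha> * mpow z \<beta> * mpow w \<delta>) has_sum f (\<zeta>, z, w)) UNIV"
    using assms unfolding expands_zz_def by blast
  obtain r1 where r1: "r1 > 0" "\<And>x :: complex ^ 'n. x \<in> polydisc r1 \<Longrightarrow> norm x < R"
    using small_polydisc[OF R(1)] by blast
  obtain r2 where r2: "r2 > 0" "\<And>x :: complex ^ 'k. x \<in> polydisc r2 \<Longrightarrow> norm x < R"
    using small_polydisc[OF R(1)] by blast
  have bij: "bij_betw (\<lambda>(\<alpha>, \<beta>, \<delta>). vjoin (vjoin \<alpha> \<beta>) \<delta>) UNIV UNIV"
    by (rule bij_betwI[where g = "\<lambda>x. (vfst (vfst x), vsnd (vfst x), vsnd x)"]) auto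
  show ?thesis
  proof (intro exI[of _ "min r1 r2"] allI impI conjI)
    show "0 < min r1 r2" using r1 r2 by simp
    fix r :: real assume r: "0 < r \<and> r \<le> min r1 r2"
    have hs: "((\<lambda>i. s i * mpow (vjoin (vjoin \<zeta> z) w) i) has_sum f (\<zeta>, z, w)) UNIV"
      if "\<zeta> \<in> polydisc r" "z \<in> polydisc r" "w \<in> polydisc r" for \<zeta> z w
    proof -
      have "norm \<zeta> < R" "norm z < R" "norm w < R"
        using r r1(2)[OF polydisc_mono[OF that(1)]] r1(2)[OF polydisc_mono[OF that(2)]]
          r2(2)[OF polydisc_mono[OF that(3)]] by auto
      from R(2)[OF this] show ?thesis
        by (subst has_sum_reindex_bij_betw[OF bij, symmetric]) (simp add: s_def case_prod_unfold mult_ac)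
    qed
    have "((\<lambda>i. s i * mpow (\<chi> i. of_real r) i) has_sum
        f (\<chi> i. of_real r, \<chi> i. of_real r, \<chi> i. of_real r)) UNIV"
      using hs[of "\<chi> i. of_real r" "\<chi> i. of_real r" "\<chi> i. of_real r"] r by (simp add: vjoin_const polydisc_def)
    then show "abs_conv r s"
      by (rule abs_convI) (use r in simp)
    show "\<forall>\<zeta>\<in>polydisc r. \<forall>z\<in>polydisc r. \<forall>w\<in>polydisc r. f (\<zeta>, z, w) = ps_eval s (vjoin (vjoin \<zeta> z) w)"
      using ps_evalI[OF hs] by simp
  qed
qed

section \<open>Differentiability and uniqueness of power series\<close>

lemma finite_mdeg_le: "finite {\<alpha> :: nat ^ 'v. mdeg \<alpha> \<le> m}"
proof -
  have "{\<alpha> :: nat ^ 'v. mdeg \<alpha> \<le> m} \<subseteq> vec_lambda ` (UNIV \<rightarrow>\<^sub>E {..m})"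
  proof
    fix \<alpha> :: "nat ^ 'v" assume a: "\<alpha> \<in> {\<alpha>. mdeg \<alpha> \<le> m}"
    have "\<alpha> $ i \<le> m" for i
      using a member_le_sum[of i UNIV "\<lambda>i. \<alpha> $ i"] by (auto simp: mdeg_def)
    then show "\<alpha> \<in> vec_lambda ` (UNIV \<rightarrow>\<^sub>E {..m})"
      by (intro rev_image_eqI[of "vec_nth \<alpha>"]) (auto simp: PiE_def)
  qed
  then show ?thesis
    by (rule finite_subset) (intro finite_imageI finite_PiE; simp)
qed

lemma has_sum_diff:
  fixes f g :: "'a \<Rightarrow> complex"
  assumes "(f has_sum S) A" "(g has_sum T) A"
  shows "((\<lambda>x. f x - g x) has_sum (S - T)) A"
  using has_sum_add[OF assms(1) has_sum_uminusI[OF assms(2)]] by simp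

lemma abs_conv_add:
  assumes "abs_conv r a" "abs_conv r b" "r \<ge> 0"
  shows "abs_conv r (\<lambda>\<alpha>. a \<alpha> + b \<alpha>)"
  unfolding abs_conv_def
proof (rule summable_on_comparison_test)
  show "(\<lambda>\<alpha>. norm (a \<alpha>) * r ^ mdeg \<alpha> + norm (b \<alpha>) * r ^ mdeg \<alpha>) summable_on UNIV"
    using assms by (intro summable_on_add) (simp_all add: abs_conv_def)
qed (use assms(3) in \<open>auto simp: norm_triangle_ineq simp flip: distrib_right intro!: mult_right_mono\<close>)

lemma ps_eval_add:
  assumes "abs_conv r a" "abs_conv r b" "x \<in> polydisc r"
  shows "ps_eval (\<lambda>\<alpha>. a \<alpha> + b \<alpha>) x = ps_eval a x + ps_eval b x"
  using has_sum_add[OF abs_conv_has_sum[OF assms(1,3)] abs_conv_has_sum[OF assms(2,3)]]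
  by (simp add: ps_evalI distrib_right)

lemma abs_conv_cmult: "abs_conv r a \<Longrightarrow> abs_conv r (\<lambda>\<alpha>. c * a \<alpha>)"
  unfolding abs_conv_def by (simp add: norm_mult mult.assoc summable_on_cmult_right)

lemma abs_conv_diff:
  assumes "abs_conv r a" "abs_conv r b" "r \<ge> 0"
  shows "abs_conv r (\<lambda>\<alpha>. a \<alpha> - b \<alpha>)"
  using abs_conv_add[OF assms(1) abs_conv_cmult[OF assms(2), of "-1"] assms(3)] by simp

lemma ps_eval_diff:
  assumes "abs_conv r a" "abs_conv r b" "x \<in> polydisc r"
  shows "ps_eval (\<lambda>\<alpha>. a \<alpha> - b \<alpha>) x = ps_eval a x - ps_eval b x"
  using has_sum_diff[OF abs_conv_has_sum[OF assms(1,3)] abs_conv_has_sum[OF assms(2,3)]]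
  by (simp add: ps_evalI left_diff_distrib)

lemma ps_eval_split:
  assumes "abs_conv r a" "x \<in> polydisc r" "finite K"
  shows "ps_eval a x = (\<Sum>\<alpha>\<in>K. a \<alpha> * mpow x \<alpha>) + ps_eval (\<lambda>\<alpha>. if \<alpha> \<in> K then 0 else a \<alpha>) x"
proof -
  have "((\<lambda>\<alpha>. (if \<alpha> \<in> K then a \<alpha> else 0) * mpow x \<alpha>) has_sum (\<Sum>\<alpha>\<in>K. a \<alpha> * mpow x \<alpha>)) UNIV"
    by (rule has_sum_finite_neutralI[OF assms(3)]) auto
  from has_sum_diff[OF abs_conv_has_sum[OF assms(1,2)] this]
  have "((\<lambda>\<alpha>. (if \<alpha> \<in> K then 0 else a \<alpha>) * mpow x \<alpha>) has_sum ps_eval a x - (\<Sum>\<alpha>\<in>K. a \<alpha> * mpow x \<alpha>)) UNIV"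
    by (rule has_sum_cong[THEN iffD1, rotated]) auto
  from ps_evalI[OF this] show ?thesis by simp
qed

lemma abs_conv_truncate: "abs_conv r a \<Longrightarrow> r \<ge> 0 \<Longrightarrow> abs_conv r (\<lambda>\<alpha>. if \<alpha> \<in> K then 0 else a \<alpha>)"
  unfolding abs_conv_def by (erule summable_on_comparison_test) auto

text \<open>
  A series that starts in degree \<open>m\<close> gains the factor \<open>(t / r)\<^sup>m\<close> when the radius shrinks
  from \<open>r\<close> to \<open>t\<close>.
\<close>

lemma wnorm_tail_le:
  assumes "abs_conv r a" "r > 0" "0 \<le> t" "t \<le> r" "\<And>\<alpha>. mdeg \<alpha> < m \<Longrightarrow> a \<alpha> = 0"
  shows "wnorm t a \<le> (t / r) ^ m * wnorm r a"
proof -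
  have "wnorm t a \<le> (\<Sum>\<^sub>\<infinity>\<alpha>. (t / r) ^ m * (norm (a \<alpha>) * r ^ mdeg \<alpha>))"
    unfolding wnorm_def
  proof (rule infsum_mono)
    show "(\<lambda>\<alpha>. norm (a \<alpha>) * t ^ mdeg \<alpha>) summable_on UNIV"
      using abs_conv_mono[OF assms(1,3,4)] by (simp add: abs_conv_def)
    show "(\<lambda>\<alpha>. (t / r) ^ m * (norm (a \<alpha>) * r ^ mdeg \<alpha>)) summable_on UNIV"
      using assms(1) by (intro summable_on_cmult_right) (simp add: abs_conv_def)
    fix \<alpha> :: "nat ^ 'a"
    show "norm (a \<alpha>) * t ^ mdeg \<alpha> \<le> (t / r) ^ m * (norm (a \<alpha>) * r ^ mdeg \<alpha>)"
    proof (cases "mdeg \<alpha> < m")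
      case False
      have "(t / r) ^ mdeg \<alpha> \<le> (t / r) ^ m"
        using False assms by (intro power_decreasing) auto
      then have "norm (a \<alpha>) * ((t / r) ^ mdeg \<alpha> * r ^ mdeg \<alpha>) \<le> norm (a \<alpha>) * ((t / r) ^ m * r ^ mdeg \<alpha>)"
        using assms(2) by (intro mult_left_mono mult_right_mono) auto
      then show ?thesis
        using assms(2) by (simp add: power_divide mult_ac)
    qed (use assms(5) in simp)
  qed
  also have "\<dots> = (t / r) ^ m * wnorm r a"
    by (simp add: wnorm_def infsum_cmult_right')
  finally show ?thesis .
qed

lemma ps_eval_tail_le:
  assumes "abs_conv r a" "r > 0" "x \<in> polydisc t" "0 \<le> t" "t \<le> r" "\<And>\<alpha>. mdeg \<alpha> < m \<Longrightarrow> a \<alpha> = 0"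
  shows "norm (ps_eval a x) \<le> (t / r) ^ m * wnorm r a"
  using norm_ps_eval_le[OF abs_conv_mono[OF assms(1,4,5)] assms(3)]
    wnorm_tail_le[OF assms(1,2,4,5,6)] by (rule order_trans)

lemma has_derivative_quadratic:
  fixes f :: "'a::real_normed_vector \<Rightarrow> 'b::real_normed_vector"
  assumes "bounded_linear D" "t > 0" "\<And>h. norm h < t \<Longrightarrow> norm (f (x + h) - f x - D h) \<le> C * norm h ^ 2"
  shows "(f has_derivative D) (at x)"
  unfolding has_derivative_at
proof (intro conjI assms(1))
  show "(\<lambda>h. norm (f (x + h) - f x - D h) / norm h) \<midarrow>0\<rightarrow> 0"
  proof (rule Lim_null_comparison)
    show "\<forall>\<^sub>F h in at 0. norm (norm (f (x + h) - f x - D h) / norm h) \<le> C * norm h"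
    proof (rule eventually_at_ball'[of t 0 UNIV, THEN eventually_mono])
      fix h :: 'a assume h: "h \<in> ball 0 t \<and> h \<noteq> 0 \<and> h \<in> UNIV"
      then show "norm (norm (f (x + h) - f x - D h) / norm h) \<le> C * norm h"
        using assms(3)[of h] by (simp add: divide_le_eq power2_eq_square mult_ac)
    qed (rule assms)
    show "(\<lambda>h. C * norm h) \<midarrow>0\<rightarrow> 0"
      by (auto intro!: tendsto_eq_intros)
  qed
qed

lemma mdeg_axis [simp]: "mdeg (axis i n) = n"
  by (simp add: mdeg_def axis_def)

lemma mpow_axis [simp]: "mpow x (axis i n) = (x $ i) ^ n"
  by (simp add: mpow_def axis_def if_distrib[where f = "\<lambda>k. _ ^ k"] cong: if_cong)

lemma mfact_axis [simp]: "mfact (axis i (Suc 0)) = 1"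
proof -
  have "fact (axis i (Suc 0) $ j) = (1 :: complex)" for j by (simp add: axis_def)
  then show ?thesis by (simp add: mfact_def)
qed

lemma mdeg_less_2: "{\<alpha> :: nat ^ 'v. mdeg \<alpha> < 2} = insert 0 (range (\<lambda>i. axis i 1))"
proof safe
  fix \<alpha> :: "nat ^ 'v" assume a: "mdeg \<alpha> < 2" "\<alpha> \<notin> range (\<lambda>i. axis i 1)"
  show "\<alpha> = 0"
  proof (rule ccontr)
    assume "\<alpha> \<noteq> 0"
    then obtain i where i: "\<alpha> $ i \<noteq> 0" by (auto simp: vec_eq_iff)
    have s: "mdeg \<alpha> = \<alpha> $ i + (\<Sum>j\<in>UNIV - {i}. \<alpha> $ j)"
      unfolding mdeg_def by (rule sum.remove) auto
    then have 1: "\<alpha> $ i = 1" and "(\<Sum>j\<in>UNIV - {i}. \<alpha> $ j) = 0" using a(1) i by linarith+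
    then have "\<alpha> $ j = 0" if "j \<noteq> i" for j using that by auto
    then have "\<alpha> = axis i 1" using 1 by (auto simp: vec_eq_iff axis_def)
    then show False using a(2) by simp
  qed
qed auto

text \<open>
  The Taylor expansion at \<open>x\<close> is affine in \<open>h\<close> up to terms of degree at least two, which are
  quadratically small.
\<close>

lemma ps_eval_has_derivative:
  fixes a :: "'v::finite series"
  assumes "abs_conv (s + t) a" "0 \<le> s" "0 < t" "x \<in> polydisc s"
  shows "(ps_eval a has_derivative (\<lambda>h. \<Sum>i\<in>UNIV. ps_eval (ps_deriv (axis i 1) a) x * h $ i)) (at x)"
proof -
  define b where "b = (\<lambda>\<gamma>. ps_eval (ps_deriv \<gamma> a) x / mfact \<gamma>)"
  have b: "abs_conv t b" and bx: "\<And>h. h \<in> polydisc t \<Longrightarrow> ps_eval b h = ps_eval a (x + h)"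
    unfolding b_def using taylor[OF assms] by auto
  define b' where "b' = (\<lambda>\<alpha>. if \<alpha> \<in> {\<alpha>. mdeg \<alpha> < 2} then 0 else b \<alpha>)"
  have b': "abs_conv t b'"
    unfolding b'_def by (rule abs_conv_truncate[OF b]) (use assms in simp)
  have exp: "ps_eval a (x + h) - ps_eval a x - (\<Sum>i\<in>UNIV. ps_eval (ps_deriv (axis i 1) a) x * h $ i) = ps_eval b' h"
    if h: "h \<in> polydisc t" for h
  proof -
    have "ps_eval b h = (\<Sum>\<alpha>\<in>{\<alpha>. mdeg \<alpha> < 2}. b \<alpha> * mpow h \<alpha>) + ps_eval b' h"
      unfolding b'_def
      by (rule ps_eval_split[OF b h]) (use finite_mdeg_le[of 1] in \<open>simp add: less_2_cases_iff le_Suc_eq numeral_2_eq_2 less_Suc_eq_le\<close>)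
    also have "(\<Sum>\<alpha>\<in>{\<alpha>. mdeg \<alpha> < 2}. b \<alpha> * mpow h \<alpha>) = b 0 + (\<Sum>\<alpha>\<in>range (\<lambda>i. axis i 1). b \<alpha> * mpow h \<alpha>)"
      unfolding mdeg_less_2 by (subst sum.insert) (auto simp: axis_eq_0_iff)
    also have "(\<Sum>\<alpha>\<in>range (\<lambda>i. axis i 1). b \<alpha> * mpow h \<alpha>) = (\<Sum>i\<in>UNIV. b (axis i 1) * h $ i)"
      by (subst sum.reindex) (auto simp: inj_on_def axis_eq_axis)
    finally have "ps_eval b h = b 0 + (\<Sum>i\<in>UNIV. b (axis i 1) * h $ i) + ps_eval b' h" .
    moreover have "b 0 = ps_eval a x"
      using bx[of 0] assms by simp
    moreover have "b (axis i 1) = ps_eval (ps_deriv (axis i 1) a) x" for i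
      by (simp add: b_def)
    ultimately show ?thesis
      using bx[OF h] by simp
  qed
  show ?thesis
  proof (rule has_derivative_quadratic[OF _ assms(3)])
    show "bounded_linear (\<lambda>h :: complex ^ 'v. \<Sum>i\<in>UNIV. ps_eval (ps_deriv (axis i 1) a) x * h $ i)"
      by (intro bounded_linear_sum bounded_linear_const_mult bounded_linear_vec_nth)
    fix h :: "complex ^ 'v" assume h: "norm h < t"
    have "norm (ps_eval b' h) \<le> (norm h / t) ^ 2 * wnorm t b'"
      by (rule ps_eval_tail_le[OF b' assms(3)]) (use h in \<open>auto simp: b'_def intro: norm_in_polydisc\<close>)
    then show "norm (ps_eval a (x + h) - ps_eval a x - (\<Sum>i\<in>UNIV. ps_eval (ps_deriv (axis i 1) a) x * h $ i))
        \<le> (wnorm t b' / t ^ 2) * norm h ^ 2"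
      using exp[of h] h by (simp add: norm_in_polydisc power_divide mult_ac)
  qed
qed

text \<open>
  Induction on the set \<open>S\<close> of variables: a polynomial that vanishes identically has zero
  coefficients as a polynomial in one variable, and these are polynomials in the remaining ones. The sum ranges over
  exponents that are still distinguished by \<open>S\<close>.
\<close>

lemma poly_coeffs_zero:
  fixes a :: "nat ^ 'v \<Rightarrow> complex"
  assumes "finite K" "\<And>x. (\<Sum>\<alpha>\<in>K. a \<alpha> * mpow x \<alpha>) = 0" "\<alpha> \<in> K"
  shows "a \<alpha> = 0"
proof -
  have "\<forall>\<alpha>\<in>K. a \<alpha> = 0"
    if "finite S" "finite K" "\<forall>\<alpha>\<in>K. \<forall>\<beta>\<in>K. (\<forall>i\<in>S. \<alpha> $ i = \<beta> $ i) \<longrightarrow> \<alpha> = \<beta>"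
      "\<forall>x :: complex ^ 'v. (\<Sum>\<alpha>\<in>K. a \<alpha> * (\<Prod>i\<in>S. (x $ i) ^ (\<alpha> $ i))) = 0" for S K
    using that
  proof (induction S arbitrary: K rule: finite_induct)
    case empty
    show ?case
    proof
      fix \<alpha> assume \<alpha>: "\<alpha> \<in> K"
      then have "K = {\<alpha>}" using empty by auto
      then show "a \<alpha> = 0" using empty by simp
    qed
  next
    case (insert s S)
    show ?case
    proof
      fix \<alpha> assume \<alpha>: "\<alpha> \<in> K"
      let ?K = "\<lambda>m. {\<beta>\<in>K. \<beta> $ s = m}"
      let ?Q = "\<lambda>m x. \<Sum>\<beta>\<in>?K m. a \<beta> * (\<Prod>i\<in>S. (x $ i) ^ (\<beta> $ i))"
      define N where "N = Max ((\<lambda>\<beta>. \<beta> $ s) ` K)"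
      have N: "\<beta> $ s \<le> N" if "\<beta> \<in> K" for \<beta>
        unfolding N_def using that insert.prems(1) by (intro Max_ge) auto
      have "?Q (\<alpha> $ s) x = 0" for x :: "complex ^ 'v"
      proof -
        have "(\<Sum>m\<le>N. ?Q m x * t ^ m) = 0" for t
        proof -
          define y where "y = (\<chi> i. if i = s then t else x $ i)"
          have "0 = (\<Sum>\<beta>\<in>K. a \<beta> * (\<Prod>i\<in>insert s S. (y $ i) ^ (\<beta> $ i)))"
            using insert.prems(3) by simp
          also have "\<dots> = (\<Sum>\<beta>\<in>K. a \<beta> * (\<Prod>i\<in>S. (x $ i) ^ (\<beta> $ i)) * t ^ (\<beta> $ s))"
          proof (rule sum.cong)
            fix \<beta>
            have "(\<Prod>i\<in>S. (y $ i) ^ (\<beta> $ i)) = (\<Prod>i\<in>S. (x $ i) ^ (\<beta> $ i))"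
              using insert.hyps by (intro prod.cong) (auto simp: y_def)
            then show "a \<beta> * (\<Prod>i\<in>insert s S. (y $ i) ^ (\<beta> $ i)) = a \<beta> * (\<Prod>i\<in>S. (x $ i) ^ (\<beta> $ i)) * t ^ (\<beta> $ s)"
              using insert.hyps by (simp add: y_def)
          qed simp
          also have "\<dots> = (\<Sum>m\<le>N. \<Sum>\<beta>\<in>?K m. a \<beta> * (\<Prod>i\<in>S. (x $ i) ^ (\<beta> $ i)) * t ^ (\<beta> $ s))"
            using N insert.prems(1) by (intro sum.group[symmetric]) auto
          also have "\<dots> = (\<Sum>m\<le>N. ?Q m x * t ^ m)"
            by (intro sum.cong refl) (auto simp: sum_distrib_right intro!: sum.cong)
          finally show ?thesis by simp
        qed
        then have "\<forall>m\<le>N. ?Q m x = 0"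
          using polyfun_eq_0[of "\<lambda>m. ?Q m x" N] by blast
        then show ?thesis
          using N[OF \<alpha>] by blast
      qed
      then have "\<forall>\<beta>\<in>?K (\<alpha> $ s). a \<beta> = 0"
        using insert.prems by (intro insert.IH) auto
      then show "a \<alpha> = 0" using \<alpha> by auto
    qed
  qed
  from this[of UNIV K] show ?thesis
    using assms by (auto simp: vec_eq_iff mpow_def)
qed

text \<open>
  Along a curve with velocity \<open>v\<close> at \<open>0\<close>, the lowest homogeneous part is \<open>t\<^sup>m\<close> times a quantity
  tending to its value at \<open>v\<close>, while the rest is \<open>O(t\<^sup>m\<^sup>+\<^sup>1)\<close>.
\<close>

lemma leading_form_vanishes:
  fixes a :: "'v::finite series" and c :: "real \<Rightarrow> complex ^ 'v"
  assumes a: "abs_conv r a" "r > 0" "\<And>\<alpha>. mdeg \<alpha> < m \<Longrightarrow> a \<alpha> = 0"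
    and c: "c 0 = 0" "(c has_vector_derivative v) (at 0)" "\<forall>\<^sub>F t in nhds 0. ps_eval a (c t) = 0"
  shows "(\<Sum>\<alpha> | mdeg \<alpha> = m. a \<alpha> * mpow v \<alpha>) = 0"
proof -
  let ?P = "\<lambda>x. \<Sum>\<alpha> | mdeg \<alpha> = m. a \<alpha> * mpow x \<alpha>"
  define b where "b = (\<lambda>\<alpha>. if \<alpha> \<in> {\<alpha>. mdeg \<alpha> = m} then 0 else a \<alpha>)"
  have b: "abs_conv r b"
    unfolding b_def by (rule abs_conv_truncate[OF a(1)]) (use a in simp)
  have fin: "finite {\<alpha> :: nat ^ 'v. mdeg \<alpha> = m}"
    by (rule finite_subset[OF _ finite_mdeg_le[of m]]) auto
  have quot: "((\<lambda>t. (1 / t) *\<^sub>R c t) \<longlongrightarrow> v) (at 0)"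
  proof -
    have "((\<lambda>h. norm (c (0 + h) - c 0 - h *\<^sub>R v) / norm h) \<longlongrightarrow> 0) (at 0)"
      using c(2) unfolding has_vector_derivative_def has_derivative_at by blast
    moreover have "\<forall>\<^sub>F h in at 0. norm (c (0 + h) - c 0 - h *\<^sub>R v) / norm h = norm ((1 / h) *\<^sub>R c h - v)"
    proof (rule eventually_mono[OF eventually_neq_at_within[of 0]])
      fix h :: real assume "h \<noteq> 0"
      then have "(1 / h) *\<^sub>R c h - v = (1 / h) *\<^sub>R (c h - h *\<^sub>R v)"
        by (simp add: scaleR_diff_right)
      then show "norm (c (0 + h) - c 0 - h *\<^sub>R v) / norm h = norm ((1 / h) *\<^sub>R c h - v)"
        using c(1) by (simp add: divide_inverse)
    qed
    ultimately have "((\<lambda>h. norm ((1 / h) *\<^sub>R c h - v)) \<longlongrightarrow> 0) (at 0)"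
      by (rule Lim_transform_eventually)
    then show ?thesis
      by (simp add: tendsto_norm_zero_iff Lim_null[symmetric])
  qed
  have cont0: "(c \<longlongrightarrow> 0) (at 0)"
    using has_vector_derivative_continuous[OF c(2)] c(1) by (simp add: continuous_at)
  have limP: "((\<lambda>t. ?P ((1 / t) *\<^sub>R c t)) \<longlongrightarrow> ?P v) (at 0)"
    unfolding mpow_def by (intro tendsto_intros quot)
  have "((\<lambda>t. ?P ((1 / t) *\<^sub>R c t)) \<longlongrightarrow> 0) (at 0)"
  proof (rule Lim_null_comparison)
    have "\<forall>\<^sub>F t in at 0. norm (c t) < r"
      using tendstoD[OF cont0 a(2)] by simp
    moreover have "\<forall>\<^sub>F t in at 0. ps_eval a (c t) = 0"
      using c(3) by (simp add: eventually_at_filter eventually_mono)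
    moreover have "\<forall>\<^sub>F t in at 0. t \<noteq> (0 :: real)"
      by (rule eventually_neq_at_within)
    ultimately show "\<forall>\<^sub>F t in at 0. norm (?P ((1 / t) *\<^sub>R c t)) \<le>
        norm ((1 / t) *\<^sub>R c t) ^ m * norm (c t) * (wnorm r b / r ^ Suc m)"
    proof eventually_elim
      case (elim t)
      have in_r: "c t \<in> polydisc r" using elim by (intro norm_in_polydisc) simp
      have "0 = ?P (c t) + ps_eval b (c t)"
        using ps_eval_split[OF a(1) in_r fin] elim unfolding b_def by simp
      then have "norm (?P (c t)) = norm (ps_eval b (c t))"
        by (metis add_eq_0_iff norm_minus_cancel)
      also have "\<dots> \<le> (norm (c t) / r) ^ Suc m * wnorm r b"
        by (rule ps_eval_tail_le[OF b a(2)])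
           (use elim a(3) in \<open>auto simp: b_def less_Suc_eq intro: norm_in_polydisc\<close>)
      finally have 1: "norm (?P (c t)) \<le> (norm (c t) / r) ^ Suc m * wnorm r b" .
      have "(1 / t) *\<^sub>R c t = complex_of_real (1 / t) *s c t"
        unfolding vec_eq_iff vector_scaleR_component by (simp add: scaleR_conv_of_real)
      then have "?P ((1 / t) *\<^sub>R c t) = of_real (1 / t) ^ m * ?P (c t)"
        by (simp add: mpow_scale sum_distrib_left mult_ac)
      then have "norm (?P ((1 / t) *\<^sub>R c t)) = (1 / \<bar>t\<bar>) ^ m * norm (?P (c t))"
        by (simp add: norm_mult norm_power norm_divide)
      also have "\<dots> \<le> (1 / \<bar>t\<bar>) ^ m * ((norm (c t) / r) ^ Suc m * wnorm r b)"
        by (rule mult_left_mono[OF 1]) simp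
      also have "\<dots> = norm ((1 / t) *\<^sub>R c t) ^ m * norm (c t) * (wnorm r b / r ^ Suc m)"
        by (simp add: power_mult_distrib power_divide)
      finally show ?case .
    qed
    have "((\<lambda>t. norm ((1 / t) *\<^sub>R c t) ^ m * norm (c t) * (wnorm r b / r ^ Suc m)) \<longlongrightarrow>
        norm v ^ m * norm (0 :: complex ^ 'v) * (wnorm r b / r ^ Suc m)) (at 0)"
      by (intro tendsto_intros quot cont0)
    then show "((\<lambda>t. norm ((1 / t) *\<^sub>R c t) ^ m * norm (c t) * (wnorm r b / r ^ Suc m)) \<longlongrightarrow> 0) (at 0)"
      by simp
  qed
  with limP show ?thesis
    by (rule tendsto_unique[OF at_neq_bot])
qed

text \<open>
  A convergent power series vanishes as soon as it vanishes along sufficiently many curves: the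
  velocities need only fill a set on which no nonzero polynomial vanishes. Only the velocities enter, as arguments of
  the homogeneous part of lowest degree.
\<close>

lemma ps_zero_on_curves:
  fixes a :: "'v::finite series"
  assumes a: "abs_conv r a" "r > 0"
    and T: "\<And>K b. finite K \<Longrightarrow> (\<And>v. v \<in> T \<Longrightarrow> (\<Sum>\<alpha>\<in>K. b \<alpha> * mpow v \<alpha>) = (0 :: complex)) \<Longrightarrow>
          (\<And>v. (\<Sum>\<alpha>\<in>K. b \<alpha> * mpow v \<alpha>) = 0)"
    and curves: "\<And>v. v \<in> T \<Longrightarrow> \<exists>c. c 0 = 0 \<and> (c has_vector_derivative v) (at 0) \<and>
          (\<forall>\<^sub>F t in nhds (0 :: real). ps_eval a (c t) = 0)"
  shows "a = (\<lambda>_. 0)"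
proof (rule ccontr)
  assume "a \<noteq> (\<lambda>_. 0)"
  then obtain \<alpha>0 where \<alpha>0: "a \<alpha>0 \<noteq> 0" by auto
  define m where "m = (LEAST m. \<exists>\<alpha>. mdeg \<alpha> = m \<and> a \<alpha> \<noteq> 0)"
  have "\<exists>\<alpha>. mdeg \<alpha> = m \<and> a \<alpha> \<noteq> 0"
    unfolding m_def by (rule LeastI_ex) (use \<alpha>0 in blast)
  then obtain \<alpha> where \<alpha>: "mdeg \<alpha> = m" "a \<alpha> \<noteq> 0" by blast
  have low: "a \<beta> = 0" if "mdeg \<beta> < m" for \<beta>
    using not_less_Least[OF that[unfolded m_def]] by blast
  have fin: "finite {\<alpha> :: nat ^ 'v. mdeg \<alpha> = m}"
    by (rule finite_subset[OF _ finite_mdeg_le[of m]]) auto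
  have "(\<Sum>\<alpha> | mdeg \<alpha> = m. a \<alpha> * mpow v \<alpha>) = 0" if "v \<in> T" for v
    using curves[OF that] leading_form_vanishes[OF a low] by blast
  then have "(\<Sum>\<alpha> | mdeg \<alpha> = m. a \<alpha> * mpow v \<alpha>) = 0" for v
    by (rule T[OF fin])
  then have "a \<alpha> = 0"
    by (rule poly_coeffs_zero[OF fin]) (use \<alpha> in simp)
  then show False using \<alpha> by simp
qed

lemma ps_eq_zero:
  fixes a :: "'v::finite series"
  assumes "abs_conv r a" "r > 0" "\<forall>\<^sub>F x in nhds 0. ps_eval a x = 0"
  shows "a = (\<lambda>_. 0)"
proof (rule ps_zero_on_curves[OF assms(1,2), where T = UNIV])
  fix v :: "complex ^ 'v"
  have "((\<lambda>t :: real. t *\<^sub>R v) \<longlongrightarrow> 0 *\<^sub>R v) (nhds 0)"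
    by (intro tendsto_intros filterlim_ident)
  then have "\<forall>\<^sub>F t in nhds (0 :: real). ps_eval a (t *\<^sub>R v) = 0"
    using assms(3) unfolding filterlim_iff scale_zero_left by blast
  moreover have "((\<lambda>t :: real. t *\<^sub>R v) has_vector_derivative v) (at 0)"
    by (auto intro!: derivative_eq_intros)
  ultimately show "\<exists>c. c 0 = 0 \<and> (c has_vector_derivative v) (at 0) \<and>
          (\<forall>\<^sub>F t in nhds (0 :: real). ps_eval a (c t) = 0)"
    by (intro exI[of _ "\<lambda>t. t *\<^sub>R v"]) auto
qed auto

lemma ps_unique:
  fixes a b :: "'v::finite series"
  assumes "abs_conv r a" "abs_conv r b" "r > 0" "\<And>x. x \<in> polydisc r \<Longrightarrow> ps_eval a x = ps_eval b x"
  shows "a = b"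
proof -
  have 1: "abs_conv r (\<lambda>\<alpha>. a \<alpha> - b \<alpha>)"
    by (rule abs_conv_diff[OF assms(1,2) less_imp_le[OF assms(3)]])
  have 2: "ps_eval (\<lambda>\<alpha>. a \<alpha> - b \<alpha>) x = 0" if "x \<in> polydisc r" for x
    by (simp add: ps_eval_diff[OF assms(1,2) that] assms(4)[OF that])
  have *: "(\<lambda>\<alpha>. a \<alpha> - b \<alpha>) = (\<lambda>_. 0)"
    by (rule ps_eq_zero[OF 1 assms(3) eventually_mono[OF eventually_polydisc[OF assms(3)]]]) (rule 2)
  show ?thesis
  proof
    show "a \<alpha> = b \<alpha>" for \<alpha>
      using fun_cong[OF *, of \<alpha>] by simp
  qed
qed

section \<open>Polynomials on a totally real subspace\<close>

text \<open>
  A separately entire function that vanishes on the real points vanishes: the coordinates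
  are freed one at a time by the one-variable identity theorem.
\<close>

lemma vanish_on_reals:
  fixes Q :: "complex ^ 'v \<Rightarrow> complex"
  assumes hol: "\<And>s i. (\<lambda>t. Q (\<chi> j. if j = i then t else s $ j)) holomorphic_on UNIV"
    and real: "\<And>s. (\<And>i. s $ i \<in> \<real>) \<Longrightarrow> Q s = 0"
  shows "Q s = 0"
proof -
  have "\<forall>s. (\<forall>i. i \<notin> S \<longrightarrow> s $ i \<in> \<real>) \<longrightarrow> Q s = 0" if "finite S" for S
    using that
  proof (induction S rule: finite_induct)
    case (insert i S)
    show ?case
    proof (intro allI impI)
      fix s :: "complex ^ 'v" assume s: "\<forall>j. j \<notin> insert i S \<longrightarrow> s $ j \<in> \<real>"
      define g where "g = (\<lambda>t. Q (\<chi> j. if j = i then t else s $ j))"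
      have lim: "(0 :: complex) islimpt \<real>"
        unfolding islimpt_approachable
      proof safe
        fix e :: real assume "e > 0"
        then show "\<exists>x'\<in>\<real>. x' \<noteq> 0 \<and> dist x' (0 :: complex) < e"
          by (intro bexI[of _ "of_real (e / 2)"]) auto
      qed
      have "g (s $ i) = 0"
      proof (rule analytic_continuation[of g UNIV \<real> 0])
        show "g holomorphic_on UNIV" unfolding g_def by (rule hol)
        show "g t = 0" if "t \<in> \<real>" for t
          unfolding g_def using insert.IH s that by auto
      qed (use lim in auto)
      moreover have "(\<chi> j. if j = i then s $ i else s $ j) = s"
        by (simp add: vec_eq_iff)
      ultimately show "Q s = 0"
        by (simp add: g_def)
    qed
  qed (use real in auto)
  from this[of UNIV] show ?thesis by simp
qed

text \<open>
  The points \<open>(cnj z, z, w)\<close> with \<open>cnj w + w = 0\<close> are the images of the real points under the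
  invertible complex linear map \<open>(x, u, y) \<mapsto> (x - \<i>u, x + \<i>u, \<i>y)\<close>.
\<close>

lemma poly_zero_totally_real:
  fixes b :: "nat ^ (('n::finite + 'n) + 'k::finite) \<Rightarrow> complex"
  assumes "finite K"
    and zero: "\<And>z w. (\<And>j. cnj (w $ j) + w $ j = 0) \<Longrightarrow> (\<Sum>\<alpha>\<in>K. b \<alpha> * mpow (vjoin (vjoin (vec_cnj z) z) w) \<alpha>) = 0"
  shows "(\<Sum>\<alpha>\<in>K. b \<alpha> * mpow v \<alpha>) = 0"
proof -
  \<comment> \<open>the complexification of \<open>z = x + \<i>u\<close>, \<open>w = \<i>y\<close>, in the order \<open>(\<zeta>, z, w)\<close>\<close>
  define A :: "complex ^ (('n + 'n) + 'k) \<Rightarrow> complex ^ (('n + 'n) + 'k)" where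
    "A s = vjoin (vjoin (\<chi> i. s $ Inl (Inl i) - \<i> * s $ Inl (Inr i)) (\<chi> i. s $ Inl (Inl i) + \<i> * s $ Inl (Inr i)))
       (\<chi> j. \<i> * s $ Inr j)" for s
  define Q where "Q s = (\<Sum>\<alpha>\<in>K. b \<alpha> * mpow (A s) \<alpha>)" for s
  have Q0: "Q s = 0" for s
  proof (rule vanish_on_reals)
    fix s :: "complex ^ (('n + 'n) + 'k)" and i
    define u :: "complex \<Rightarrow> complex ^ (('n + 'n) + 'k)" where "u t = (\<chi> j. if j = i then t else s $ j)" for t
    have coord: "(\<lambda>t. u t $ l) holomorphic_on UNIV" for l
      by (cases "l = i") (auto simp: u_def intro!: holomorphic_intros)
    have comp: "(\<lambda>t. A (u t) $ l) holomorphic_on UNIV" for l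
    proof (cases l)
      case (Inl l')
      then show ?thesis
        by (cases l') (auto simp: A_def intro!: holomorphic_intros coord)
    next
      case (Inr l')
      then show ?thesis
        by (auto simp: A_def intro!: holomorphic_intros coord)
    qed
    show "(\<lambda>t. Q (\<chi> j. if j = i then t else s $ j)) holomorphic_on UNIV"
      using comp unfolding Q_def mpow_def u_def by (intro holomorphic_intros)
  next
    fix s :: "complex ^ (('n + 'n) + 'k)" assume s: "\<And>i. s $ i \<in> \<real>"
    have c: "cnj (s $ i) = s $ i" for i using s by (simp add: Reals_cnj_iff)
    have "A s = vjoin (vjoin (vec_cnj (\<chi> i. s $ Inl (Inl i) + \<i> * s $ Inl (Inr i))) (\<chi> i. s $ Inl (Inl i) + \<i> * s $ Inl (Inr i)))
       (\<chi> j. \<i> * s $ Inr j)"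
      by (simp add: A_def vec_cnj_def c)
    then show "Q s = 0"
      unfolding Q_def using zero c by simp
  qed
  define s where "s = vjoin (vjoin (\<chi> i. (v $ Inl (Inl i) + v $ Inl (Inr i)) / 2)
     (\<chi> i. (v $ Inl (Inr i) - v $ Inl (Inl i)) / (2 * \<i>))) (\<chi> j. - \<i> * v $ Inr j)"
  have "A s = v"
    by (auto simp: A_def s_def vec_eq_iff vjoin_def field_simps split: sum.splits)
  then show ?thesis
    using Q0[of s] by (simp add: Q_def)
qed

section \<open>The coefficients in the determining equations\<close>

lemma ps_deriv_axis: "ps_deriv (axis i 1) a \<delta> = of_nat (\<delta> $ i + 1) * a (\<delta> + axis i 1)"
proof -
  have "(fact ((\<delta> + axis i 1) $ j) :: complex) = fact (\<delta> $ j) * (if j = i then of_nat (\<delta> $ i + 1) else 1)" for j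
    by (simp add: axis_def)
  then have "mfact (\<delta> + axis i 1) = mfact \<delta> * of_nat (\<delta> $ i + 1)"
    unfolding mfact_def by (simp add: prod.distrib del: of_nat_add of_nat_Suc)
  then show ?thesis
    by (simp add: ps_deriv_def)
qed

lemma ps_deriv_Inl:
  "ps_deriv (axis (Inl v) 1) (sjoin c) = sjoin (\<lambda>k \<delta>. of_nat (k $ v + 1) * c (k + axis v 1) \<delta>)"
proof
  fix i
  show "ps_deriv (axis (Inl v) 1) (sjoin c) i = sjoin (\<lambda>k \<delta>. of_nat (k $ v + 1) * c (k + axis v 1) \<delta>) i"
    unfolding ps_deriv_axis by (simp add: sjoin_def vfst_vsnd_nth)
qed

lemma ps_deriv_Inr:
  "ps_deriv (axis (Inr l) 1) (sjoin c) = sjoin (\<lambda>k. ps_deriv (axis l 1) (c k))"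
proof
  fix i
  show "ps_deriv (axis (Inr l) 1) (sjoin c) i = sjoin (\<lambda>k. ps_deriv (axis l 1) (c k)) i"
    unfolding ps_deriv_axis sjoin_def vfst_add vsnd_add by (simp add: vfst_vsnd_nth)
qed

lemma ps_eval_cmult: "ps_eval (\<lambda>\<delta>. c * a \<delta>) w = c * ps_eval a w"
  by (simp add: ps_eval_def mult.assoc infsum_cmult_right')

lemma abs_conv_bar [simp]: "abs_conv r (ps_bar a) \<longleftrightarrow> abs_conv r a"
  by (simp add: abs_conv_def ps_bar_def)

lemma ps_bar_sjoin: "ps_bar (sjoin c) = sjoin (\<lambda>\<alpha>. ps_bar (c \<alpha>))"
  by (simp add: ps_bar_def sjoin_def)

lemma abs_conv_zero [simp]: "abs_conv r (\<lambda>_. 0)"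
  by (simp add: abs_conv_def)

lemma ps_eval_zero [simp]: "ps_eval (\<lambda>_. 0) x = 0"
  by (simp add: ps_eval_def)

lemma abs_conv_sum:
  assumes "\<And>i. i \<in> I \<Longrightarrow> abs_conv r (a i)" "r \<ge> 0"
  shows "abs_conv r (\<lambda>\<alpha>. \<Sum>i\<in>I. a i \<alpha>)"
  using assms by (induction I rule: infinite_finite_induct) (auto intro: abs_conv_add)

lemma ps_eval_sum:
  assumes "\<And>i. i \<in> I \<Longrightarrow> abs_conv r (a i)" "r \<ge> 0" "x \<in> polydisc r"
  shows "ps_eval (\<lambda>\<alpha>. \<Sum>i\<in>I. a i \<alpha>) x = (\<Sum>i\<in>I. ps_eval (a i) x)"
  using assms by (induction I rule: infinite_finite_induct) (auto simp: ps_eval_add[of r] abs_conv_sum)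

text \<open>
  A series in the second group of variables, regarded as a series in both.
\<close>

definition in_second :: "'q::finite series \<Rightarrow> ('p::finite + 'q) series" where
  "in_second a = (\<lambda>k. of_bool (vfst k = 0) * a (vsnd k))"

lemma in_second:
  fixes a :: "'q::finite series"
  assumes "abs_conv r a" "r > 0"
  shows abs_conv_in_second: "abs_conv r (in_second a :: ('p::finite + 'q) series)"
    and ps_eval_in_second: "\<And>y :: complex ^ ('p + 'q). y \<in> polydisc r \<Longrightarrow> ps_eval (in_second a) y = ps_eval a (vsnd y)"
proof -
  let ?e = "\<lambda>\<beta>. vjoin 0 \<beta> :: nat ^ ('p + 'q)"
  have sm: "(\<lambda>\<beta>. norm (a \<beta>) * r ^ mdeg (?e \<beta>)) summable_on UNIV"
    using assms(1) by (simp add: abs_conv_def)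
  have coll: "collect a ?e UNIV = in_second a"
  proof
    fix k :: "nat ^ ('p + 'q)"
    have "{\<beta> \<in> UNIV. ?e \<beta> = k} = (if vfst k = 0 then {vsnd k} else {})"
      by (auto simp: vjoin_eqI)
    then show "collect a ?e UNIV k = in_second a k"
      by (simp add: collect_def in_second_def)
  qed
  show "abs_conv r (in_second a :: ('p + 'q) series)"
    using collect_abs_conv[OF sm assms(2)] unfolding coll .
  fix y :: "complex ^ ('p + 'q)" assume y: "y \<in> polydisc r"
  have "((\<lambda>\<beta>. a \<beta> * mpow y (?e \<beta>)) has_sum ps_eval (in_second a) y) UNIV"
    using collect_eval[OF sm assms(2) y] unfolding coll .
  moreover have "mpow y (?e \<beta>) = mpow (vsnd y) \<beta>" for \<beta>
    by (subst vjoin_collapse[of y, symmetric], subst mpow_vjoin) simp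
  ultimately show "ps_eval (in_second a) y = ps_eval a (vsnd y)"
    by (simp add: ps_evalI)
qed

text \<open>
  In a product with a series that does not involve the first group of variables, the
  first exponent is carried by the other factor alone.
\<close>

lemma cauchy_in_second:
  "cauchy (in_second a) b k = (\<Sum>(\<beta>', \<beta>'') | \<beta>' + \<beta>'' = vsnd k. b (vjoin (vfst k) \<beta>'') * a \<beta>')"
proof -
  have "cauchy (in_second a) b k = (\<Sum>(i, j) | i + j = k \<and> vfst i = 0. in_second a i * b j)"
    unfolding cauchy_def
    by (rule sum.mono_neutral_right)
       (auto simp: in_second_def intro: finite_subset[OF _ finite_add_decomps[of k]])
  also have "\<dots> = (\<Sum>(\<beta>', \<beta>'') | \<beta>' + \<beta>'' = vsnd k. b (vjoin (vfst k) \<beta>'') * a \<beta>')"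
    by (rule sum.reindex_bij_witness[where i = "\<lambda>(\<beta>', \<beta>''). (vjoin 0 \<beta>', vjoin (vfst k) \<beta>'')"
          and j = "\<lambda>(i, j). (vsnd i, vsnd j)"])
       (auto simp: in_second_def vjoin_add vjoin_eqI)
  finally show ?thesis .
qed

lemma finite_family_decomps: "finite {a :: 'k::finite \<Rightarrow> nat ^ 'n. (\<Sum>j\<in>UNIV. a j) = \<alpha>}"
proof (rule finite_subset)
  show "{a :: 'k \<Rightarrow> nat ^ 'n. (\<Sum>j\<in>UNIV. a j) = \<alpha>} \<subseteq> UNIV \<rightarrow>\<^sub>E {\<beta>. mdeg \<beta> \<le> mdeg \<alpha>}"
  proof safe
    fix a :: "'k \<Rightarrow> nat ^ 'n" and j
    have "mdeg (a j) \<le> (\<Sum>j\<in>UNIV. mdeg (a j))"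
      by (rule member_le_sum) auto
    then show "mdeg (a j) \<le> mdeg (\<Sum>j\<in>UNIV. a j)"
      by (simp add: mdeg_sum)
  qed auto
  show "finite (UNIV \<rightarrow>\<^sub>E {\<beta> :: nat ^ 'n. mdeg \<beta> \<le> mdeg \<alpha>} :: ('k \<Rightarrow> nat ^ 'n) set)"
    by (intro finite_PiE finite_mdeg_le) simp
qed

lemma finite_decomps: "finite (decomps m \<alpha>)"
proof (rule finite_subset)
  show "decomps m \<alpha> \<subseteq> {..<m} \<rightarrow>\<^sub>E {\<beta>. mdeg \<beta> \<le> mdeg \<alpha>}"
  proof
    fix t assume t: "t \<in> decomps m \<alpha>"
    have "mdeg (t i) \<le> (\<Sum>i<m. mdeg (t i))" if "i < m" for i
      by (rule member_le_sum) (use that in auto)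
    then show "t \<in> {..<m} \<rightarrow>\<^sub>E {\<beta>. mdeg \<beta> \<le> mdeg \<alpha>}"
      using t by (auto simp: decomps_def mdeg_sum[symmetric])
  qed
qed (intro finite_PiE finite_mdeg_le; simp)

lemma sum_vjoin: "finite S \<Longrightarrow> (\<Sum>q\<in>S. vjoin (f q) (g q)) = vjoin (sum f S) (sum g S)"
  by (induction S rule: finite_induct) (auto simp: vjoin_add)

lemma vfst_sum: "finite S \<Longrightarrow> vfst (sum f S) = (\<Sum>q\<in>S. vfst (f q))"
  and vsnd_sum: "finite S \<Longrightarrow> vsnd (sum f S) = (\<Sum>q\<in>S. vsnd (f q))"
  by (induction S rule: finite_induct) auto

lemma sum_slots: "(\<Sum>q\<in>slots \<gamma>. f q) = (\<Sum>j\<in>UNIV. \<Sum>m<\<gamma> $ j. f (j, m))"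
  and prod_slots_nested: "(\<Prod>q\<in>slots \<gamma>. g q) = (\<Prod>j\<in>UNIV. \<Prod>m<\<gamma> $ j. g (j, m))"
  unfolding slots_def by (simp_all add: sum.Sigma prod.Sigma case_prod_unfold)

text \<open>
  The families \<open>a\<close>, \<open>b\<close> in \<open>calA\<close> are determined by their decompositions \<open>s\<close>, \<open>t\<close>, and a
  pair \<open>(s, t)\<close> is the same as a choice of one exponent \<open>(\<alpha>, \<beta>)\<close> in each slot.
\<close>

lemma calA_eq_series_power:
  fixes X :: "'k::finite \<Rightarrow> nat ^ 'n::finite \<Rightarrow> nat ^ 'n \<Rightarrow> complex"
  shows "calA X \<alpha> \<beta> \<gamma> = series_power (\<lambda>j k. X j (vfst k) (vsnd k)) \<gamma> (vjoin \<alpha> \<beta>)"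
proof -
  let ?AB = "{(a, b). (\<Sum>j\<in>UNIV. a j) = \<alpha> \<and> (\<Sum>j\<in>UNIV. b j) = \<beta>} :: (('k \<Rightarrow> nat ^ 'n) \<times> ('k \<Rightarrow> nat ^ 'n)) set"
  let ?ST = "\<lambda>(a, b). {(s, t). \<forall>j. s j \<in> decomps (\<gamma> $ j) (a j) \<and> t j \<in> decomps (\<gamma> $ j) (b j)}"
  let ?U = "{u \<in> slots \<gamma> \<rightarrow>\<^sub>E UNIV. (\<Sum>q\<in>slots \<gamma>. u q) = vjoin \<alpha> \<beta>}"
  have fAB: "finite ?AB"
    by (rule finite_subset[OF _ finite_cartesian_product[OF finite_family_decomps[of \<alpha>] finite_family_decomps[of \<beta>]]]) auto
  have fST: "finite (?ST p)" for p
  proof (rule finite_subset)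
    show "?ST p \<subseteq> (UNIV \<rightarrow>\<^sub>E (\<Union>j. decomps (\<gamma> $ j) (fst p j))) \<times> (UNIV \<rightarrow>\<^sub>E (\<Union>j. decomps (\<gamma> $ j) (snd p j)))"
      by (auto simp: PiE_def)
    show "finite (((UNIV :: 'k set) \<rightarrow>\<^sub>E (\<Union>j. decomps (\<gamma> $ j) (fst p j))) \<times> ((UNIV :: 'k set) \<rightarrow>\<^sub>E (\<Union>j. decomps (\<gamma> $ j) (snd p j))))"
      by (intro finite_cartesian_product finite_PiE) (simp_all add: finite_decomps)
  qed
  have "calA X \<alpha> \<beta> \<gamma> = (\<Sum>p\<in>?AB. \<Sum>q\<in>?ST p. \<Prod>j\<in>UNIV. \<Prod>m<\<gamma> $ j. X j (fst q j m) (snd q j m))"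
    by (simp add: calA_def case_prod_unfold)
  also have "\<dots> = (\<Sum>p\<in>Sigma ?AB ?ST. \<Prod>j\<in>UNIV. \<Prod>m<\<gamma> $ j. X j (fst (snd p) j m) (snd (snd p) j m))"
  proof -
    have "(\<Sum>p\<in>?AB. \<Sum>q\<in>?ST p. \<Prod>j\<in>UNIV. \<Prod>m<\<gamma> $ j. X j (fst q j m) (snd q j m)) =
        (\<Sum>(p, q)\<in>Sigma ?AB ?ST. \<Prod>j\<in>UNIV. \<Prod>m<\<gamma> $ j. X j (fst q j m) (snd q j m))"
      by (rule sum.Sigma[OF fAB]) (use fST in blast)
    also have "\<dots> = (\<Sum>p\<in>Sigma ?AB ?ST. \<Prod>j\<in>UNIV. \<Prod>m<\<gamma> $ j. X j (fst (snd p) j m) (snd (snd p) j m))"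
      by (rule sum.cong[OF refl]) (simp add: split_beta)
    finally show ?thesis .
  qed
  also have "\<dots> = (\<Sum>u\<in>?U. \<Prod>q\<in>slots \<gamma>. X (fst q) (vfst (u q)) (vsnd (u q)))"
  proof (rule sum.reindex_bij_witness[where
        i = "\<lambda>u. ((\<lambda>j. \<Sum>m<\<gamma> $ j. vfst (u (j, m)), \<lambda>j. \<Sum>m<\<gamma> $ j. vsnd (u (j, m))),
             (\<lambda>j. \<lambda>m\<in>{..<\<gamma> $ j}. vfst (u (j, m)), \<lambda>j. \<lambda>m\<in>{..<\<gamma> $ j}. vsnd (u (j, m))))" and
        j = "\<lambda>p. \<lambda>q\<in>slots \<gamma>. vjoin (fst (snd p) (fst q) (snd q)) (snd (snd p) (fst q) (snd q))"])
    fix p assume "p \<in> Sigma ?AB ?ST"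
    then obtain a b s t where p: "p = ((a, b), (s, t))" and ab: "(\<Sum>j\<in>UNIV. a j) = \<alpha>" "(\<Sum>j\<in>UNIV. b j) = \<beta>"
      and st: "\<And>j. s j \<in> {..<\<gamma> $ j} \<rightarrow>\<^sub>E UNIV" "\<And>j. (\<Sum>m<\<gamma> $ j. s j m) = a j"
        "\<And>j. t j \<in> {..<\<gamma> $ j} \<rightarrow>\<^sub>E UNIV" "\<And>j. (\<Sum>m<\<gamma> $ j. t j m) = b j"
      by (auto simp: decomps_def)
    let ?u = "\<lambda>q\<in>slots \<gamma>. vjoin (fst (snd p) (fst q) (snd q)) (snd (snd p) (fst q) (snd q))"
    have u: "?u (j, m) = vjoin (s j m) (t j m)" if "m < \<gamma> $ j" for j m
      using that by (simp add: p slots_def)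
    have rs: "(\<lambda>m\<in>{..<\<gamma> $ j}. vfst (?u (j, m))) = s j" "(\<lambda>m\<in>{..<\<gamma> $ j}. vsnd (?u (j, m))) = t j" for j
      using st(1)[of j] st(3)[of j] u by (auto simp: fun_eq_iff restrict_def PiE_def extensional_def)
    have sums: "(\<Sum>m<\<gamma> $ j. vfst (?u (j, m))) = a j" "(\<Sum>m<\<gamma> $ j. vsnd (?u (j, m))) = b j" for j
      using st(2)[of j] st(4)[of j] by (simp_all add: p slots_def cong: sum.cong_simp)
    show "((\<lambda>j. \<Sum>m<\<gamma> $ j. vfst (?u (j, m)), \<lambda>j. \<Sum>m<\<gamma> $ j. vsnd (?u (j, m))),
             (\<lambda>j. \<lambda>m\<in>{..<\<gamma> $ j}. vfst (?u (j, m)), \<lambda>j. \<lambda>m\<in>{..<\<gamma> $ j}. vsnd (?u (j, m)))) = p"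
      unfolding rs sums by (simp add: p)
    have "(\<Sum>q\<in>slots \<gamma>. ?u q) = (\<Sum>j\<in>UNIV. \<Sum>m<\<gamma> $ j. vjoin (s j m) (t j m))"
      unfolding sum_slots using u by (intro sum.cong) auto
    also have "\<dots> = vjoin \<alpha> \<beta>"
      using st(2,4) ab by (simp add: sum_vjoin)
    finally show "?u \<in> ?U" by auto
    show "(\<Prod>q\<in>slots \<gamma>. X (fst q) (vfst (?u q)) (vsnd (?u q))) =
        (\<Prod>j\<in>UNIV. \<Prod>m<\<gamma> $ j. X j (fst (snd p) j m) (snd (snd p) j m))"
      unfolding prod_slots_nested using u by (intro prod.cong refl) (simp add: p)
  next
    fix u assume u: "u \<in> ?U"
    let ?p = "((\<lambda>j. \<Sum>m<\<gamma> $ j. vfst (u (j, m)), \<lambda>j. \<Sum>m<\<gamma> $ j. vsnd (u (j, m))),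
             (\<lambda>j. \<lambda>m\<in>{..<\<gamma> $ j}. vfst (u (j, m)), \<lambda>j. \<lambda>m\<in>{..<\<gamma> $ j}. vsnd (u (j, m))))"
    have "(\<Sum>j\<in>UNIV. \<Sum>m<\<gamma> $ j. u (j, m)) = vjoin \<alpha> \<beta>"
      using u sum_slots[of u \<gamma>] by simp
    from arg_cong[OF this, of vfst] arg_cong[OF this, of vsnd]
    have "(\<Sum>j\<in>UNIV. \<Sum>m<\<gamma> $ j. vfst (u (j, m))) = \<alpha>" "(\<Sum>j\<in>UNIV. \<Sum>m<\<gamma> $ j. vsnd (u (j, m))) = \<beta>"
      by (simp_all add: vfst_sum vsnd_sum)
    then show "?p \<in> Sigma ?AB ?ST"
      by (auto simp: decomps_def)
    show "(\<lambda>q\<in>slots \<gamma>. vjoin (fst (snd ?p) (fst q) (snd q)) (snd (snd ?p) (fst q) (snd q))) = u"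
      using u by (auto simp: fun_eq_iff slots_def PiE_def extensional_def)
  qed
  also have "\<dots> = series_power (\<lambda>j k. X j (vfst k) (vsnd k)) \<gamma> (vjoin \<alpha> \<beta>)"
  proof -
    have "finite ?U"
    proof (rule finite_subset)
      show "?U \<subseteq> slots \<gamma> \<rightarrow>\<^sub>E {k. mdeg k \<le> mdeg (vjoin \<alpha> \<beta>)}"
      proof
        fix u assume u: "u \<in> ?U"
        have "mdeg (u q) \<le> (\<Sum>q\<in>slots \<gamma>. mdeg (u q))" if "q \<in> slots \<gamma>" for q
          by (rule member_le_sum) (use that in auto)
        moreover have "(\<Sum>q\<in>slots \<gamma>. mdeg (u q)) = mdeg (vjoin \<alpha> \<beta>)"
          using u by (simp add: mdeg_sum[symmetric])
        ultimately show "u \<in> slots \<gamma> \<rightarrow>\<^sub>E {k. mdeg k \<le> mdeg (vjoin \<alpha> \<beta>)}"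
          using u by (auto simp: PiE_def)
      qed
    qed (intro finite_PiE finite_slots finite_mdeg_le)
    then show ?thesis
      by (simp add: series_power_def collect_def)
  qed
  finally show ?thesis .
qed

text \<open>
  The expansion of \<open>A(\<zeta>, w + b(\<zeta>, z))\<close> in powers of \<open>(\<zeta>, z)\<close> for fixed \<open>w\<close>. Taylor's formula at
  \<open>(0, w)\<close> with increment \<open>(\<zeta>, b)\<close> gives the terms \<open>\<zeta>\<close> to the power \<open>\<alpha>'\<close> times \<open>b\<close> to the power \<open>\<gamma>\<close>; the
  powers of \<open>b\<close> are expanded and equal exponents collected. Inner series of norm at most \<open>t\<close>, with
  \<open>s + t\<close> a radius of convergence of \<open>A\<close>, keep all sums absolutely convergent.
\<close>

lemma taylor_subst:
  fixes c :: "nat ^ 'n::finite \<Rightarrow> 'k::finite series" and b :: "'k \<Rightarrow> ('n + 'n) series"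
  assumes c: "abs_conv (s + t) (sjoin c)" "0 \<le> s" "0 < t" "w \<in> polydisc s"
    and b: "\<And>j. abs_conv r (b j)" "r > 0" "r \<le> t" "\<And>j. wnorm r (b j) \<le> t"
  defines "e \<equiv> \<lambda>\<gamma> k. \<Sum>(\<alpha>', \<alpha>'') | \<alpha>' + \<alpha>'' = vfst k.
             1 / mfact \<gamma> * series_power b \<gamma> (vjoin \<alpha>'' (vsnd k)) * ps_eval (ps_deriv \<gamma> (c \<alpha>')) w"
  shows taylor_subst_summable: "\<And>k. (\<lambda>\<gamma>. e \<gamma> k) summable_on UNIV"
    and taylor_subst_abs_conv: "abs_conv r (\<lambda>k. \<Sum>\<^sub>\<infinity>\<gamma>. e \<gamma> k)"
    and taylor_subst_eval: "\<And>y. y \<in> polydisc r \<Longrightarrow>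
       ps_eval (\<lambda>k. \<Sum>\<^sub>\<infinity>\<gamma>. e \<gamma> k) y = ps_eval (sjoin c) (vjoin (vfst y) (w + (\<chi> j. ps_eval (b j) y)))"
proof -
  \<comment> \<open>the base point of the Taylor expansion; its coefficients are the family \<open>d\<close>\<close>
  let ?y0 = "vjoin 0 w :: complex ^ ('n + 'k)"
  define d where "d \<alpha> \<gamma> = ps_eval (ps_deriv \<gamma> (c \<alpha>)) w / mfact \<gamma>" for \<alpha> \<gamma>
  have y0: "?y0 \<in> polydisc s" using c by simp
  have D: "(\<lambda>\<gamma>. ps_eval (ps_deriv \<gamma> (sjoin c)) ?y0 / mfact \<gamma>) = sjoin d"
  proof
    fix i :: "nat ^ ('n + 'k)"
    have "ps_eval (ps_deriv (vjoin (vfst i) (vsnd i)) (sjoin c)) ?y0 / mfact (vjoin (vfst i) (vsnd i)) = sjoin d i"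
      unfolding ps_eval_deriv_sjoin mfact_vjoin by (simp add: sjoin_def d_def)
    then show "ps_eval (ps_deriv i (sjoin c)) ?y0 / mfact i = sjoin d i" by simp
  qed
  have dc: "abs_conv t (sjoin d)"
    using abs_conv_taylor[OF c(1,2,3) y0] unfolding D .
  have dv: "ps_eval (sjoin d) h = ps_eval (sjoin c) (?y0 + h)" if "h \<in> polydisc t" for h
    using ps_eval_taylor[OF c(1,2,3) y0 that] unfolding D .
  let ?c = "\<lambda>((\<alpha>', \<gamma>), i). d \<alpha>' \<gamma> * series_power b \<gamma> i" and ?e = "\<lambda>((\<alpha>', \<gamma>), i). vjoin \<alpha>' 0 + i"
  have s1: "(\<lambda>x. norm (?c x) * r ^ mdeg (?e x)) summable_on (SIGMA p:UNIV. UNIV)"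
  proof (rule summable_on_SigmaI)
    fix p :: "(nat ^ 'n) \<times> (nat ^ 'k)"
    have "((\<lambda>i. norm (d (fst p) (snd p)) * r ^ mdeg (fst p) * (norm (series_power b (snd p) i) * r ^ mdeg i)) has_sum
        norm (d (fst p) (snd p)) * r ^ mdeg (fst p) * wnorm r (series_power b (snd p))) UNIV"
      unfolding wnorm_def
      by (intro has_sum_cmult_right has_sum_infsum) (use abs_conv_series_power[OF b(1,2)] in \<open>simp add: abs_conv_def\<close>)
    then show "((\<lambda>i. norm (?c (p, i)) * r ^ mdeg (?e (p, i))) has_sum
        norm (d (fst p) (snd p)) * r ^ mdeg (fst p) * wnorm r (series_power b (snd p))) UNIV"
      by (simp add: case_prod_unfold norm_mult mdeg_add power_add mult_ac)
  next
    have le: "norm (d (fst p) (snd p)) * r ^ mdeg (fst p) * wnorm r (series_power b (snd p)) \<le>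
       norm (sjoin d (vjoin (fst p) (snd p))) * t ^ mdeg (vjoin (fst p) (snd p))" for p
    proof -
      have "norm (d (fst p) (snd p)) * (r ^ mdeg (fst p) * wnorm r (series_power b (snd p))) \<le>
          norm (d (fst p) (snd p)) * (t ^ mdeg (fst p) * t ^ mdeg (snd p))"
        using b(2,3) wnorm_series_power_le[OF b(1,2,4)]
        by (intro mult_left_mono mult_mono power_mono wnorm_nonneg) auto
      then show ?thesis by (simp add: power_add mult_ac)
    qed
    have "(\<lambda>p. norm (sjoin d (vjoin (fst p) (snd p))) * t ^ mdeg (vjoin (fst p) (snd p))) summable_on UNIV"
      using dc summable_on_vjoin[of "\<lambda>i. norm (sjoin d i) * t ^ mdeg i"]
      by (simp add: abs_conv_def case_prod_unfold)
    then show "(\<lambda>p. norm (d (fst p) (snd p)) * r ^ mdeg (fst p) * wnorm r (series_power b (snd p))) summable_on UNIV"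
      by (rule summable_on_comparison_test[OF _ le])
         (use b(2) wnorm_nonneg[of r] in \<open>auto intro!: mult_nonneg_nonneg\<close>)
  qed (use b(2) in auto)
  then have sm: "(\<lambda>x. norm (?c x) * r ^ mdeg (?e x)) summable_on UNIV" by simp
  \<comment> \<open>the terms with exponent \<open>k\<close>, parametrized by \<open>\<gamma>\<close> and the decompositions of the first half of \<open>k\<close>\<close>
  let ?D = "\<lambda>k :: nat ^ ('n + 'n). {(\<alpha>', \<alpha>''). \<alpha>' + \<alpha>'' = vfst k}"
  let ?g = "\<lambda>(k :: nat ^ ('n + 'n)) (\<gamma> :: nat ^ 'k, \<alpha>' :: nat ^ 'n, \<alpha>'' :: nat ^ 'n). ((\<alpha>', \<gamma>), vjoin \<alpha>'' (vsnd k))"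
  have bij: "bij_betw (?g k) (SIGMA \<gamma>:UNIV. ?D k) {x \<in> UNIV. ?e x = k}" for k :: "nat ^ ('n + 'n)"
  proof (rule bij_betwI[where g = "\<lambda>((\<alpha>', \<gamma>), i). (\<gamma>, (\<alpha>', vfst i))"])
    show "?g k \<in> (SIGMA \<gamma>:UNIV. ?D k) \<rightarrow> {x \<in> UNIV. ?e x = k}"
      by (auto simp: vjoin_add)
    show "(\<lambda>((\<alpha>', \<gamma>), i). (\<gamma>, (\<alpha>', vfst i))) \<in> {x \<in> UNIV. ?e x = k} \<rightarrow> (SIGMA \<gamma>:UNIV. ?D k)"
      by auto
  next
    fix x :: "((nat ^ 'n) \<times> (nat ^ 'k)) \<times> (nat ^ ('n + 'n))" assume x: "x \<in> {x \<in> UNIV. ?e x = k}"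
    obtain \<alpha>' \<gamma> i where "x = ((\<alpha>', \<gamma>), i)" by (metis surj_pair)
    with x show "?g k ((\<lambda>((\<alpha>', \<gamma>), i). (\<gamma>, (\<alpha>', vfst i))) x) = x"
      by auto
  qed auto
  have inner: "(\<Sum>\<^sub>\<infinity>p\<in>?D k. ?c (?g k (\<gamma>, p))) = e \<gamma> k" for \<gamma> k
    using finite_add_decomps[of "vfst k"] by (simp add: e_def d_def case_prod_unfold mult_ac)
  have fs: "(\<lambda>q. ?c (?g k q)) summable_on (SIGMA \<gamma>:UNIV. ?D k)" for k
    using collect_fibre[OF sm b(2), of k] by (simp only: summable_on_reindex_bij_betw[OF bij, where f = ?c])
  have coll: "collect ?c ?e UNIV = (\<lambda>k. \<Sum>\<^sub>\<infinity>\<gamma>. e \<gamma> k)"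
  proof
    fix k
    have "collect ?c ?e UNIV k = (\<Sum>\<^sub>\<infinity>q\<in>(SIGMA \<gamma>:UNIV. ?D k). ?c (?g k q))"
      unfolding collect_def by (rule infsum_reindex_bij_betw[OF bij, symmetric])
    also have "\<dots> = (\<Sum>\<^sub>\<infinity>\<gamma>. e \<gamma> k)"
      unfolding inner[symmetric] by (rule infsum_Sigma_banach[OF fs, symmetric])
    finally show "collect ?c ?e UNIV k = (\<Sum>\<^sub>\<infinity>\<gamma>. e \<gamma> k)" .
  qed
  show "(\<lambda>\<gamma>. e \<gamma> k) summable_on UNIV" for k
    unfolding inner[symmetric] by (rule summable_on_Sigma_banach) (use fs[of k] in \<open>simp add: case_prod_unfold\<close>)
  show "abs_conv r (\<lambda>k. \<Sum>\<^sub>\<infinity>\<gamma>. e \<gamma> k)"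
    using collect_abs_conv[OF sm b(2)] unfolding coll .
  fix y :: "complex ^ ('n + 'n)" assume y: "y \<in> polydisc r"
  let ?X = "\<chi> j. ps_eval (b j) y"
  have "((\<lambda>x. ?c x * mpow y (?e x)) has_sum ps_eval (\<lambda>k. \<Sum>\<^sub>\<infinity>\<gamma>. e \<gamma> k) y) (SIGMA p:UNIV. UNIV)"
    using collect_eval[OF sm b(2) y] unfolding coll by simp
  then have "((\<lambda>p. d (fst p) (snd p) * mpow (vfst y) (fst p) * mpow ?X (snd p)) has_sum
      ps_eval (\<lambda>k. \<Sum>\<^sub>\<infinity>\<gamma>. e \<gamma> k) y) UNIV"
  proof (rule has_sum_SigmaD)
    fix p :: "(nat ^ 'n) \<times> (nat ^ 'k)"
    have m: "mpow y (vjoin \<alpha> 0) = mpow (vfst y) \<alpha>" for \<alpha>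
      by (subst vjoin_collapse[of y, symmetric], subst mpow_vjoin) simp
    have "((\<lambda>i. d (fst p) (snd p) * mpow (vfst y) (fst p) * (series_power b (snd p) i * mpow y i)) has_sum
       d (fst p) (snd p) * mpow (vfst y) (fst p) * ps_eval (series_power b (snd p)) y) UNIV"
      by (intro has_sum_cmult_right abs_conv_has_sum[OF abs_conv_series_power[OF b(1,2)] y])
    then show "((\<lambda>i. ?c (p, i) * mpow y (?e (p, i))) has_sum
       d (fst p) (snd p) * mpow (vfst y) (fst p) * mpow ?X (snd p)) UNIV"
      unfolding ps_eval_series_power[OF b(1,2) y] by (simp add: case_prod_unfold mpow_add m mult_ac)
  qed
  note hs = this
  have hp: "vjoin (vfst y) ?X \<in> polydisc t"
  proof -
    have "vfst y \<in> polydisc r" using y by (metis vjoin_collapse vjoin_in_polydisc)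
    then show ?thesis
      using in_polydisc_ps_eval[of r b t y, OF b(1,4) y] polydisc_mono[OF _ b(3)] by simp
  qed
  have "((\<lambda>p. d (fst p) (snd p) * mpow (vfst y) (fst p) * mpow ?X (snd p)) has_sum
      ps_eval (sjoin d) (vjoin (vfst y) ?X)) UNIV"
    using abs_conv_has_sum[OF dc hp] has_sum_vjoin[of "\<lambda>i. sjoin d i * mpow (vjoin (vfst y) ?X) i"]
    by (simp add: case_prod_unfold mult.assoc)
  with hs have "ps_eval (\<lambda>k. \<Sum>\<^sub>\<infinity>\<gamma>. e \<gamma> k) y = ps_eval (sjoin d) (vjoin (vfst y) ?X)"
    by (rule has_sum_unique)
  also have "\<dots> = ps_eval (sjoin c) (vjoin (vfst y) (w + ?X))"
    unfolding dv[OF hp] by (simp add: vjoin_add)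
  finally show "ps_eval (\<lambda>k. \<Sum>\<^sub>\<infinity>\<gamma>. e \<gamma> k) y = ps_eval (sjoin c) (vjoin (vfst y) (w + ?X))" .
qed

section \<open>Germs of analytic functions\<close>

definition analytic0 :: "(complex ^ 'v \<Rightarrow> complex) \<Rightarrow> bool" where
  "analytic0 f \<longleftrightarrow> (\<exists>r>0. \<exists>a. abs_conv r a \<and> (\<forall>x\<in>polydisc r. f x = ps_eval a x))"

lemma analytic0I: "r > 0 \<Longrightarrow> abs_conv r a \<Longrightarrow> (\<And>x. x \<in> polydisc r \<Longrightarrow> f x = ps_eval a x) \<Longrightarrow> analytic0 f"
  by (auto simp: analytic0_def)

lemma analytic0_ps: "abs_conv r a \<Longrightarrow> r > 0 \<Longrightarrow> analytic0 (ps_eval a)"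
  by (rule analytic0I) auto

lemma analytic0_common:
  fixes f g :: "complex ^ 'v \<Rightarrow> complex"
  assumes "analytic0 f" "analytic0 g"
  obtains r a b where "r > 0" "abs_conv r a" "abs_conv r b"
    "\<And>x. x \<in> polydisc r \<Longrightarrow> f x = ps_eval a x" "\<And>x. x \<in> polydisc r \<Longrightarrow> g x = ps_eval b x"
proof -
  obtain r1 a r2 b where 1: "r1 > 0" "abs_conv r1 a" "\<And>x. x \<in> polydisc r1 \<Longrightarrow> f x = ps_eval a x"
    and 2: "r2 > 0" "abs_conv r2 b" "\<And>x. x \<in> polydisc r2 \<Longrightarrow> g x = ps_eval b x"
    using assms unfolding analytic0_def by metis
  show ?thesis
  proof (rule that)
    show "min r1 r2 > 0" using 1(1) 2(1) by simp
    show "abs_conv (min r1 r2) a" by (rule abs_conv_mono[OF 1(2)]) (use 1(1) 2(1) in auto)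
    show "abs_conv (min r1 r2) b" by (rule abs_conv_mono[OF 2(2)]) (use 1(1) 2(1) in auto)
    show "f x = ps_eval a x" "g x = ps_eval b x" if "x \<in> polydisc (min r1 r2)" for x
      using 1(3) 2(3) polydisc_mono[OF that] by simp_all
  qed
qed

lemma analytic0_add:
  assumes "analytic0 f" "analytic0 g"
  shows "analytic0 (\<lambda>x. f x + g x)"
proof -
  obtain r a b where *: "r > 0" "abs_conv r a" "abs_conv r b"
    "\<And>x. x \<in> polydisc r \<Longrightarrow> f x = ps_eval a x" "\<And>x. x \<in> polydisc r \<Longrightarrow> g x = ps_eval b x"
    using analytic0_common[OF assms] by blast
  then show ?thesis
    by (intro analytic0I[of r "\<lambda>\<alpha>. a \<alpha> + b \<alpha>"]) (auto simp: abs_conv_add ps_eval_add[of r])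
qed

lemma analytic0_mult:
  assumes "analytic0 f" "analytic0 g"
  shows "analytic0 (\<lambda>x. f x * g x)"
proof -
  obtain r a b where *: "r > 0" "abs_conv r a" "abs_conv r b"
    "\<And>x. x \<in> polydisc r \<Longrightarrow> f x = ps_eval a x" "\<And>x. x \<in> polydisc r \<Longrightarrow> g x = ps_eval b x"
    using analytic0_common[OF assms] by blast
  then show ?thesis
    by (intro analytic0I[of r "cauchy a b"]) (auto simp: abs_conv_cauchy ps_eval_cauchy)
qed

lemma analytic0_const: "analytic0 (\<lambda>_. c)"
proof (rule analytic0I[of 1 "\<lambda>\<alpha>. if \<alpha> = 0 then c else 0"])
  show "abs_conv 1 (\<lambda>\<alpha>. if \<alpha> = 0 then c else 0)"
    unfolding abs_conv_def
    by (rule has_sum_imp_summable, rule has_sum_finite_neutralI[where B = "{0}"]) auto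
  show "c = ps_eval (\<lambda>\<alpha>. if \<alpha> = 0 then c else 0) x" for x
    by (rule ps_evalI[symmetric], rule has_sum_finite_neutralI[where B = "{0}"]) auto
qed auto

lemma analytic0_coord: "analytic0 (\<lambda>x. x $ i)"
proof (rule analytic0I[of 1 "\<lambda>\<alpha>. if \<alpha> = axis i 1 then 1 else 0"])
  show "abs_conv 1 (\<lambda>\<alpha>. if \<alpha> = axis i 1 then 1 else 0)"
    unfolding abs_conv_def
    by (rule has_sum_imp_summable, rule has_sum_finite_neutralI[where B = "{axis i 1}"]) auto
  show "x $ i = ps_eval (\<lambda>\<alpha>. if \<alpha> = axis i 1 then 1 else 0) x" for x
    by (rule ps_evalI[symmetric], rule has_sum_finite_neutralI[where B = "{axis i 1}"]) auto
qed auto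

lemma analytic0_diff: "analytic0 f \<Longrightarrow> analytic0 g \<Longrightarrow> analytic0 (\<lambda>x. f x - g x)"
  using analytic0_add[of f "\<lambda>x. (-1) * g x"] analytic0_mult[OF analytic0_const, of g "-1"] by simp

lemma analytic0_sum:
  assumes "\<And>i. i \<in> I \<Longrightarrow> analytic0 (f i)"
  shows "analytic0 (\<lambda>x. \<Sum>i\<in>I. f i x)"
  using assms by (induction I rule: infinite_finite_induct) (auto intro: analytic0_add analytic0_const)

text \<open>
  Without a constant term, the weighted norm tends to \<open>0\<close> with the radius; thus a series vanishing
  at \<open>0\<close> may be substituted into any convergent series.
\<close>

lemma wnorm_small:
  assumes "abs_conv r a" "r > 0" "a 0 = 0" "s > 0"
  obtains t where "0 < t" "t \<le> r" "\<And>t'. 0 < t' \<Longrightarrow> t' \<le> t \<Longrightarrow> wnorm t' a \<le> s"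
proof
  \<comment> \<open>the summand \<open>1\<close> only avoids a division by zero\<close>
  let ?t = "min r (s * r / (wnorm r a + 1))"
  have nn: "wnorm r a \<ge> 0" using assms by (simp add: wnorm_nonneg)
  show "0 < ?t" "?t \<le> r" using assms nn by auto
  fix t' assume t': "0 < t'" "t' \<le> ?t"
  have "wnorm t' a \<le> (t' / r) ^ 1 * wnorm r a"
    by (rule wnorm_tail_le[OF assms(1,2)]) (use t' assms in auto)
  also have "\<dots> \<le> (s / (wnorm r a + 1)) * wnorm r a"
    using t' assms nn by (intro mult_right_mono) (auto simp: field_simps)
  also have "\<dots> \<le> s"
    using assms(4) nn by (simp add: field_simps)
  finally show "wnorm t' a \<le> s" .
qed

lemma wnorm_small_family:
  fixes b :: "'k::finite \<Rightarrow> 'v::finite series"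
  assumes "\<And>j. abs_conv r (b j)" "r > 0" "\<And>j. b j 0 = 0" "s > 0"
  obtains t where "0 < t" "t \<le> r" "\<And>j t'. 0 < t' \<Longrightarrow> t' \<le> t \<Longrightarrow> wnorm t' (b j) \<le> s"
proof -
  have "\<forall>j. \<exists>t. 0 < t \<and> t \<le> r \<and> (\<forall>t'. 0 < t' \<longrightarrow> t' \<le> t \<longrightarrow> wnorm t' (b j) \<le> s)"
    using wnorm_small[OF assms(1,2,3,4)] by metis
  then obtain T where T: "\<And>j. 0 < T j" "\<And>j. T j \<le> r" "\<And>j t'. 0 < t' \<Longrightarrow> t' \<le> T j \<Longrightarrow> wnorm t' (b j) \<le> s"
    by metis
  show ?thesis
  proof (rule that[of "Min (range T)"])
    show "Min (range T) \<le> r"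
      using T(2)[of undefined] by (meson Min_le finite finite_imageI order_trans rangeI)
  qed (use T in auto)
qed

lemma analytic0_compose:
  fixes a :: "'k::finite series" and g :: "'k \<Rightarrow> complex ^ 'v \<Rightarrow> complex"
  assumes "abs_conv s a" "s > 0" "\<And>j. analytic0 (g j)" "\<And>j. g j 0 = 0"
  shows "analytic0 (\<lambda>x. ps_eval a (\<chi> j. g j x))"
proof -
  have "\<forall>j. \<exists>r b. r > 0 \<and> abs_conv r b \<and> (\<forall>x\<in>polydisc r. g j x = ps_eval b x)"
    using assms(3) unfolding analytic0_def by blast
  then obtain R b where R: "\<And>j. R j > 0" "\<And>j. abs_conv (R j) (b j)"
    "\<And>j x. x \<in> polydisc (R j) \<Longrightarrow> g j x = ps_eval (b j) x" by metis
  define r where "r = Min (range R)"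
  have r: "r > 0" "\<And>j. r \<le> R j" using R by (auto simp: r_def)
  have b: "abs_conv r (b j)" for j using abs_conv_mono[OF R(2) _ r(2)] r(1) by simp
  have b0: "b j 0 = 0" for j
    using R(3)[of 0 j] R(1)[of j] assms(4)[of j] by simp
  obtain t where t: "0 < t" "t \<le> r" "\<And>j t'. 0 < t' \<Longrightarrow> t' \<le> t \<Longrightarrow> wnorm t' (b j) \<le> s"
    using wnorm_small_family[of r b s, OF b r(1) b0 assms(2)] by blast
  have bt: "abs_conv t (b j)" for j using abs_conv_mono[OF b _ t(2)] t(1) by simp
  obtain c where c: "abs_conv t c" "\<forall>y\<in>polydisc t. ps_eval c y = ps_eval a (\<chi> j. ps_eval (b j) y)"
    using ps_compose[of s a t b, OF assms(1) bt t(1) t(3)[OF t(1) order_refl]] by blast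
  show ?thesis
  proof (rule analytic0I[OF t(1) c(1)])
    fix x :: "complex ^ 'v" assume x: "x \<in> polydisc t"
    have "g j x = ps_eval (b j) x" for j
      by (rule R(3)) (use polydisc_mono[OF x] t(2) r(2)[of j] in auto)
    then show "ps_eval a (\<chi> j. g j x) = ps_eval c x"
      using c(2) x by simp
  qed
qed

section \<open>The expansion of the tangency condition\<close>

lemma has_sum_sum:
  fixes f :: "'i \<Rightarrow> 'x \<Rightarrow> complex"
  assumes "finite I" "\<And>i. i \<in> I \<Longrightarrow> (f i has_sum S i) A"
  shows "((\<lambda>x. \<Sum>i\<in>I. f i x) has_sum (\<Sum>i\<in>I. S i)) A"
  using assms by (induction I rule: finite_induct) (auto intro: has_sum_add)

text \<open>
  The series \<open>-2 w\<^sub>j + \<Xi>\<^sub>j(\<zeta>, z, w)\<close> in all variables at once, with \<open>(\<zeta>, z)\<close> as first and \<open>w\<close> as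
  second group.
\<close>

definition defining_series :: "('k::finite \<Rightarrow> nat ^ 'n::finite \<Rightarrow> nat ^ 'n \<Rightarrow> 'k series) \<Rightarrow> 'k \<Rightarrow> (('n + 'n) + 'k) series" where
  "defining_series X j = sjoin (\<lambda>k. X j (vfst k) (vsnd k))"

text \<open>
  The derivative along the vector field of \<open>w'\<^sub>j - w\<^sub>j - X\<^sub>j(\<zeta>, z, w)\<close>, where \<open>\<zeta>\<close> and \<open>w'\<close> stand for the
  conjugates of \<open>z\<close> and \<open>w\<close>, restricted to the points with \<open>w' = w + X(\<zeta>, z, w)\<close>. The terms are arranged as in the
  determining equations, so that \<open>- W\<^sub>j\<close> appears as \<open>W\<^sub>j - 2 W\<^sub>j\<close>.
\<close>

definition tangency :: "('k::finite \<Rightarrow> nat ^ 'n::finite \<Rightarrow> nat ^ 'n \<Rightarrow> 'k series) \<Rightarrow>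
    ('n \<Rightarrow> nat ^ 'n \<Rightarrow> 'k series) \<Rightarrow> ('k \<Rightarrow> nat ^ 'n \<Rightarrow> 'k series) \<Rightarrow>
    'k \<Rightarrow> complex ^ (('n + 'n) + 'k) \<Rightarrow> complex" where
  "tangency X Z W j x =
    (let \<zeta> = vfst (vfst x); z = vsnd (vfst x); w = vsnd x;
         w' = w + (\<chi> l. ps_eval (defining_series X l) x);
         D = (\<lambda>v. ps_eval (ps_deriv (axis v 1) (defining_series X j)) x) in
      ps_eval (ps_bar (sjoin (W j))) (vjoin \<zeta> w')
      - (\<Sum>i\<in>UNIV. ps_eval (ps_bar (sjoin (Z i))) (vjoin \<zeta> w') * D (Inl (Inl i)))
      + ps_eval (sjoin (W j)) (vjoin z w)
      - (\<Sum>i\<in>UNIV. ps_eval (sjoin (Z i)) (vjoin z w) * D (Inl (Inr i)))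
      - 2 * ps_eval (sjoin (W j)) (vjoin z w)
      - (\<Sum>l\<in>UNIV. ps_eval (sjoin (W l)) (vjoin z w) * D (Inr l)))"

text \<open>
  The determining equation written with Cauchy products: apart from the Taylor expansions, each of its
  sums over decompositions is the coefficient of a product of two series in \<open>(\<zeta>, z)\<close>. In the second sum the series over \<open>\<gamma>\<close> has to be
  taken out of a finite sum, which requires its summability.
\<close>

lemma det_rhs_cauchy:
  fixes X :: "'k::finite \<Rightarrow> nat ^ 'n::finite \<Rightarrow> nat ^ 'n \<Rightarrow> 'k series"
    and w :: "complex ^ 'k" and j :: 'k
  defines "Xw \<equiv> \<lambda>w j k. ps_eval (X j (vfst k) (vsnd k)) w"
  defines "e \<equiv> \<lambda>c w \<gamma> k. \<Sum>(\<alpha>', \<alpha>'') | \<alpha>' + \<alpha>'' = vfst k.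
             1 / mfact \<gamma> * series_power (Xw w) \<gamma> (vjoin \<alpha>'' (vsnd k)) * ps_eval (ps_deriv \<gamma> (c \<alpha>')) w"
  defines "D \<equiv> \<lambda>v k. ps_eval (\<lambda>\<delta>. of_nat (k $ v + 1) * X j (vfst (k + axis v 1)) (vsnd (k + axis v 1)) \<delta>) w"
  assumes sm: "\<And>i k. (\<lambda>\<gamma>. e (\<lambda>\<alpha>. ps_bar (Z i \<alpha>)) w \<gamma> k) summable_on UNIV"
  shows "det_rhs X Z W j (vfst k) (vsnd k) w =
     (\<Sum>\<^sub>\<infinity>\<gamma>. e (\<lambda>\<alpha>. ps_bar (W j \<alpha>)) w \<gamma> k)
     - (\<Sum>i\<in>UNIV. cauchy (\<lambda>k. \<Sum>\<^sub>\<infinity>\<gamma>. e (\<lambda>\<alpha>. ps_bar (Z i \<alpha>)) w \<gamma> k)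
          (D (Inl i)) k)
     + in_second (\<lambda>\<beta>. ps_eval (W j \<beta>) w) k
     - (\<Sum>i\<in>UNIV. cauchy (in_second (\<lambda>\<beta>. ps_eval (Z i \<beta>) w))
          (D (Inr i)) k)
     - 2 * in_second (\<lambda>\<beta>. ps_eval (W j \<beta>) w) k
     - (\<Sum>l\<in>UNIV. cauchy (in_second (\<lambda>\<beta>. ps_eval (W l \<beta>) w))
          (\<lambda>k. ps_eval (ps_deriv (axis l 1) (X j (vfst k) (vsnd k))) w) k)"
proof -
  have cA: "calA (\<lambda>j \<alpha> \<beta>. ps_eval (X j \<alpha> \<beta>) w) \<alpha> \<beta> \<gamma> = series_power (Xw w) \<gamma> (vjoin \<alpha> \<beta>)" for \<alpha> \<beta> \<gamma>
    unfolding calA_eq_series_power Xw_def ..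
  have T2: "cauchy (\<lambda>k. \<Sum>\<^sub>\<infinity>\<gamma>. e (\<lambda>\<alpha>. ps_bar (Z i \<alpha>)) w \<gamma> k)
          (D (Inl i)) k
     = (\<Sum>\<^sub>\<infinity>\<gamma>.
          \<Sum>(\<alpha>', \<alpha>'', \<alpha>''') | \<alpha>' + \<alpha>'' + \<alpha>''' = vfst k. \<Sum>(\<beta>', \<beta>'') | \<beta>' + \<beta>'' = vsnd k.
            1 / mfact \<gamma> * series_power (Xw w) \<gamma> (vjoin \<alpha>'' \<beta>')
              * (of_nat (\<alpha>''' $ i + 1) * ps_eval (X j (\<alpha>''' + axis i 1) \<beta>'') w)
              * ps_eval (ps_deriv \<gamma> (ps_bar (Z i \<alpha>'))) w)" for i
  proof -
    let ?D = "\<lambda>q :: nat ^ ('n + 'n). of_nat (vfst q $ i + 1) * ps_eval (X j (vfst q + axis i 1) (vsnd q)) w"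
    let ?e = "e (\<lambda>\<alpha>. ps_bar (Z i \<alpha>)) w"
    let ?t = "\<lambda>\<gamma> \<alpha>' \<alpha>'' \<beta>'. 1 / mfact \<gamma> * series_power (Xw w) \<gamma> (vjoin \<alpha>'' \<beta>') * ps_eval (ps_deriv \<gamma> (ps_bar (Z i \<alpha>'))) w"
    have "cauchy (\<lambda>k. \<Sum>\<^sub>\<infinity>\<gamma>. ?e \<gamma> k)
          (D (Inl i)) k
      = (\<Sum>p | fst p + snd p = k. (\<Sum>\<^sub>\<infinity>\<gamma>. ?e \<gamma> (fst p)) * ?D (snd p))"
      by (simp add: cauchy_def D_def ps_eval_cmult vfst_vsnd_nth case_prod_unfold)
    also have "\<dots> = (\<Sum>\<^sub>\<infinity>\<gamma>. \<Sum>p | fst p + snd p = k. ?e \<gamma> (fst p) * ?D (snd p))"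
      by (rule infsumI[symmetric], rule has_sum_sum)
         (use finite_add_decomps[of k] sm in \<open>auto simp: case_prod_unfold intro!: has_sum_cmult_left has_sum_infsum\<close>)
    also have "\<dots> = (\<Sum>\<^sub>\<infinity>\<gamma>.
          \<Sum>(\<alpha>', \<alpha>'', \<alpha>''') | \<alpha>' + \<alpha>'' + \<alpha>''' = vfst k. \<Sum>(\<beta>', \<beta>'') | \<beta>' + \<beta>'' = vsnd k.
            ?t \<gamma> \<alpha>' \<alpha>'' \<beta>' * ?D (vjoin \<alpha>''' \<beta>''))"
    proof (rule infsum_cong)
      fix \<gamma> :: "nat ^ 'k"
      have f1: "finite {p. fst p + snd p = k}"
        using finite_add_decomps[of k] by (simp add: case_prod_unfold)
      have f2: "finite {q. fst q + snd q = vfst p}" for p :: "nat ^ ('n + 'n)"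
        using finite_add_decomps[of "vfst p"] by (simp add: case_prod_unfold)
      have f4: "finite {q. fst q + snd q = vsnd k}"
        using finite_add_decomps[of "vsnd k"] by (simp add: case_prod_unfold)
      have f3: "finite {(\<alpha>', \<alpha>'', \<alpha>'''). \<alpha>' + \<alpha>'' + \<alpha>''' = vfst k}"
      proof (rule finite_subset)
        show "{(\<alpha>', \<alpha>'', \<alpha>'''). \<alpha>' + \<alpha>'' + \<alpha>''' = vfst k} \<subseteq>
          {\<alpha>. mdeg \<alpha> \<le> mdeg (vfst k)} \<times> {\<alpha>. mdeg \<alpha> \<le> mdeg (vfst k)} \<times> {\<alpha>. mdeg \<alpha> \<le> mdeg (vfst k)}"
        proof safe
          fix a b c :: "nat ^ 'n" assume "a + b + c = vfst k"
          then have "mdeg (vfst k) = mdeg a + mdeg b + mdeg c" by (metis mdeg_add)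
          then show "mdeg a \<le> mdeg (vfst k)" "mdeg b \<le> mdeg (vfst k)" "mdeg c \<le> mdeg (vfst k)" by auto
        qed
      qed (intro finite_cartesian_product finite_mdeg_le)
      have "(\<Sum>p | fst p + snd p = k. ?e \<gamma> (fst p) * ?D (snd p))
        = (\<Sum>p | fst p + snd p = k. \<Sum>q | fst q + snd q = vfst (fst p).
              ?t \<gamma> (fst q) (snd q) (vsnd (fst p)) * ?D (snd p))"
        by (simp add: e_def sum_distrib_right case_prod_unfold)
      also have "\<dots> = (\<Sum>(p, q)\<in>(SIGMA p:{p. fst p + snd p = k}. {q. fst q + snd q = vfst (fst p)}).
              ?t \<gamma> (fst q) (snd q) (vsnd (fst p)) * ?D (snd p))"
        using f1 f2 by (subst sum.Sigma) auto
      \<comment> \<open>\<open>k = p + q\<close> together with a decomposition of the first half of \<open>p\<close> amounts to a triple for the first half of \<open>k\<close> and a pair for the second\<close>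
      also have "\<dots> = (\<Sum>((\<alpha>', \<alpha>'', \<alpha>'''), (\<beta>', \<beta>''))\<in>{(\<alpha>', \<alpha>'', \<alpha>'''). \<alpha>' + \<alpha>'' + \<alpha>''' = vfst k} \<times> {q. fst q + snd q = vsnd k}.
            ?t \<gamma> \<alpha>' \<alpha>'' \<beta>' * ?D (vjoin \<alpha>''' \<beta>''))"
      proof (rule sum.reindex_bij_witness[where
            i = "\<lambda>((\<alpha>', \<alpha>'', \<alpha>'''), (\<beta>', \<beta>'')). ((vjoin (\<alpha>' + \<alpha>'') \<beta>', vjoin \<alpha>''' \<beta>''), (\<alpha>', \<alpha>''))" and
            j = "\<lambda>(p, q). ((fst q, snd q, vfst (snd p)), (vsnd (fst p), vsnd (snd p)))"])
      qed (auto simp: vjoin_add simp flip: vfst_add vsnd_add)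
      also have "\<dots> = (\<Sum>(\<alpha>', \<alpha>'', \<alpha>''') | \<alpha>' + \<alpha>'' + \<alpha>''' = vfst k. \<Sum>(\<beta>', \<beta>'') | \<beta>' + \<beta>'' = vsnd k.
            ?t \<gamma> \<alpha>' \<alpha>'' \<beta>' * ?D (vjoin \<alpha>''' \<beta>''))"
        using f3 f4 by (subst sum.cartesian_product[symmetric]) (simp add: case_prod_unfold)
      finally show "(\<Sum>p | fst p + snd p = k. ?e \<gamma> (fst p) * ?D (snd p)) = \<dots>" .
    qed
    finally show ?thesis
      by (simp add: mult_ac)
  qed
  show ?thesis
    unfolding det_rhs_def Let_def cA T2 cauchy_in_second
    by (simp add: e_def D_def in_second_def ps_eval_cmult vfst_vsnd_nth)
qed

text \<open>
  The factors of the Cauchy products in \<open>det_rhs_cauchy\<close> are evaluated one by one. A single radius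
  \<open>r\<close> serves all \<open>w\<close> because evaluation at \<open>w\<close> does not increase the weighted norm of the series
  that is substituted (\<open>partial_eval\<close>).
\<close>

lemma det_rhs_expansion:
  fixes X :: "'k::finite \<Rightarrow> nat ^ 'n::finite \<Rightarrow> nat ^ 'n \<Rightarrow> 'k series"
  assumes R: "R > 0" and X: "\<And>j. abs_conv R (defining_series X j)" "\<And>j. defining_series X j 0 = 0"
    and Z: "\<And>i. abs_conv R (sjoin (Z i))" and W: "\<And>l. abs_conv R (sjoin (W l))"
  obtains r where "r > 0"
    "\<And>w j. w \<in> polydisc r \<Longrightarrow> abs_conv r (\<lambda>k. det_rhs X Z W j (vfst k) (vsnd k) w)"
    "\<And>w j y. w \<in> polydisc r \<Longrightarrow> y \<in> polydisc r \<Longrightarrow>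
       ps_eval (\<lambda>k. det_rhs X Z W j (vfst k) (vsnd k) w) y = tangency X Z W j (vjoin y w)"
proof -
  \<comment> \<open>one half of \<open>R\<close> for the base point \<open>w\<close>, the other for the increment in Taylor's formula\<close>
  define h where "h = R / 2"
  have h: "h > 0" "h + h = R" using R by (auto simp: h_def)
  obtain r where r: "0 < r" "r \<le> h" "\<And>j. wnorm r (defining_series X j) \<le> h"
  proof -
    obtain t where t: "0 < t" "t \<le> R" "\<And>j t'. 0 < t' \<Longrightarrow> t' \<le> t \<Longrightarrow> wnorm t' (defining_series X j) \<le> h"
      using wnorm_small_family[of R "defining_series X" h, OF X(1) R X(2) h(1)] by blast
    show ?thesis by (rule that[of "min t h"]) (use t h in auto)
  qed
  have rR: "r \<le> R" using r h by simp
  have Xr: "abs_conv r (defining_series X j)" for j using abs_conv_mono[OF X(1) _ rR] r by simp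
  have Zr: "abs_conv r (sjoin (Z j))" for j using abs_conv_mono[OF Z(1) _ rR] r by simp
  have Wr: "abs_conv r (sjoin (W j))" for j using abs_conv_mono[OF W(1) _ rR] r by simp
  have Dr: "abs_conv r (ps_deriv \<gamma> (defining_series X j))" for \<gamma> j
  proof -
    have "abs_conv h (ps_deriv \<gamma> (defining_series X j))"
      by (rule abs_conv_ps_deriv[OF _ less_imp_le[OF h(1)] h(1) zero_in_polydisc])
         (use X h in auto)
    then show ?thesis by (rule abs_conv_mono) (use r in auto)
  qed
  have main: "abs_conv r (\<lambda>k. det_rhs X Z W j (vfst k) (vsnd k) w) \<and>
     (\<forall>y\<in>polydisc r. ps_eval (\<lambda>k. det_rhs X Z W j (vfst k) (vsnd k) w) y = tangency X Z W j (vjoin y w))"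
    if w: "w \<in> polydisc r" for w j
  proof -
    have wh: "w \<in> polydisc h" by (rule polydisc_mono[OF w r(2)])
    define b where "b = (\<lambda>j k. ps_eval (X j (vfst k) (vsnd k)) w)"
    define e where "e = (\<lambda>c \<gamma> k. \<Sum>(\<alpha>', \<alpha>'') | \<alpha>' + \<alpha>'' = vfst k.
             1 / mfact \<gamma> * series_power b \<gamma> (vjoin \<alpha>'' (vsnd k)) * ps_eval (ps_deriv \<gamma> (c \<alpha>')) w)"
    have b: "abs_conv r (b j)" "wnorm r (b j) \<le> h"
      "\<And>y. y \<in> polydisc r \<Longrightarrow> ps_eval (b j) y = ps_eval (defining_series X j) (vjoin y w)" for j
      using partial_eval[OF Xr[of j, unfolded defining_series_def] r(1) w] r(3)[of j]
      unfolding b_def defining_series_def by auto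
    have E: "\<And>k. (\<lambda>\<gamma>. e c \<gamma> k) summable_on UNIV" "abs_conv r (\<lambda>k. \<Sum>\<^sub>\<infinity>\<gamma>. e c \<gamma> k)"
      "\<And>y. y \<in> polydisc r \<Longrightarrow> ps_eval (\<lambda>k. \<Sum>\<^sub>\<infinity>\<gamma>. e c \<gamma> k) y =
         ps_eval (sjoin c) (vjoin (vfst y) (w + (\<chi> j. ps_eval (defining_series X j) (vjoin y w))))"
      if "abs_conv R (sjoin c)" for c
    proof -
      have cR: "abs_conv (h + h) (sjoin c)" using that h(2) by simp
      note T = taylor_subst[OF cR less_imp_le[OF h(1)] h(1) wh b(1) r(1,2) b(2)]
      show "(\<lambda>\<gamma>. e c \<gamma> k) summable_on UNIV" for k
        unfolding e_def by (rule T(1))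
      show "abs_conv r (\<lambda>k. \<Sum>\<^sub>\<infinity>\<gamma>. e c \<gamma> k)"
        unfolding e_def by (rule T(2))
      show "ps_eval (\<lambda>k. \<Sum>\<^sub>\<infinity>\<gamma>. e c \<gamma> k) y =
         ps_eval (sjoin c) (vjoin (vfst y) (w + (\<chi> j. ps_eval (defining_series X j) (vjoin y w))))" if y: "y \<in> polydisc r" for y
        unfolding b(3)[OF y, symmetric] e_def by (rule T(3)[OF y])
    qed
    have Wb: "abs_conv R (sjoin (\<lambda>\<alpha>. ps_bar (W j \<alpha>)))" and Zb: "abs_conv R (sjoin (\<lambda>\<alpha>. ps_bar (Z i \<alpha>)))" for j i
      unfolding ps_bar_sjoin[symmetric] abs_conv_bar by (rule W, rule Z)
    let ?D1 = "\<lambda>v k. ps_eval (\<lambda>\<delta>. of_nat (k $ v + 1) * X j (vfst (k + axis v 1)) (vsnd (k + axis v 1)) \<delta>) w"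
    let ?D2 = "\<lambda>l k. ps_eval (ps_deriv (axis l 1) (X j (vfst k) (vsnd k))) w"
    have D1: "abs_conv r (?D1 v)"
      "\<And>y. y \<in> polydisc r \<Longrightarrow> ps_eval (?D1 v) y = ps_eval (ps_deriv (axis (Inl v) 1) (defining_series X j)) (vjoin y w)" for v
      using partial_eval[OF Dr[of "axis (Inl v) 1" j, unfolded defining_series_def ps_deriv_Inl] r(1) w]
      unfolding defining_series_def ps_deriv_Inl by auto
    have D2: "abs_conv r (?D2 l)"
      "\<And>y. y \<in> polydisc r \<Longrightarrow> ps_eval (?D2 l) y = ps_eval (ps_deriv (axis (Inr l) 1) (defining_series X j)) (vjoin y w)" for l
      using partial_eval[OF Dr[of "axis (Inr l) 1" j, unfolded defining_series_def ps_deriv_Inr] r(1) w]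
      unfolding defining_series_def ps_deriv_Inr by auto
    have S: "abs_conv r (in_second (\<lambda>\<beta>. ps_eval (c \<beta>) w) :: ('n + 'n) series)"
      "\<And>y :: complex ^ ('n + 'n). y \<in> polydisc r \<Longrightarrow>
         ps_eval (in_second (\<lambda>\<beta>. ps_eval (c \<beta>) w)) y = ps_eval (sjoin c) (vjoin (vsnd y) w)"
      if "abs_conv r (sjoin c)" for c :: "nat ^ 'n \<Rightarrow> 'k series"
    proof -
      note P = partial_eval[OF that r(1) w]
      show "abs_conv r (in_second (\<lambda>\<beta>. ps_eval (c \<beta>) w) :: ('n + 'n) series)"
        by (rule abs_conv_in_second[OF P(1) r(1)])
      fix y :: "complex ^ ('n + 'n)" assume y: "y \<in> polydisc r"
      have "vsnd y \<in> polydisc r" using y by (metis vjoin_collapse vjoin_in_polydisc)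
      then show "ps_eval (in_second (\<lambda>\<beta>. ps_eval (c \<beta>) w)) y = ps_eval (sjoin c) (vjoin (vsnd y) w)"
        using ps_eval_in_second[OF P(1) r(1) y] P(3) by simp
    qed
    let ?E = "\<lambda>c k. \<Sum>\<^sub>\<infinity>\<gamma>. e (\<lambda>\<alpha>. ps_bar (c \<alpha>)) \<gamma> k"
    let ?s = "\<lambda>c. in_second (\<lambda>\<beta>. ps_eval (c \<beta>) w) :: ('n + 'n) series"
    have eq: "(\<lambda>k. det_rhs X Z W j (vfst k) (vsnd k) w) = (\<lambda>k.
       ?E (W j) k
     - (\<Sum>i\<in>UNIV. cauchy (?E (Z i)) (?D1 (Inl i)) k)
     + ?s (W j) k
     - (\<Sum>i\<in>UNIV. cauchy (?s (Z i)) (?D1 (Inr i)) k)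
     - 2 * ?s (W j) k
     - (\<Sum>l\<in>UNIV. cauchy (?s (W l)) (?D2 l) k))"
      (is "_ = ?rhs")
      by (rule ext, unfold e_def b_def, rule det_rhs_cauchy)
         (use E(1)[OF Zb] in \<open>simp add: e_def b_def\<close>)
    note r0 = less_imp_le[OF r(1)]
    have ac: "abs_conv r (?E (W j))"
      "abs_conv r (\<lambda>k. \<Sum>i\<in>UNIV. cauchy (?E (Z i)) (?D1 (Inl i)) k)"
      "abs_conv r (?s (W j))"
      "abs_conv r (\<lambda>k. \<Sum>i\<in>UNIV. cauchy (?s (Z i)) (?D1 (Inr i)) k)"
      "abs_conv r (\<lambda>k. 2 * (?s (W j)) k)"
      "abs_conv r (\<lambda>k. \<Sum>l\<in>UNIV. cauchy (?s (W l)) (?D2 l) k)"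
      by (intro abs_conv_sum abs_conv_cauchy abs_conv_cmult r0 r(1)
          E(2)[OF Wb] E(2)[OF Zb] S(1)[OF Wr] S(1)[OF Zr] D1(1) D2(1))+
    have sums: "ps_eval (\<lambda>k. \<Sum>i\<in>UNIV. cauchy (a i) (d i) k) y = (\<Sum>i\<in>UNIV. ps_eval (a i) y * ps_eval (d i) y)"
      if "\<And>i. abs_conv r (a i)" "\<And>i. abs_conv r (d i)" "y \<in> polydisc r"
      for a d :: "'i::finite \<Rightarrow> ('n + 'n) series" and y
      using ps_eval_sum[of UNIV r "\<lambda>i. cauchy (a i) (d i)" y, OF abs_conv_cauchy[OF that(1,2) r(1)] r0 that(3)]
        ps_eval_cauchy[OF that(1,2) r(1) that(3)] by simp
    show ?thesis
    proof (intro conjI ballI)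
      show "abs_conv r (\<lambda>k. det_rhs X Z W j (vfst k) (vsnd k) w)"
        unfolding eq by (intro abs_conv_add abs_conv_diff ac r0)
      fix y :: "complex ^ ('n + 'n)" assume y: "y \<in> polydisc r"
      have "ps_eval ?rhs y =
        ps_eval (?E (W j)) y
        - ps_eval (\<lambda>k. \<Sum>i\<in>UNIV. cauchy (?E (Z i)) (?D1 (Inl i)) k) y
        + ps_eval (?s (W j)) y
        - ps_eval (\<lambda>k. \<Sum>i\<in>UNIV. cauchy (?s (Z i)) (?D1 (Inr i)) k) y
        - ps_eval (\<lambda>k. 2 * ?s (W j) k) y
        - ps_eval (\<lambda>k. \<Sum>l\<in>UNIV. cauchy (?s (W l)) (?D2 l) k) y"
        by (simp only: ps_eval_add[of r] ps_eval_diff[of r] abs_conv_add abs_conv_diff ac y r0)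
      also have "\<dots> = tangency X Z W j (vjoin y w)"
        unfolding sums[OF E(2)[OF Zb] D1(1) y] sums[OF S(1)[OF Zr] D1(1) y] sums[OF S(1)[OF Wr] D2(1) y]
          E(3)[OF Wb y] E(3)[OF Zb y] S(2)[OF Wr y] S(2)[OF Zr y] D1(2)[OF y] D2(2)[OF y] ps_eval_cmult[where c = 2]
        unfolding tangency_def Let_def ps_bar_sjoin vfst_vjoin vsnd_vjoin by (rule refl)
      finally show "ps_eval (\<lambda>k. det_rhs X Z W j (vfst k) (vsnd k) w) y = tangency X Z W j (vjoin y w)"
        unfolding eq .
    qed
  qed
  show ?thesis
    by (rule that[OF r(1)]) (use main in blast)+
qed

lemma analytic0_tangency:
  fixes X :: "'k::finite \<Rightarrow> nat ^ 'n::finite \<Rightarrow> nat ^ 'n \<Rightarrow> 'k series"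
  assumes R: "R > 0" and X: "\<And>j. abs_conv R (defining_series X j)" "\<And>j. defining_series X j 0 = 0"
    and Z: "\<And>i. abs_conv R (sjoin (Z i))" and W: "\<And>l. abs_conv R (sjoin (W l))"
  shows "analytic0 (tangency X Z W j)"
proof -
  have sub1: "analytic0 (\<lambda>x :: complex ^ (('n + 'n) + 'k). ps_eval (sjoin c) (vjoin (vsnd (vfst x)) (vsnd x)))"
    if "abs_conv R (sjoin c)" for c :: "nat ^ 'n \<Rightarrow> 'k series"
  proof -
    have "analytic0 (\<lambda>x :: complex ^ (('n + 'n) + 'k). ps_eval (sjoin c)
        (\<chi> i. (case i of Inl a \<Rightarrow> \<lambda>x. x $ Inl (Inr a) | Inr b \<Rightarrow> \<lambda>x. x $ Inr b) x))"
      by (rule analytic0_compose[OF that R]) (auto split: sum.splits intro: analytic0_coord)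
    moreover have "(\<chi> i. (case i of Inl a \<Rightarrow> \<lambda>x. x $ Inl (Inr a) | Inr b \<Rightarrow> \<lambda>x. x $ Inr b) x) =
        vjoin (vsnd (vfst x)) (vsnd x)" for x :: "complex ^ (('n + 'n) + 'k)"
      by (simp add: vec_sum_eq_iff vfst_vsnd_nth)
    ultimately show ?thesis by simp
  qed
  have sub2: "analytic0 (\<lambda>x :: complex ^ (('n + 'n) + 'k). ps_eval a (vjoin (vfst (vfst x)) (vsnd x + (\<chi> l. ps_eval (defining_series X l) x))))"
    if "abs_conv R a" for a :: "('n + 'k) series"
  proof -
    have "analytic0 (\<lambda>x :: complex ^ (('n + 'n) + 'k). ps_eval a
        (\<chi> i. (case i of Inl a \<Rightarrow> \<lambda>x. x $ Inl (Inl a) | Inr b \<Rightarrow> \<lambda>x. x $ Inr b + ps_eval (defining_series X b) x) x))"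
      by (rule analytic0_compose[OF that R])
         (auto simp: X split: sum.splits intro!: analytic0_coord analytic0_add analytic0_ps[OF X(1) R])
    moreover have "(\<chi> i. (case i of Inl a \<Rightarrow> \<lambda>x. x $ Inl (Inl a) | Inr b \<Rightarrow> \<lambda>x. x $ Inr b + ps_eval (defining_series X b) x) x) =
        vjoin (vfst (vfst x)) (vsnd x + (\<chi> l. ps_eval (defining_series X l) x))" for x :: "complex ^ (('n + 'n) + 'k)"
      by (simp add: vec_sum_eq_iff vfst_vsnd_nth)
    ultimately show ?thesis by simp
  qed
  have D: "analytic0 (ps_eval (ps_deriv \<gamma> (defining_series X j)))" for \<gamma>
  proof (rule analytic0_ps)
    show "abs_conv (R / 2) (ps_deriv \<gamma> (defining_series X j))"
      by (rule abs_conv_ps_deriv[of _ "R / 2" _ 0]) (use X R in auto)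
  qed (use R in simp)
  show ?thesis
    unfolding tangency_def Let_def
    by (intro analytic0_diff analytic0_add analytic0_sum analytic0_mult analytic0_const sub1 sub2 D)
       (simp_all add: Z W)
qed

text \<open>
  The joint expansion in \<open>(\<zeta>, z, w)\<close> shows that the coefficient of \<open>\<zeta>\<^sup>\<alpha> z\<^sup>\<beta>\<close> is a power series in
  \<open>w\<close> on a polydisc independent of \<open>\<alpha>\<close> and \<open>\<beta>\<close>. If it vanishes near \<open>0\<close>, on a neighbourhood
  that may shrink with \<open>\<alpha>\<close> and \<open>\<beta>\<close>, then its coefficients vanish, and hence it vanishes on the whole
  polydisc.
\<close>

lemma tangency_zero_iff_det:
  fixes X :: "'k::finite \<Rightarrow> nat ^ 'n::finite \<Rightarrow> nat ^ 'n \<Rightarrow> 'k series"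
  assumes R: "R > 0" and X: "\<And>j. abs_conv R (defining_series X j)" "\<And>j. defining_series X j 0 = 0"
    and Z: "\<And>i. abs_conv R (sjoin (Z i))" and W: "\<And>l. abs_conv R (sjoin (W l))"
  shows "(\<forall>\<^sub>F x in nhds 0. tangency X Z W j x = 0) \<longleftrightarrow>
    (\<forall>\<alpha> \<beta>. \<forall>\<^sub>F w in nhds 0. det_rhs X Z W j \<alpha> \<beta> w = 0)"
proof -
  obtain r1 where r1: "r1 > 0"
    "\<And>w j. w \<in> polydisc r1 \<Longrightarrow> abs_conv r1 (\<lambda>k. det_rhs X Z W j (vfst k) (vsnd k) w)"
    "\<And>w j y. w \<in> polydisc r1 \<Longrightarrow> y \<in> polydisc r1 \<Longrightarrow>
       ps_eval (\<lambda>k. det_rhs X Z W j (vfst k) (vsnd k) w) y = tangency X Z W j (vjoin y w)"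
    by (rule det_rhs_expansion[of R X Z W, OF assms]) (rule that; assumption)
  obtain r2 f where r2: "r2 > 0" and f: "abs_conv r2 f"
    "\<And>x. x \<in> polydisc r2 \<Longrightarrow> tangency X Z W j x = ps_eval f x"
    using analytic0_tangency[of R X Z W j, OF assms] unfolding analytic0_def by blast
  define r where "r = min r1 r2"
  have r: "r > 0" "r \<le> r1" "r \<le> r2" using r1 r2 by (auto simp: r_def)
  have fr: "abs_conv r f" by (rule abs_conv_mono[OF f(1)]) (use r in auto)
  define fc where "fc = (\<lambda>k \<delta>. f (vjoin k \<delta>))"
  have fc: "f = sjoin fc" by (simp add: fc_def sjoin_def fun_eq_iff)
  have det: "det_rhs X Z W j (vfst k) (vsnd k) w = ps_eval (fc k) w" if w: "w \<in> polydisc r" for k w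
  proof -
    have w1: "w \<in> polydisc r1" by (rule polydisc_mono[OF w r(2)])
    note P = partial_eval[OF fr[unfolded fc] r(1) w]
    have "(\<lambda>k. det_rhs X Z W j (vfst k) (vsnd k) w) = (\<lambda>k. ps_eval (fc k) w)"
    proof (rule ps_unique[OF _ P(1) r(1)])
      show "abs_conv r (\<lambda>k. det_rhs X Z W j (vfst k) (vsnd k) w)"
        by (rule abs_conv_mono[OF r1(2)[OF w1]]) (use r in auto)
      fix y :: "complex ^ ('n + 'n)" assume y: "y \<in> polydisc r"
      have "vjoin y w \<in> polydisc r2"
        using polydisc_mono[OF y r(3)] polydisc_mono[OF w r(3)] by simp
      then show "ps_eval (\<lambda>k. det_rhs X Z W j (vfst k) (vsnd k) w) y = ps_eval (\<lambda>k. ps_eval (fc k) w) y"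
        using r1(3)[OF w1 polydisc_mono[OF y r(2)]] f(2) P(3)[OF y] by (simp add: fc)
    qed
    then show ?thesis by (rule fun_cong)
  qed
  have fcr: "abs_conv r (fc k)" for k
    by (rule partial_eval(4)[OF fr[unfolded fc] r(1) zero_in_polydisc]) (use r in simp)
  have ev: "\<forall>\<^sub>F w in nhds 0. (w :: complex ^ 'k) \<in> polydisc r" by (rule eventually_polydisc[OF r(1)])
  have evx: "\<forall>\<^sub>F x in nhds 0. (x :: complex ^ (('n + 'n) + 'k)) \<in> polydisc r2" by (rule eventually_polydisc[OF r2])
  show ?thesis
  proof
    assume "\<forall>\<^sub>F x in nhds 0. tangency X Z W j x = 0"
    then have "\<forall>\<^sub>F x in nhds 0. ps_eval f x = 0"
      using evx by eventually_elim (simp add: f(2))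
    then have "f = (\<lambda>_. 0)" by (rule ps_eq_zero[OF fr r(1)])
    then have fc0: "fc k = (\<lambda>_. 0)" for k by (simp add: fc_def)
    show "\<forall>\<alpha> \<beta>. \<forall>\<^sub>F w in nhds 0. det_rhs X Z W j \<alpha> \<beta> w = 0"
    proof (intro allI)
      fix \<alpha> \<beta>
      show "\<forall>\<^sub>F w in nhds 0. det_rhs X Z W j \<alpha> \<beta> w = 0"
        using ev by eventually_elim (use det[of _ "vjoin \<alpha> \<beta>"] fc0 in simp)
    qed
  next
    assume D: "\<forall>\<alpha> \<beta>. \<forall>\<^sub>F w in nhds 0. det_rhs X Z W j \<alpha> \<beta> w = 0"
    have "fc k = (\<lambda>_. 0)" for k
    proof (rule ps_eq_zero[OF fcr r(1)])
      have "\<forall>\<^sub>F w in nhds 0. det_rhs X Z W j (vfst k) (vsnd k) w = 0" using D by blast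
      then show "\<forall>\<^sub>F w in nhds 0. ps_eval (fc k) w = 0"
        using ev by eventually_elim (simp add: det)
    qed
    then have "f = (\<lambda>_. 0)" by (simp add: fc sjoin_def)
    then show "\<forall>\<^sub>F x in nhds 0. tangency X Z W j x = 0"
      using evx by (auto simp: f(2) elim: eventually_mono)
  qed
qed

section \<open>Tangent spaces of real analytic submanifolds\<close>

text \<open>
  Convergence at a point with all coordinates equal to \<open>s\<close> dominates the terms of degree at
  least two for all smaller increments, so the power series is affine up to a quadratic error.
\<close>

lemma real_analytic_at_differentiable:
  fixes f :: "'a::euclidean_space \<Rightarrow> 'b::euclidean_space"
  assumes "real_analytic_at f p"
  obtains D where "(f has_derivative D) (at p)"
proof -
  let ?S = "Basis \<rightarrow>\<^sub>E (UNIV :: nat set) :: ('a \<Rightarrow> nat) set"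
  let ?m = "\<lambda>h \<alpha>. \<Prod>b\<in>Basis. (h \<bullet> b) ^ \<alpha> b"
  let ?d = "\<lambda>\<alpha> :: 'a \<Rightarrow> nat. \<Sum>b\<in>Basis. \<alpha> b"
  obtain c r where r: "r > 0" and c: "\<And>h. norm h < r \<Longrightarrow> ((\<lambda>\<alpha>. ?m h \<alpha> *\<^sub>R c \<alpha>) has_sum f (p + h)) ?S"
    using assms unfolding real_analytic_at_def by blast
  \<comment> \<open>small enough for the point \<open>h0\<close> below, with all coordinates equal to \<open>s\<close>, to have norm less than \<open>r\<close>\<close>
  define s where "s = r / (2 * DIM('a))"
  have s: "s > 0" using r by (simp add: s_def)
  define h0 :: 'a where "h0 = (\<Sum>b\<in>Basis. s *\<^sub>R b)"
  have h0b: "h0 \<bullet> b = s" if "b \<in> Basis" for b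
    using that by (simp add: h0_def inner_sum_left inner_Basis if_distrib cong: if_cong)
  have "norm h0 \<le> (\<Sum>b\<in>(Basis :: 'a set). s)"
    unfolding h0_def by (rule sum_norm_le) (use s in simp)
  also have "\<dots> < r" using r by (simp add: s_def field_simps)
  finally have h0r: "norm h0 < r" .
  have sr: "s < r"
  proof -
    have "s = r / 2 / DIM('a)" by (simp add: s_def)
    also have "\<dots> \<le> r / 2" using r DIM_positive[where ?'a = 'a] by (simp add: divide_le_eq)
    also have "\<dots> < r" using r by simp
    finally show ?thesis .
  qed
  have m0: "?m h0 \<alpha> = s ^ ?d \<alpha>" for \<alpha> by (simp add: h0b power_sum)
  have summ: "(\<lambda>\<alpha>. s ^ ?d \<alpha> * norm (c \<alpha>)) summable_on ?S"
  proof (rule summable_on_comparison_test)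
    have "(\<lambda>\<alpha>. norm ((s ^ ?d \<alpha> *\<^sub>R c \<alpha>) \<bullet> b)) summable_on ?S" for b
    proof -
      have "(\<lambda>\<alpha>. (s ^ ?d \<alpha> *\<^sub>R c \<alpha>) \<bullet> b) summable_on ?S"
        using has_sum_imp_summable[OF has_sum_bounded_linear[OF bounded_linear_inner_left[of b] c[OF h0r]]]
        unfolding m0 by (simp add: o_def)
      then show ?thesis by (subst summable_on_iff_abs_summable_on_real[symmetric])
    qed
    then show "(\<lambda>\<alpha>. \<Sum>b\<in>Basis. norm ((s ^ ?d \<alpha> *\<^sub>R c \<alpha>) \<bullet> b)) summable_on ?S"
      by (induction rule: infinite_finite_induct[of _ "Basis :: 'b set"]) (auto intro: summable_on_add)
    fix \<alpha>
    have "s ^ ?d \<alpha> * norm (c \<alpha>) = norm (s ^ ?d \<alpha> *\<^sub>R c \<alpha>)" using s by simp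
    also have "\<dots> \<le> (\<Sum>b\<in>Basis. \<bar>(s ^ ?d \<alpha> *\<^sub>R c \<alpha>) \<bullet> b\<bar>)" by (rule norm_le_l1)
    finally show "s ^ ?d \<alpha> * norm (c \<alpha>) \<le> (\<Sum>b\<in>Basis. norm ((s ^ ?d \<alpha> *\<^sub>R c \<alpha>) \<bullet> b))" by simp
  qed (use s in auto)
  define C where "C = (\<Sum>\<^sub>\<infinity>\<alpha>\<in>?S. s ^ ?d \<alpha> * norm (c \<alpha>))"
  let ?Czero = "{\<alpha>\<in>?S. ?d \<alpha> = 0}" and ?Cone = "{\<alpha>\<in>?S. ?d \<alpha> = 1}" and ?Ctwo = "{\<alpha>\<in>?S. ?d \<alpha> \<ge> 2}"
  define D where "D h = (\<Sum>\<alpha>\<in>?Cone. ?m h \<alpha> *\<^sub>R c \<alpha>)" for h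
  have fin: "finite {\<alpha>\<in>?S. ?d \<alpha> \<le> n}" for n
  proof (rule finite_subset)
    show "{\<alpha>\<in>?S. ?d \<alpha> \<le> n} \<subseteq> Basis \<rightarrow>\<^sub>E {..n}"
    proof
      fix \<alpha> assume a: "\<alpha> \<in> {\<alpha>\<in>?S. ?d \<alpha> \<le> n}"
      have "\<alpha> b \<le> n" if "b \<in> Basis" for b
        using a member_le_sum[of b Basis \<alpha>] that by auto
      then show "\<alpha> \<in> Basis \<rightarrow>\<^sub>E {..n}" using a by (auto simp: PiE_def)
    qed
  qed (intro finite_PiE; simp)
  have fin0: "finite ?Czero"
    by (rule finite_subset[OF _ fin[of 0]]) auto
  have fin1: "finite ?Cone"
    by (rule finite_subset[OF _ fin[of 1]]) force
  have D: "bounded_linear D"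
  proof -
    have "bounded_linear (\<lambda>h. ?m h \<alpha> *\<^sub>R c \<alpha>)" if \<alpha>: "\<alpha> \<in> ?Cone" for \<alpha>
    proof -
      obtain b where b: "b \<in> Basis" "\<alpha> b = 1" "\<And>b'. b' \<in> Basis \<Longrightarrow> b' \<noteq> b \<Longrightarrow> \<alpha> b' = 0"
      proof -
        have "\<exists>a\<in>Basis. \<alpha> a = Suc 0 \<and> (\<forall>b\<in>Basis. a \<noteq> b \<longrightarrow> \<alpha> b = 0)"
          using \<alpha> sum_eq_Suc0_iff[of "Basis :: 'a set" \<alpha>] by simp
        then show ?thesis using that by force
      qed
      have "?m h \<alpha> = h \<bullet> b" for h
      proof -
        have "?m h \<alpha> = (h \<bullet> b) ^ \<alpha> b * (\<Prod>b'\<in>Basis - {b}. (h \<bullet> b') ^ \<alpha> b')"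
          by (rule prod.remove) (use b in auto)
        also have "(\<Prod>b'\<in>Basis - {b}. (h \<bullet> b') ^ \<alpha> b') = 1"
          by (rule prod.neutral) (use b in auto)
        finally show ?thesis using b by simp
      qed
      then show ?thesis
        by (simp add: bounded_linear_scaleR_const bounded_linear_inner_left)
    qed
    then show ?thesis
      unfolding D_def[abs_def] by (intro bounded_linear_sum)
  qed
  have split: "norm (f (p + h) - (\<Sum>\<alpha>\<in>?Czero. c \<alpha>) - D h) \<le> (norm h / s) ^ 2 * C" if h: "norm h < s" for h
  proof -
    let ?g = "\<lambda>\<alpha>. ?m h \<alpha> *\<^sub>R c \<alpha>"
    have hs: "(?g has_sum f (p + h)) ?S" using c[of h] h sr by simp
    have "((\<lambda>\<alpha>. ?g \<alpha>) has_sum (sum ?g (?Czero \<union> ?Cone))) (?Czero \<union> ?Cone)"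
      by (rule has_sum_finite) (use fin0 fin1 in simp)
    then have "(?g has_sum (f (p + h) - sum ?g (?Czero \<union> ?Cone))) (?S - (?Czero \<union> ?Cone))"
      by (rule has_sum_Diff[OF hs]) auto
    moreover have "?S - (?Czero \<union> ?Cone) = ?Ctwo" by (auto simp del: sum_eq_0_iff)
    moreover have "sum ?g (?Czero \<union> ?Cone) = sum ?g ?Czero + D h"
      unfolding D_def by (rule sum.union_disjoint[OF fin0 fin1]) auto
    moreover have "sum ?g ?Czero = (\<Sum>\<alpha>\<in>?Czero. c \<alpha>)"
      by (rule sum.cong) auto
    ultimately have h2: "(?g has_sum (f (p + h) - (\<Sum>\<alpha>\<in>?Czero. c \<alpha>) - D h)) ?Ctwo"
      by (simp add: algebra_simps)
    have "((\<lambda>\<alpha>. (norm h / s) ^ 2 * (s ^ ?d \<alpha> * norm (c \<alpha>))) has_sum (norm h / s) ^ 2 * C) ?S"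
      unfolding C_def by (intro has_sum_cmult_right has_sum_infsum summ)
    moreover have "((\<lambda>\<alpha>. (norm h / s) ^ 2 * (s ^ ?d \<alpha> * norm (c \<alpha>))) summable_on ?Ctwo)"
      by (intro summable_on_cmult_right summable_on_subset_banach[OF summ]) auto
    ultimately have le: "(\<Sum>\<^sub>\<infinity>\<alpha>\<in>?Ctwo. (norm h / s) ^ 2 * (s ^ ?d \<alpha> * norm (c \<alpha>))) \<le> (norm h / s) ^ 2 * C"
      and sm2: "((\<lambda>\<alpha>. (norm h / s) ^ 2 * (s ^ ?d \<alpha> * norm (c \<alpha>))) has_sum
         (\<Sum>\<^sub>\<infinity>\<alpha>\<in>?Ctwo. (norm h / s) ^ 2 * (s ^ ?d \<alpha> * norm (c \<alpha>)))) ?Ctwo"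
      using s by (auto intro!: has_sum_mono2[OF has_sum_infsum])
    have "norm (f (p + h) - (\<Sum>\<alpha>\<in>?Czero. c \<alpha>) - D h) \<le> (\<Sum>\<^sub>\<infinity>\<alpha>\<in>?Ctwo. (norm h / s) ^ 2 * (s ^ ?d \<alpha> * norm (c \<alpha>)))"
    proof (rule norm_infsum_le[OF h2 sm2])
      fix \<alpha> assume \<alpha>: "\<alpha> \<in> ?Ctwo"
      have "\<bar>?m h \<alpha>\<bar> \<le> (\<Prod>b\<in>Basis. norm h ^ \<alpha> b)"
        unfolding abs_prod by (rule prod_mono) (auto simp: power_abs intro!: power_mono Basis_le_norm)
      also have "\<dots> = norm h ^ ?d \<alpha>" by (simp add: power_sum)
      also have "\<dots> = (norm h / s) ^ ?d \<alpha> * s ^ ?d \<alpha>"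
        using s by (simp add: power_divide)
      also have "\<dots> \<le> (norm h / s) ^ 2 * s ^ ?d \<alpha>"
        using \<alpha> h s by (intro mult_right_mono power_decreasing) auto
      finally show "norm (?g \<alpha>) \<le> (norm h / s) ^ 2 * (s ^ ?d \<alpha> * norm (c \<alpha>))"
        by (simp add: mult.assoc[symmetric] mult_right_mono)
    qed
    also note le
    finally show ?thesis .
  qed
  have fp: "(\<Sum>\<alpha>\<in>?Czero. c \<alpha>) = f p"
    using split[of 0] s linear_0[OF bounded_linear.linear[OF D]] by simp
  have "(f has_derivative D) (at p)"
  proof (rule has_derivative_quadratic[OF D s])
    show "norm (f (p + h) - f p - D h) \<le> (C / s ^ 2) * norm h ^ 2" if "norm h < s" for h
      using split[OF that] unfolding fp by (simp add: power_divide mult_ac)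
  qed
  then show ?thesis by (rule that)
qed

text \<open>
  Lines in the model subspace \<open>L\<close> are mapped by the inverse chart to curves in \<open>M\<close>, and the
  differential of the inverse chart is injective by the chain rule.
\<close>

lemma tangent_space_contains_subspace:
  fixes M :: "'a::euclidean_space set"
  assumes "real_analytic_submanifold d M" "p \<in> M"
  obtains T where "subspace T" "dim T = d" "T \<subseteq> tangent_space M p"
proof -
  obtain U V \<Phi> \<Psi> and L :: "'a set" where U: "open U" "p \<in> U" "open V" "homeomorphism U V \<Phi> \<Psi>"
    and an: "\<And>x. x \<in> U \<Longrightarrow> real_analytic_at \<Phi> x" "\<And>y. y \<in> V \<Longrightarrow> real_analytic_at \<Psi> y"
    and L: "subspace L" "dim L = d" "\<Phi> ` (M \<inter> U) = L \<inter> V"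
    using assms unfolding real_analytic_submanifold_def by metis
  define y where "y = \<Phi> p"
  have hom: "\<And>x. x \<in> U \<Longrightarrow> \<Psi> (\<Phi> x) = x" "\<And>y. y \<in> V \<Longrightarrow> \<Phi> (\<Psi> y) = y"
    using U(4) by (auto simp: homeomorphism_def)
  have y: "y \<in> L" "y \<in> V" using L(3) assms(2) U(2) by (auto simp: y_def)
  have \<Psi>y: "\<Psi> y = p" using hom(1) U(2) by (simp add: y_def)
  obtain A where A: "(\<Phi> has_derivative A) (at p)" using real_analytic_at_differentiable[OF an(1)[OF U(2)]] .
  obtain B where B: "(\<Psi> has_derivative B) (at y)" using real_analytic_at_differentiable[OF an(2)[OF y(2)]] .
  have "((\<Phi> \<circ> \<Psi>) has_derivative (A \<circ> B)) (at y)"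
    by (rule diff_chain_at[OF B]) (use A \<Psi>y in simp)
  moreover have "((\<Phi> \<circ> \<Psi>) has_derivative id) (at y)"
    by (rule has_derivative_transform_within_open[OF has_derivative_id U(3) y(2)]) (use hom in auto)
  ultimately have AB: "A \<circ> B = id"
    by (rule has_derivative_unique)
  have linB: "linear B" using B has_derivative_linear by blast
  have injB: "inj B" using AB by (metis inj_on_id inj_on_imageI2)
  show ?thesis
  proof
    show "subspace (B ` L)" by (rule linear_subspace_image[OF linB L(1)])
    show "dim (B ` L) = d"
      using dim_image_eq[OF linB inj_on_subset[OF injB]] L(2) by auto
    show "B ` L \<subseteq> tangent_space M p"
    proof
      fix v assume "v \<in> B ` L"
      then obtain l where l: "l \<in> L" "v = B l" by blast
      define c where "c = (\<lambda>t :: real. \<Psi> (y + t *\<^sub>R l))"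
      have lim: "((\<lambda>t :: real. y + t *\<^sub>R l) \<longlongrightarrow> y + 0 *\<^sub>R l) (nhds 0)"
        by (intro tendsto_intros filterlim_ident)
      have "\<forall>\<^sub>F t in nhds (0 :: real). y + t *\<^sub>R l \<in> V"
        using topological_tendstoD[OF lim U(3)] y(2) by simp
      then have "\<forall>\<^sub>F t in nhds (0 :: real). c t \<in> M"
      proof eventually_elim
        case (elim t)
        have "y + t *\<^sub>R l \<in> L" by (intro subspace_add[OF L(1)] subspace_scale[OF L(1)] y l)
        then obtain m where "m \<in> M \<inter> U" "y + t *\<^sub>R l = \<Phi> m" using elim L(3) by blast
        then show "c t \<in> M" using hom(1) by (simp add: c_def)
      qed
      moreover have "(c has_vector_derivative v) (at 0)"
      proof -
        have "((\<lambda>t. \<Psi> (y + t *\<^sub>R l)) has_derivative (\<lambda>t. B (t *\<^sub>R l))) (at 0)"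
          by (rule has_derivative_compose[of "\<lambda>t. y + t *\<^sub>R l" _ _ _ \<Psi> B])
             (use B in \<open>auto intro!: derivative_eq_intros\<close>)
        then show ?thesis
          by (simp add: has_vector_derivative_def c_def l linear_scale[OF linB])
      qed
      moreover have "c 0 = p" by (simp add: c_def \<Psi>y)
      ultimately show "v \<in> tangent_space M p"
        unfolding tangent_space_def by blast
    qed
  qed
qed

section \<open>Conjugation\<close>

text \<open>
  The embedding \<open>(z, w) \<mapsto> (cnj z, z, w)\<close>.
\<close>

definition real_point :: "(complex ^ 'n) \<times> (complex ^ 'k) \<Rightarrow> complex ^ (('n + 'n) + 'k)" where
  "real_point p = vjoin (vjoin (vec_cnj (fst p)) (fst p)) (snd p)"

lemma real_point_nth [simp]:
  "real_point p $ Inl (Inl i) = cnj (fst p $ i)" "real_point p $ Inl (Inr i) = fst p $ i"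
  "real_point p $ Inr l = snd p $ l"
  by (simp_all add: real_point_def vec_cnj_def)

lemma bounded_linear_real_point: "bounded_linear (real_point :: (complex ^ 'n) \<times> (complex ^ 'k) \<Rightarrow> _)"
proof -
  have "linear (real_point :: (complex ^ 'n) \<times> (complex ^ 'k) \<Rightarrow> _)"
  proof (rule linearI)
    show "real_point (x + y) = real_point x + real_point y" for x y :: "(complex ^ 'n) \<times> (complex ^ 'k)"
      by (simp add: real_point_def vjoin_def vec_cnj_def vec_eq_iff split: sum.splits)
    show "real_point (c *\<^sub>R x) = c *\<^sub>R real_point x" for c and x :: "(complex ^ 'n) \<times> (complex ^ 'k)"
      by (simp add: real_point_def vjoin_def vec_cnj_def vec_eq_iff split: sum.splits)
  qed
  then show ?thesis by (simp add: linear_conv_bounded_linear)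
qed

lemma real_point_0 [simp]: "real_point 0 = 0"
  by (rule linear_0[OF bounded_linear.linear[OF bounded_linear_real_point]])

lemma real_point_has_derivative: "(real_point has_derivative real_point) (at p)"
  by (rule bounded_linear_imp_has_derivative[OF bounded_linear_real_point])

lemma eventually_real_point:
  assumes "\<forall>\<^sub>F x in nhds 0. P x" shows "\<forall>\<^sub>F p in nhds 0. P (real_point p)"
proof -
  have "(real_point \<longlongrightarrow> real_point 0) (nhds 0)"
    by (rule bounded_linear.tendsto[OF bounded_linear_real_point filterlim_ident])
  then show ?thesis using eventually_compose_filterlim[OF assms] by simp
qed

lemma ps_eval_bar: "ps_eval (ps_bar a) (vec_cnj x) = cnj (ps_eval a x)"
proof -
  have "mpow (vec_cnj x) \<delta> = cnj (mpow x \<delta>)" for \<delta> by (simp add: mpow_def vec_cnj_def)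
  then show ?thesis
    unfolding ps_eval_def ps_bar_def infsum_cnj[symmetric] by simp
qed

lemma cnj_mfact [simp]: "cnj (mfact \<delta>) = mfact \<delta>"
  by (simp add: mfact_def)

lemma ps_bar_deriv: "ps_deriv \<gamma> (ps_bar a) = ps_bar (ps_deriv \<gamma> a)"
  by (simp add: ps_deriv_def ps_bar_def fun_eq_iff)

lemma calA_cnj: "calA (\<lambda>j \<alpha> \<beta>. cnj (X j \<alpha> \<beta>)) \<alpha> \<beta> \<gamma> = cnj (calA X \<alpha> \<beta> \<gamma>)"
  by (simp add: calA_def case_prod_unfold)

lemma det_rhs_conj_eq: "det_rhs_conj X Z W j \<alpha> \<beta> (vec_cnj w) = cnj (det_rhs X Z W j \<alpha> \<beta> w)"
  unfolding det_rhs_conj_def det_rhs_def Let_def ps_bar_deriv ps_eval_bar calA_cnj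
  by (simp add: case_prod_unfold flip: infsum_cnj)

lemma vec_cnj_vec_cnj [simp]: "vec_cnj (vec_cnj w) = w"
  by (simp add: vec_cnj_def)

lemma eventually_vec_cnj:
  assumes "\<forall>\<^sub>F w in nhds 0. P w" shows "\<forall>\<^sub>F w in nhds 0. P (vec_cnj w)"
proof -
  have "((\<lambda>w. vec_cnj w) \<longlongrightarrow> vec_cnj 0) (nhds 0)"
    unfolding vec_cnj_def by (intro tendsto_intros filterlim_ident)
  moreover have "vec_cnj 0 = 0" by (simp add: vec_cnj_def vec_eq_iff)
  ultimately show ?thesis using eventually_compose_filterlim[OF assms] by metis
qed

lemma det_rhs_conj_iff:
  "(\<forall>\<^sub>F w in nhds 0. det_rhs_conj X Z W j \<alpha> \<beta> w = 0) \<longleftrightarrow> (\<forall>\<^sub>F w in nhds 0. det_rhs X Z W j \<alpha> \<beta> w = 0)"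
proof
  assume "\<forall>\<^sub>F w in nhds 0. det_rhs_conj X Z W j \<alpha> \<beta> w = 0"
  from eventually_vec_cnj[OF this] show "\<forall>\<^sub>F w in nhds 0. det_rhs X Z W j \<alpha> \<beta> w = 0"
    by (simp add: det_rhs_conj_eq)
next
  assume "\<forall>\<^sub>F w in nhds 0. det_rhs X Z W j \<alpha> \<beta> w = 0"
  from eventually_vec_cnj[OF this]
  show "\<forall>\<^sub>F w in nhds 0. det_rhs_conj X Z W j \<alpha> \<beta> w = 0"
    by (subst (asm) complex_cnj_zero_iff[symmetric]) (simp flip: det_rhs_conj_eq)
qed

section \<open>The tangent spaces of M\<close>

definition defining_fun :: "('k::finite \<Rightarrow> nat ^ 'n::finite \<Rightarrow> nat ^ 'n \<Rightarrow> 'k series) \<Rightarrow> 'k \<Rightarrow>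
    (complex ^ 'n) \<times> (complex ^ 'k) \<Rightarrow> complex" where
  "defining_fun X j p = cnj (snd p $ j) - snd p $ j - ps_eval (defining_series X j) (real_point p)"

text \<open>
  The differential of \<open>defining_fun\<close>, written with the formal partial derivatives of the series.
\<close>

definition d_defining :: "('k::finite \<Rightarrow> nat ^ 'n::finite \<Rightarrow> nat ^ 'n \<Rightarrow> 'k series) \<Rightarrow> 'k \<Rightarrow>
    (complex ^ 'n) \<times> (complex ^ 'k) \<Rightarrow> (complex ^ 'n) \<times> (complex ^ 'k) \<Rightarrow> complex" where
  "d_defining X j p v = cnj (snd v $ j) - snd v $ j
     - (\<Sum>i\<in>UNIV. ps_eval (ps_deriv (axis i 1) (defining_series X j)) (real_point p) * real_point v $ i)"

lemma defining_has_derivative: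
  fixes X :: "'k::finite \<Rightarrow> nat ^ 'n::finite \<Rightarrow> nat ^ 'n \<Rightarrow> 'k series"
  assumes "R > 0" "abs_conv R (defining_series X j)" "real_point p \<in> polydisc (R / 2)"
  shows "(defining_fun X j has_derivative d_defining X j p) (at p)"
proof -
  have d: "(ps_eval (defining_series X j) has_derivative
      (\<lambda>h. \<Sum>i\<in>UNIV. ps_eval (ps_deriv (axis i 1) (defining_series X j)) (real_point p) * h $ i)) (at (real_point p))"
    by (rule ps_eval_has_derivative[of "R / 2" "R / 2"]) (use assms in auto)
  have "((\<lambda>p. ps_eval (defining_series X j) (real_point p)) has_derivative
      (\<lambda>v. \<Sum>i\<in>UNIV. ps_eval (ps_deriv (axis i 1) (defining_series X j)) (real_point p) * real_point v $ i)) (at p)"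
    by (rule has_derivative_compose[OF real_point_has_derivative d])
  moreover have "bounded_linear (\<lambda>p :: (complex ^ 'n) \<times> (complex ^ 'k). cnj (snd p $ j) - snd p $ j)"
    by (intro bounded_linear_sub bounded_linear_compose[OF bounded_linear_cnj]
        bounded_linear_compose[OF bounded_linear_vec_nth bounded_linear_snd])
  ultimately show ?thesis
    unfolding defining_fun_def[abs_def] d_defining_def[abs_def]
    by (intro has_derivative_diff bounded_linear_imp_has_derivative)
qed

lemma subspace_d_defining: "subspace {v. \<forall>j. d_defining X j p v = 0}"
proof -
  have "linear (d_defining X j p)" for j
  proof -
    have "linear (\<lambda>v. real_point v $ i)" for i
      by (intro bounded_linear.linear bounded_linear_compose[OF bounded_linear_vec_nth bounded_linear_real_point])
    then have r: "real_point (x + y) $ i = real_point x $ i + real_point y $ i"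
      "real_point (c *\<^sub>R x) $ i = c *\<^sub>R (real_point x $ i)" for x y c i
      using linear_add linear_scale by blast+
    show ?thesis
      by (rule linearI) (simp_all add: d_defining_def r algebra_simps sum.distrib scaleR_sum_right)
  qed
  then show ?thesis
    by (simp add: subspace_def linear_0 linear_add linear_scale)
qed

text \<open>
  The kernel meets the \<open>k\<close>-dimensional space of vectors \<open>(0, y)\<close> with real \<open>y\<close> only in \<open>0\<close>: there
  the differential is \<open>2 y\<^sub>j\<close> up to a sum of \<open>k\<close> terms of size at most \<open>max \<bar>y\<bar> / k\<close>, so that it
  does not vanish for an index \<open>j\<close> with \<open>\<bar>y\<^sub>j\<bar>\<close> maximal.
\<close>

lemma dim_kernel_le:
  fixes X :: "'k::finite \<Rightarrow> nat ^ 'n::finite \<Rightarrow> nat ^ 'n \<Rightarrow> 'k series"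
  assumes small: "\<And>j l. norm (ps_eval (ps_deriv (axis (Inr l) 1) (defining_series X j)) (real_point p) + 2 * of_bool (l = j)) < 1 / CARD('k)"
  shows "dim {v :: (complex ^ 'n) \<times> (complex ^ 'k). \<forall>j. d_defining X j p v = 0} \<le> 2 * CARD('n) + CARD('k)"
proof -
  let ?K = "{v :: (complex ^ 'n) \<times> (complex ^ 'k). \<forall>j. d_defining X j p v = 0}"
  define g where "g = (\<lambda>y :: real ^ 'k. (0 :: complex ^ 'n, \<chi> j. complex_of_real (y $ j)))"
  have ling: "linear g"
    by (rule linearI) (auto simp: g_def vec_eq_iff complex_eq_iff)
  have injg: "inj g"
    by (auto simp: g_def inj_def vec_eq_iff)
  have subG: "subspace (range g)" by (rule linear_subspace_image[OF ling subspace_UNIV])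
  have dimG: "dim (range g) = CARD('k)"
    using dim_image_eq[OF ling, of UNIV] injg by simp
  have zero: "y = 0" if y: "g y \<in> ?K" for y
  proof (rule ccontr)
    assume "y \<noteq> 0"
    define m where "m = Max (range (\<lambda>j. \<bar>y $ j\<bar>))"
    have m: "\<bar>y $ j\<bar> \<le> m" for j unfolding m_def by (rule Max_ge) auto
    have "m \<in> range (\<lambda>j. \<bar>y $ j\<bar>)" unfolding m_def by (rule Max_in) auto
    then obtain j where j: "m = \<bar>y $ j\<bar>" by blast
    have mpos: "m > 0"
    proof -
      obtain i where "y $ i \<noteq> 0" using \<open>y \<noteq> 0\<close> by (auto simp: vec_eq_iff)
      then show ?thesis using m[of i] by linarith
    qed
    let ?D = "\<lambda>l. ps_eval (ps_deriv (axis (Inr l) 1) (defining_series X j)) (real_point p)"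
    have "(\<Sum>l\<in>UNIV. ?D l * y $ l) = 0"
      using y by (simp add: d_defining_def g_def UNIV_sum_split)
    moreover have "(\<Sum>l\<in>UNIV. 2 * of_bool (l = j) * complex_of_real (y $ l)) = 2 * y $ j"
      by (simp add: of_bool_def if_distrib if_distribR cong: if_cong)
    ultimately have "2 * complex_of_real (y $ j) = (\<Sum>l\<in>UNIV. (?D l + 2 * of_bool (l = j)) * y $ l)"
      by (simp add: distrib_right sum.distrib)
    then have "2 * m = norm (\<Sum>l\<in>UNIV. (?D l + 2 * of_bool (l = j)) * y $ l)"
      by (metis j norm_mult norm_numeral norm_of_real)
    also have "\<dots> \<le> (\<Sum>l\<in>(UNIV :: 'k set). (1 / CARD('k)) * m)"
    proof (rule sum_norm_le)
      fix l
      show "norm ((?D l + 2 * of_bool (l = j)) * y $ l) \<le> (1 / CARD('k)) * m"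
        unfolding norm_mult norm_of_real by (intro mult_mono less_imp_le[OF small] m) auto
    qed
    also have "\<dots> = m" by simp
    finally show False using mpos by simp
  qed
  have int: "?K \<inter> range g = {0}"
  proof
    show "?K \<inter> range g \<subseteq> {0}"
      using zero linear_0[OF ling] by fastforce
    show "{0} \<subseteq> ?K \<inter> range g"
      using subspace_0[OF subspace_d_defining, of X p] subspace_0[OF subG] by auto
  qed
  have "dim {x + y |x y. x \<in> ?K \<and> y \<in> range g} + dim (?K \<inter> range g) = dim ?K + dim (range g)"
    by (rule dim_sums_Int[OF subspace_d_defining subG])
  then have "dim ?K + CARD('k) = dim {x + y |x y. x \<in> ?K \<and> y \<in> range g}"
    unfolding int dimG by simp
  also have "\<dots> \<le> DIM((complex ^ 'n) \<times> (complex ^ 'k))" by (rule dim_subset_UNIV)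
  finally show ?thesis by simp
qed

text \<open>
  As \<open>\<Xi>\<^sub>j\<close> is quadratically small, \<open>-2 w\<^sub>j\<close> is the linear part of the series.
\<close>

lemma derivative_at_0:
  fixes X :: "'k::finite \<Rightarrow> nat ^ 'n::finite \<Rightarrow> nat ^ 'n \<Rightarrow> 'k series"
    and Xi :: "(complex ^ 'n) \<times> (complex ^ 'n) \<times> (complex ^ 'k) \<Rightarrow> complex ^ 'k"
  assumes R: "R > 0" "abs_conv R (defining_series X j)"
    and eq: "\<And>\<zeta> z w. \<zeta> \<in> polydisc R \<Longrightarrow> z \<in> polydisc R \<Longrightarrow> w \<in> polydisc R \<Longrightarrow>
       - 2 * w $ j + Xi (\<zeta>, z, w) $ j = ps_eval (defining_series X j) (vjoin (vjoin \<zeta> z) w)"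
    and O2: "(\<lambda>p. norm (Xi p $ j)) \<in> O[nhds 0](\<lambda>p. norm p ^ 2)"
  shows defining_series_0: "defining_series X j 0 = 0"
    and defining_series_deriv_0: "ps_eval (ps_deriv (axis v 1) (defining_series X j)) 0 = (if v = Inr j then - 2 else 0)"
proof -
  obtain C where C: "C > 0" "\<forall>\<^sub>F p in nhds 0. norm (Xi p $ j) \<le> C * norm p ^ 2"
    using O2 by (auto elim!: landau_o.bigE)
  obtain e where e: "e > 0" "\<And>p. norm p < e \<Longrightarrow> norm (Xi p $ j) \<le> C * norm p ^ 2"
    using C(2) unfolding eventually_nhds_metric by (auto simp: dist_norm)
  have Xi0: "Xi 0 $ j = 0" using e(2)[of 0] e(1) by simp
  have "ps_eval (defining_series X j) (vjoin (vjoin 0 0) 0) = 0"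
    using eq[of 0 0 0] R(1) Xi0 by (simp add: zero_prod_def)
  then show z0: "defining_series X j 0 = 0" by simp
  let ?a = "defining_series X j"
  let ?f = "\<lambda>x :: complex ^ (('n + 'n) + 'k). ps_eval ?a x + 2 * x $ Inr j"
  have "(?f has_derivative (\<lambda>h. 0)) (at 0)"
  proof (rule has_derivative_quadratic)
    show "min R (e / 3) > 0" using R(1) e(1) by simp
    fix h :: "complex ^ (('n + 'n) + 'k)" assume h: "norm h < min R (e / 3)"
    let ?\<zeta> = "vfst (vfst h)" and ?z = "vsnd (vfst h)" and ?w = "vsnd h"
    have hp: "h \<in> polydisc R" using h by (intro norm_in_polydisc) simp
    then have "vjoin (vjoin ?\<zeta> ?z) ?w \<in> polydisc R" by simp
    then have pd: "?\<zeta> \<in> polydisc R" "?z \<in> polydisc R" "?w \<in> polydisc R"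
      unfolding vjoin_in_polydisc by auto
    have f: "?f h = Xi (?\<zeta>, ?z, ?w) $ j"
      using eq[OF pd] by (simp add: vfst_vsnd_nth algebra_simps)
    have nf: "norm (vfst x) \<le> norm x" "norm (vsnd x) \<le> norm x" for x :: "complex ^ ('p::finite + 'q::finite)"
    proof -
      have "(norm (vfst x))\<^sup>2 + (norm (vsnd x))\<^sup>2 = (norm x)\<^sup>2"
        by (simp add: norm_vec_def L2_set_def sum_nonneg UNIV_sum_split vfst_vsnd_nth)
      then have "(norm (vfst x))\<^sup>2 \<le> (norm x)\<^sup>2" "(norm (vsnd x))\<^sup>2 \<le> (norm x)\<^sup>2"
        using zero_le_power2[of "norm (vfst x)"] zero_le_power2[of "norm (vsnd x)"] by linarith+
      then show "norm (vfst x) \<le> norm x" "norm (vsnd x) \<le> norm x"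
        by (auto intro: power2_le_imp_le)
    qed
    have "norm (?\<zeta>, ?z, ?w) \<le> norm ?\<zeta> + (norm ?z + norm ?w)"
      using norm_Pair_le[of ?\<zeta> "(?z, ?w)"] norm_Pair_le[of ?z ?w] by linarith
    also have "\<dots> \<le> 3 * norm h"
      using nf(1)[of "vfst h"] nf(2)[of "vfst h"] nf(1)[of h] nf(2)[of h] by linarith
    finally have n3: "norm (?\<zeta>, ?z, ?w) \<le> 3 * norm h" .
    then have "norm (Xi (?\<zeta>, ?z, ?w) $ j) \<le> C * norm (?\<zeta>, ?z, ?w) ^ 2"
      using h by (intro e(2)) simp
    also have "\<dots> \<le> C * (3 * norm h) ^ 2"
      using n3 C(1) by (intro mult_left_mono power_mono) auto
    finally show "norm (?f (0 + h) - ?f 0 - 0) \<le> (9 * C) * norm h ^ 2"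
      using f z0 by (simp add: power_mult_distrib)
  qed auto
  moreover have "(?f has_derivative (\<lambda>h. (\<Sum>i\<in>UNIV. ps_eval (ps_deriv (axis i 1) ?a) 0 * h $ i) + 2 * h $ Inr j)) (at 0)"
  proof (rule has_derivative_add)
    show "(ps_eval ?a has_derivative (\<lambda>h. \<Sum>i\<in>UNIV. ps_eval (ps_deriv (axis i 1) ?a) 0 * h $ i)) (at 0)"
      by (rule ps_eval_has_derivative[of "R / 2" "R / 2"]) (use R in auto)
    show "((\<lambda>x :: complex ^ (('n + 'n) + 'k). 2 * x $ Inr j) has_derivative (\<lambda>h. 2 * h $ Inr j)) (at 0)"
      by (intro bounded_linear_imp_has_derivative bounded_linear_const_mult bounded_linear_vec_nth)
  qed
  ultimately have "(\<lambda>h. 0) = (\<lambda>h :: complex ^ (('n + 'n) + 'k).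
      (\<Sum>i\<in>UNIV. ps_eval (ps_deriv (axis i 1) ?a) 0 * h $ i) + 2 * h $ Inr j)"
    by (rule has_derivative_unique)
  from fun_cong[OF this, of "axis v 1"]
  have "ps_eval (ps_deriv (axis v 1) ?a) 0 + 2 * axis v 1 $ Inr j = 0"
    by (simp add: axis_def if_distrib cong: if_cong)
  moreover have "axis v (1 :: complex) $ Inr j = (if v = Inr j then 1 else 0)"
    by (simp add: axis_def)
  ultimately show "ps_eval (ps_deriv (axis v 1) ?a) 0 = (if v = Inr j then - 2 else 0)"
    by (cases "v = Inr j") (simp_all add: eq_neg_iff_add_eq_0)
qed

text \<open>
  On \<open>M\<close>, \<open>w + X\<close> is the conjugate of \<open>w\<close>, and a series with conjugated coefficients
  takes at conjugate points the conjugate values.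
\<close>

lemma d_defining_eq_tangency:
  fixes X :: "'k::finite \<Rightarrow> nat ^ 'n::finite \<Rightarrow> nat ^ 'n \<Rightarrow> 'k series"
  assumes M: "\<And>j. defining_fun X j p = 0"
    and Z: "\<And>i. Zp $ i = ps_eval (sjoin (Z i)) (vjoin (fst p) (snd p))"
    and W: "\<And>l. Wp $ l = ps_eval (sjoin (W l)) (vjoin (fst p) (snd p))"
  shows "d_defining X j p (Zp, Wp) = tangency X Z W j (real_point p)"
proof -
  have w': "snd p + (\<chi> l. ps_eval (defining_series X l) (real_point p)) = vec_cnj (snd p)"
    using M by (simp add: defining_fun_def vec_eq_iff vec_cnj_def algebra_simps)
  have cj: "vjoin (vec_cnj (fst p)) (vec_cnj (snd p)) = vec_cnj (vjoin (fst p) (snd p))"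
    by (simp add: vec_sum_eq_iff vec_cnj_def)
  have parts: "vfst (vfst (real_point p)) = vec_cnj (fst p)" "vsnd (vfst (real_point p)) = fst p"
    "vsnd (real_point p) = snd p"
    by (simp_all add: real_point_def)
  show ?thesis
    unfolding tangency_def Let_def parts w' cj ps_eval_bar Z[symmetric] W[symmetric]
    by (simp add: d_defining_def UNIV_sum_split algebra_simps)
qed

lemma common_radius:
  fixes P :: "'i::finite \<Rightarrow> real \<Rightarrow> bool"
  assumes "\<And>i. \<exists>r>0. \<forall>r'. 0 < r' \<and> r' \<le> r \<longrightarrow> P i r'"
  obtains r where "r > 0" "\<And>i r'. 0 < r' \<Longrightarrow> r' \<le> r \<Longrightarrow> P i r'"
proof -
  obtain R where R: "\<And>i. R i > 0" "\<And>i r'. 0 < r' \<Longrightarrow> r' \<le> R i \<Longrightarrow> P i r'"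
    using assms by metis
  show ?thesis
    by (rule that[of "Min (range R)"]) (use R in auto)
qed

text \<open>
  The function \<open>\<rho>\<^sub>j\<close> is zero along a curve in \<open>M\<close>, hence so is its derivative in the direction of the velocity.
\<close>

lemma tangent_space_subset_kernel:
  fixes X :: "'k::finite \<Rightarrow> nat ^ 'n::finite \<Rightarrow> nat ^ 'n \<Rightarrow> 'k series"
  assumes N: "open N" "p \<in> N" "\<And>q. q \<in> N \<Longrightarrow> q \<in> M \<Longrightarrow> defining_fun X j q = 0"
    and d: "(defining_fun X j has_derivative d_defining X j p) (at p)"
    and v: "v \<in> tangent_space M p"
  shows "d_defining X j p v = 0"
proof -
  obtain c where c: "c 0 = p" "\<forall>\<^sub>F t in nhds (0 :: real). c t \<in> M" "(c has_vector_derivative v) (at 0)"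
    using v unfolding tangent_space_def by blast
  have lin: "linear (d_defining X j p)" using d has_derivative_linear by blast
  have 1: "((\<lambda>t. defining_fun X j (c t)) has_derivative (\<lambda>t. d_defining X j p (t *\<^sub>R v))) (at 0)"
    by (rule has_derivative_compose[OF c(3)[unfolded has_vector_derivative_def]]) (use d c(1) in simp)
  have "isCont c 0" by (rule has_vector_derivative_continuous[OF c(3)])
  then have lim: "(c \<longlongrightarrow> c 0) (nhds 0)"
    by (simp add: continuous_at tendsto_at_iff_tendsto_nhds)
  have "\<forall>\<^sub>F t in nhds 0. c t \<in> N"
    by (rule topological_tendstoD[OF lim N(1)]) (use c(1) N(2) in simp)
  with c(2) have "\<forall>\<^sub>F t in nhds 0. defining_fun X j (c t) = 0"
    by eventually_elim (use N(3) in blast)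
  then have ev: "\<forall>\<^sub>F t in nhds 0. 0 = defining_fun X j (c t)"
    by (rule eventually_mono) simp
  have 2: "((\<lambda>t. defining_fun X j (c t)) has_derivative (\<lambda>t. 0)) (at 0)"
    by (rule has_derivative_transform_eventually[OF has_derivative_const[of 0]])
       (use ev eventually_nhds_x_imp_x[OF ev] in \<open>auto simp: eventually_at_filter elim: eventually_mono\<close>)
  have "(\<lambda>t. d_defining X j p (t *\<^sub>R v)) = (\<lambda>t. 0)"
    by (rule has_derivative_unique[OF 1 2])
  from fun_cong[OF this, of 1] show ?thesis by simp
qed

section \<open>The infinitesimal CR-automorphisms of M\<close>

text \<open>
  Every vector of \<open>tangent_space M 0\<close> is, by definition, the velocity at \<open>0\<close> of a curve in \<open>M\<close>, and
  \<open>real_point\<close> carries these velocities onto the totally real subspace of \<open>poly_zero_totally_real\<close>.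
\<close>

lemma zero_on_M_imp_zero:
  fixes X :: "'k::finite \<Rightarrow> nat ^ 'n::finite \<Rightarrow> nat ^ 'n \<Rightarrow> 'k series"
  assumes an: "analytic0 F"
    and T: "tangent_space M 0 = {(z :: complex ^ 'n, w :: complex ^ 'k). \<forall>j. cnj (w $ j) + w $ j = 0}"
    and zero: "\<forall>\<^sub>F p in nhds 0. p \<in> M \<longrightarrow> F (real_point p) = 0"
  shows "\<forall>\<^sub>F x in nhds 0. F x = 0"
proof -
  obtain r f where r: "r > 0" and f: "abs_conv r f" "\<And>x. x \<in> polydisc r \<Longrightarrow> F x = ps_eval f x"
    using an unfolding analytic0_def by blast
  have ev_r: "\<forall>\<^sub>F x in nhds 0. (x :: complex ^ (('n + 'n) + 'k)) \<in> polydisc r"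
    by (rule eventually_polydisc[OF r])
  have "f = (\<lambda>_. 0)"
  proof (rule ps_zero_on_curves[OF f(1) r, where T = "real_point ` tangent_space M 0"])
    fix K and b :: "nat ^ (('n + 'n) + 'k) \<Rightarrow> complex" and v
    assume K: "finite K" and z: "\<And>v. v \<in> real_point ` tangent_space M 0 \<Longrightarrow> (\<Sum>\<alpha>\<in>K. b \<alpha> * mpow v \<alpha>) = 0"
    show "(\<Sum>\<alpha>\<in>K. b \<alpha> * mpow v \<alpha>) = 0"
    proof (rule poly_zero_totally_real[OF K])
      fix z :: "complex ^ 'n" and w :: "complex ^ 'k" assume "\<And>j. cnj (w $ j) + w $ j = 0"
      then have "real_point (z, w) \<in> real_point ` tangent_space M 0"
        unfolding T by blast
      from z[OF this] show "(\<Sum>\<alpha>\<in>K. b \<alpha> * mpow (vjoin (vjoin (vec_cnj z) z) w) \<alpha>) = 0"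
        by (simp add: real_point_def)
    qed
  next
    fix v assume "v \<in> real_point ` tangent_space M 0"
    then obtain u where u: "v = real_point u" "u \<in> tangent_space M 0" by blast
    then obtain c where c: "c 0 = 0" "\<forall>\<^sub>F t in nhds (0 :: real). c t \<in> M" "(c has_vector_derivative u) (at 0)"
      unfolding tangent_space_def by blast
    have "isCont c 0" by (rule has_vector_derivative_continuous[OF c(3)])
    then have lim: "(c \<longlongrightarrow> 0) (nhds 0)"
      using c(1) by (metis continuous_at tendsto_at_iff_tendsto_nhds)
    have "\<forall>\<^sub>F t in nhds 0. c t \<in> M \<longrightarrow> F (real_point (c t)) = 0"
      by (rule eventually_compose_filterlim[OF zero lim])
    moreover have "\<forall>\<^sub>F t in nhds 0. real_point (c t) \<in> polydisc r"
      by (rule eventually_compose_filterlim[OF eventually_real_point[OF ev_r] lim])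
    ultimately have "\<forall>\<^sub>F t in nhds 0. ps_eval f (real_point (c t)) = 0"
      using c(2) by eventually_elim (simp add: f(2)[symmetric])
    moreover have "((\<lambda>t. real_point (c t)) has_vector_derivative v) (at 0)"
      unfolding u(1) by (rule bounded_linear.has_vector_derivative[OF bounded_linear_real_point c(3)])
    ultimately show "\<exists>c. c 0 = 0 \<and> (c has_vector_derivative v) (at 0) \<and> (\<forall>\<^sub>F t in nhds (0 :: real). ps_eval f (c t) = 0)"
      using c(1) by (intro exI[of _ "\<lambda>t. real_point (c t)"]) simp
  qed
  then show ?thesis
    using ev_r by (auto simp: f(2) elim: eventually_mono)
qed

lemma eventually_deriv_close:
  fixes X :: "'k::finite \<Rightarrow> nat ^ 'n::finite \<Rightarrow> nat ^ 'n \<Rightarrow> 'k series"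
  assumes "R > 0" "abs_conv R (defining_series X j)" "e > 0"
    and "ps_eval (ps_deriv (axis (Inr l) 1) (defining_series X j)) 0 = - 2 * of_bool (l = j)"
  shows "\<forall>\<^sub>F p in nhds 0. norm (ps_eval (ps_deriv (axis (Inr l) 1) (defining_series X j)) (real_point p) + 2 * of_bool (l = j)) < e"
proof (rule eventually_real_point)
  let ?D = "ps_deriv (axis (Inr l) 1) (defining_series X j)"
  have "abs_conv (R / 2) ?D"
    by (rule abs_conv_ps_deriv[of "R / 2" "R / 2" _ 0]) (use assms in auto)
  then have "(ps_eval ?D has_derivative (\<lambda>h. \<Sum>i\<in>UNIV. ps_eval (ps_deriv (axis i 1) ?D) 0 * h $ i)) (at 0)"
    by (intro ps_eval_has_derivative[of "R / 4" "R / 4"]) (use assms in auto)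
  then have "isCont (ps_eval ?D) 0" by (rule has_derivative_continuous)
  then have "(ps_eval ?D \<longlongrightarrow> ps_eval ?D 0) (nhds 0)"
    by (simp only: continuous_at tendsto_at_iff_tendsto_nhds)
  from tendstoD[OF this assms(3)]
  show "\<forall>\<^sub>F x in nhds 0. norm (ps_eval ?D x + 2 * of_bool (l = j)) < e"
    unfolding assms(4) by (simp add: dist_norm)
qed

theorem theorem4p1:
  fixes M :: "((complex ^ 'n) \<times> (complex ^ 'k)) set"
    and Xi :: "(complex ^ 'n) \<times> (complex ^ 'n) \<times> (complex ^ 'k) \<Rightarrow> complex ^ 'k"
    and Xt :: "'k \<Rightarrow> nat ^ 'n \<Rightarrow> nat ^ 'n \<Rightarrow> 'k series"
    and Z :: "(complex ^ 'n) \<times> (complex ^ 'k) \<Rightarrow> complex ^ 'n"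
    and W :: "(complex ^ 'n) \<times> (complex ^ 'k) \<Rightarrow> complex ^ 'k"
    and Zc :: "'n \<Rightarrow> nat ^ 'n \<Rightarrow> 'k series"
    and Wc :: "'k \<Rightarrow> nat ^ 'n \<Rightarrow> 'k series"
  assumes "0 \<in> M"
    and "real_analytic_submanifold (2 * CARD('n) + CARD('k)) M"
    and "CR_generic M"
    and "has_CR_dim CARD('n) M"
    and "tangent_space M 0 = {(z, w). \<forall>j. cnj (w $ j) + w $ j = 0}"
    and "\<forall>\<^sub>F (z, w) in nhds 0.
           (z, w) \<in> M \<longleftrightarrow> (\<forall>j. cnj (w $ j) + w $ j = Xi (vec_cnj z, z, w) $ j)"
    and "\<And>j. (\<lambda>p. norm (Xi p $ j)) \<in> O[nhds 0](\<lambda>p. norm p ^ 2)"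
    and "\<And>j. expands_zz (\<lambda>(\<zeta>, z, w). - 2 * w $ j + Xi (\<zeta>, z, w) $ j) (Xt j)"
    and "\<And>i. expands_z (\<lambda>p. Z p $ i) (Zc i)"
    and "\<And>l. expands_z (\<lambda>p. W p $ l) (Wc l)"
  shows "(Z, W) \<in> aut_CR M \<longleftrightarrow>
    (\<forall>j \<alpha> \<beta>. (\<forall>\<^sub>F w in nhds 0. det_rhs Xt Zc Wc j \<alpha> \<beta> w = 0) \<and>
             (\<forall>\<^sub>F w in nhds 0. det_rhs_conj Xt Zc Wc j \<alpha> \<beta> w = 0))"
proof -
  note M0 = assms(1) and Mman = assms(2) and T0 = assms(5) and Meq = assms(6) and O2 = assms(7)
    and Xexp = assms(8) and Zexp = assms(9) and Wexp = assms(10)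
  \<comment> \<open>the given expansions are valid on the polydisc of radius \<open>r\<close>\<close>
  define PX where "PX = (\<lambda>j r. abs_conv r (defining_series Xt j) \<and>
     (\<forall>\<zeta>\<in>polydisc r. \<forall>z\<in>polydisc r. \<forall>w\<in>polydisc r.
       - 2 * w $ j + Xi (\<zeta>, z, w) $ j = ps_eval (defining_series Xt j) (vjoin (vjoin \<zeta> z) w)))"
  define PF where "PF = (\<lambda>(f :: (complex ^ 'n) \<times> (complex ^ 'k) \<Rightarrow> complex) c r. abs_conv r (sjoin c) \<and>
     (\<forall>z\<in>polydisc r. \<forall>w\<in>polydisc r. f (z, w) = ps_eval (sjoin c) (vjoin z w)))"
  have PX: "\<exists>r>0. \<forall>r'. 0 < r' \<and> r' \<le> r \<longrightarrow> PX j r'" for j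
    using expands_zz_sjoin[OF Xexp[of j]] by (simp add: PX_def defining_series_def)
  have PF: "\<exists>r>0. \<forall>r'. 0 < r' \<and> r' \<le> r \<longrightarrow> PF f c r'" if "expands_z f c" for f c
    unfolding PF_def by (rule expands_z_sjoin[OF that])
  obtain R1 where R1: "R1 > 0" "\<And>j r'. 0 < r' \<Longrightarrow> r' \<le> R1 \<Longrightarrow> PX j r'"
    by (rule common_radius[of PX, OF PX]) (rule that; blast)
  obtain R2 where R2: "R2 > 0" "\<And>i r'. 0 < r' \<Longrightarrow> r' \<le> R2 \<Longrightarrow> PF (\<lambda>p. Z p $ i) (Zc i) r'"
    by (rule common_radius[of "\<lambda>i. PF (\<lambda>p. Z p $ i) (Zc i)", OF PF[OF Zexp]]) (rule that; blast)
  obtain R3 where R3: "R3 > 0" "\<And>l r'. 0 < r' \<Longrightarrow> r' \<le> R3 \<Longrightarrow> PF (\<lambda>p. W p $ l) (Wc l) r'"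
    by (rule common_radius[of "\<lambda>l. PF (\<lambda>p. W p $ l) (Wc l)", OF PF[OF Wexp]]) (rule that; blast)
  define R where "R = min R1 (min R2 R3)"
  have R: "R > 0" "R \<le> R1" "R \<le> R2" "R \<le> R3" using R1(1) R2(1) R3(1) by (auto simp: R_def)
  have X: "abs_conv R (defining_series Xt j)"
    "\<And>\<zeta> z w. \<zeta> \<in> polydisc R \<Longrightarrow> z \<in> polydisc R \<Longrightarrow> w \<in> polydisc R \<Longrightarrow>
        - 2 * w $ j + Xi (\<zeta>, z, w) $ j = ps_eval (defining_series Xt j) (vjoin (vjoin \<zeta> z) w)" for j
    using R1(2)[OF R(1,2), of j] unfolding PX_def by blast+
  have Zs: "abs_conv R (sjoin (Zc i))"
    "\<And>z w. z \<in> polydisc R \<Longrightarrow> w \<in> polydisc R \<Longrightarrow> Z (z, w) $ i = ps_eval (sjoin (Zc i)) (vjoin z w)" for i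
    using R2(2)[OF R(1,3), of i] unfolding PF_def by blast+
  have Ws: "abs_conv R (sjoin (Wc l))"
    "\<And>z w. z \<in> polydisc R \<Longrightarrow> w \<in> polydisc R \<Longrightarrow> W (z, w) $ l = ps_eval (sjoin (Wc l)) (vjoin z w)" for l
    using R3(2)[OF R(1,4), of l] unfolding PF_def by blast+
  have X0: "defining_series Xt j 0 = 0" for j
    by (rule defining_series_0[OF R(1) X(1) X(2) O2])
  have DX0: "ps_eval (ps_deriv (axis (Inr l) 1) (defining_series Xt j)) 0 = - 2 * of_bool (l = j)" for j l
    using defining_series_deriv_0[OF R(1) X(1) X(2) O2, where v = "Inr l"] by simp
  note tz = tangency_zero_iff_det[of R Xt Zc Wc, OF R(1) X(1) X0 Zs(1) Ws(1)]
  note ta = analytic0_tangency[of R Xt Zc Wc, OF R(1) X(1) X0 Zs(1) Ws(1)]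

  \<comment> \<open>the properties of points near \<open>0\<close> that make the tangent space equal to the kernel\<close>
  let ?good = "\<lambda>p. real_point p \<in> polydisc (R / 2) \<and> (p \<in> M \<longleftrightarrow> (\<forall>j. defining_fun Xt j p = 0)) \<and>
     (\<forall>j l. norm (ps_eval (ps_deriv (axis (Inr l) 1) (defining_series Xt j)) (real_point p) + 2 * of_bool (l = j)) < 1 / CARD('k))"
  have in_R: "fst p \<in> polydisc R" "snd p \<in> polydisc R" "vec_cnj (fst p) \<in> polydisc R"
    if "real_point p \<in> polydisc (R / 2)" for p
    using polydisc_mono[OF that, of R] R(1) unfolding real_point_def by auto
  have "\<forall>\<^sub>F p in nhds 0. real_point p \<in> polydisc (R / 2)"
    by (rule eventually_real_point[OF eventually_polydisc]) (use R in simp)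
  moreover have "\<forall>\<^sub>F p in nhds 0. \<forall>j l. norm (ps_eval (ps_deriv (axis (Inr l) 1) (defining_series Xt j)) (real_point p) + 2 * of_bool (l = j)) < 1 / CARD('k)"
    by (intro eventually_all_finite eventually_deriv_close[OF R(1) X(1) _ DX0]) simp
  ultimately have "\<forall>\<^sub>F p in nhds 0. ?good p"
    using Meq
  proof eventually_elim
    case (elim p)
    have "defining_fun Xt j p = cnj (snd p $ j) + snd p $ j - Xi (vec_cnj (fst p), fst p, snd p) $ j" for j
      unfolding defining_fun_def real_point_def X(2)[OF in_R(3,1,2)[OF elim(1)], of j, symmetric] by simp
    then show ?case using elim by (simp add: case_prod_unfold)
  qed
  then obtain N where N: "open N" "0 \<in> N" "\<And>p. p \<in> N \<Longrightarrow> ?good p"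
    unfolding eventually_nhds by blast
  have tan: "tangent_space M p = {v. \<forall>j. d_defining Xt j p v = 0}" if p: "p \<in> N" "p \<in> M" for p
  proof
    have der: "(defining_fun Xt j has_derivative d_defining Xt j p) (at p)" for j
      by (rule defining_has_derivative[OF R(1) X(1)]) (use N(3) p in blast)
    show sub: "tangent_space M p \<subseteq> {v. \<forall>j. d_defining Xt j p v = 0}"
      using tangent_space_subset_kernel[OF N(1) p(1) _ der] N(3) by blast
    obtain T where T: "subspace T" "dim T = 2 * CARD('n) + CARD('k)" "T \<subseteq> tangent_space M p"
      using tangent_space_contains_subspace[OF Mman p(2)] by blast
    have "dim {v. \<forall>j. d_defining Xt j p v = 0} \<le> dim T"
      unfolding T(2) by (rule dim_kernel_le) (use N(3)[OF p(1)] in blast)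
    then have "T = {v. \<forall>j. d_defining Xt j p v = 0}"
      using T sub by (intro subspace_dim_equal subspace_d_defining) auto
    then show "{v. \<forall>j. d_defining Xt j p v = 0} \<subseteq> tangent_space M p" using T(3) by simp
  qed
  have mem: "(Z p, W p) \<in> tangent_space M p \<longleftrightarrow> (\<forall>j. tangency Xt Zc Wc j (real_point p) = 0)"
    if p: "p \<in> N" "p \<in> M" for p
  proof -
    have g: "?good p" by (rule N(3)[OF p(1)])
    have "Z p $ i = ps_eval (sjoin (Zc i)) (vjoin (fst p) (snd p))"
      "W p $ l = ps_eval (sjoin (Wc l)) (vjoin (fst p) (snd p))" for i l
      using Zs(2)[OF in_R(1,2)[OF g[THEN conjunct1]]] Ws(2)[OF in_R(1,2)[OF g[THEN conjunct1]]] by simp_all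
    then have "d_defining Xt j p (Z p, W p) = tangency Xt Zc Wc j (real_point p)" for j
      using g p(2) by (intro d_defining_eq_tangency) auto
    then show ?thesis unfolding tan[OF p] by simp
  qed
  have "(Z, W) \<in> aut_CR M \<longleftrightarrow> (\<forall>\<^sub>F p in nhds 0. p \<in> M \<longrightarrow> (Z p, W p) \<in> tangent_space M p)"
    using Zexp Wexp by (auto simp: aut_CR_def holomorphic_germ_def conj_plus_vfield_10)
  also have "\<dots> \<longleftrightarrow> (\<forall>\<^sub>F p in nhds 0. p \<in> M \<longrightarrow> (\<forall>j. tangency Xt Zc Wc j (real_point p) = 0))"
    by (rule eventually_subst) (use mem eventually_nhds_in_open[OF N(1,2)] in \<open>auto elim: eventually_mono\<close>)
  also have "\<dots> \<longleftrightarrow> (\<forall>j. \<forall>\<^sub>F x in nhds 0. tangency Xt Zc Wc j x = 0)"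
  proof
    assume L: "\<forall>\<^sub>F p in nhds 0. p \<in> M \<longrightarrow> (\<forall>j. tangency Xt Zc Wc j (real_point p) = 0)"
    show "\<forall>j. \<forall>\<^sub>F x in nhds 0. tangency Xt Zc Wc j x = 0"
    proof
      fix j
      show "\<forall>\<^sub>F x in nhds 0. tangency Xt Zc Wc j x = 0"
        by (rule zero_on_M_imp_zero[OF ta T0]) (use L in \<open>auto elim: eventually_mono\<close>)
    qed
  next
    assume "\<forall>j. \<forall>\<^sub>F x in nhds 0. tangency Xt Zc Wc j x = 0"
    then have "\<forall>\<^sub>F p in nhds 0. \<forall>j. tangency Xt Zc Wc j (real_point p) = 0"
      by (intro eventually_all_finite eventually_real_point) blast
    then show "\<forall>\<^sub>F p in nhds 0. p \<in> M \<longrightarrow> (\<forall>j. tangency Xt Zc Wc j (real_point p) = 0)"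
      by (rule eventually_mono) simp
  qed
  also have "\<dots> \<longleftrightarrow> (\<forall>j \<alpha> \<beta>. \<forall>\<^sub>F w in nhds 0. det_rhs Xt Zc Wc j \<alpha> \<beta> w = 0)"
    using tz by simp
  finally show ?thesis
    by (simp add: det_rhs_conj_iff)
qed

end
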